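(* For each $k\geq 1$, the number of uniquely sorted affine sylvester classes of $\widetilde S_{2k}$, which is also the number of $231$-avoiding uniquely sorted affine permutations in $\widetilde S_{2k}$, is $$3\binom{4k}{k}-2\sum_{i=0}^{k}\binom{4k}{i}.$$
   Context: An affine permutation of size $n$ is a bijection $w:\mathbb Z\to\mathbb Z$ with $w(i+n)=w(i)+n$ for all $i\in\mathbb Z$ and $\sum_{i=1}^n w(i)=\binom{n+1}{2}$. They form the affine symmetric group $\widetilde S_n$ under composition, a Coxeter group with simple generators $\widetilde s_1,\ldots,\widetilde s_n$, where $\widetilde s_i$ swaps $i+mn$ and $i+mn+1$ for all $m\in\mathbb Z$ and fixes all other integers. The left weak order is $x\leq_L y\iff\ell(yx^{-1})=\ell(y)-\ell(x)$, $\ell$ being Coxeter length. Affine sylvester congruence. For $w\in\widetilde S_n$ define a partial order $\preceq_w$ on $\mathbb Z$ (positions): for $i<j$, the positions $i,j$ are incomparable if and only if there is $k$ with $i<k<j$ and $w(k)>\max\{w(i),w(j)\}$; otherwise the position with the smaller value of $w$ is below the other. (This is the descendant order of the decreasing affine binary plane tree with in-order reading $w$.) The affine sylvester congruence is $v\equiv_{\widetilde{\mathrm{syl}}}w\iff{\preceq_v}={\preceq_w}$; it is a semilattice congruence on $(\widetilde S_n,\leq_L)$ in which $\{e\}$ is a class, and each class (an "affine sylvester class") has a unique $\leq_L$-minimal element. Let $\pi_\downarrow(w)$ be the minimal element of the class of $w$. The affine stack-sorting map is $\widetilde{\mathtt s}:\widetilde S_n\to\widetilde S_n$, $\widetilde{\mathtt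 s}(w)=w\,(\pi_\downarrow(w))^{-1}$. An affine permutation $w$ is uniquely sorted if $\lvert\widetilde{\mathtt s}^{-1}(w)\rvert=1$. An affine sylvester class is uniquely sorted if its elements are uniquely sorted (the number $\lvert\widetilde{\mathtt s}^{-1}(w)\rvert$ depends only on the affine sylvester class of $w$). An affine permutation $w$ is $231$-avoiding if there are no $i<j<k$ in $\mathbb Z$ with $w(k)<w(i)<w(j)$. *)

theory Defs
  imports Complex_Main
begin

definition affine_perms :: "nat \<Rightarrow> (int \<Rightarrow> int) set" where
  "affine_perms n = {w. bij w \<and> (\<forall>i. w (i + int n) = w i + int n) \<and>
     (\<Sum>i=1..int n. w i) = int ((n + 1) choose 2)}"

text \<open>For \<open>n = 1\<close> this is a shift rather than an affine permutation, so it is only meaningful for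
  \<open>n \<ge> 2\<close>.\<close>

definition simple_gen :: "nat \<Rightarrow> nat \<Rightarrow> int \<Rightarrow> int" where
  "simple_gen n i x =
     (if \<exists>m. x = int i + m * int n then x + 1
      else if \<exists>m. x = int i + m * int n + 1 then x - 1
      else x)"

definition word_prod :: "nat \<Rightarrow> nat list \<Rightarrow> int \<Rightarrow> int" where
  "word_prod n is = foldr (\<lambda>i f. simple_gen n i \<circ> f) is id"

definition coxeter_length :: "nat \<Rightarrow> (int \<Rightarrow> int) \<Rightarrow> nat" where
  "coxeter_length n w =
     (LEAST l. \<exists>is. length is = l \<and> set is \<subseteq> {1..n} \<and> word_prod n is = w)"

definition left_weak_le :: "nat \<Rightarrow> (int \<Rightarrow> int) \<Rightarrow> (int \<Rightarrow> int) \<Rightarrow> bool" where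
  "left_weak_le n x y \<longleftrightarrow>
     int (coxeter_length n (y \<circ> inv x)) = int (coxeter_length n y) - int (coxeter_length n x)"

text \<open>The order on positions given by descent in the decreasing affine binary plane tree with
  in-order reading \<open>w\<close>; \<open>min\<close>/\<open>max\<close> make the criterion for \<open>i < j\<close> symmetric in \<open>i\<close> and \<open>j\<close>.\<close>

definition pos_incomparable :: "(int \<Rightarrow> int) \<Rightarrow> int \<Rightarrow> int \<Rightarrow> bool" where
  "pos_incomparable w i j \<longleftrightarrow>
     (\<exists>k. min i j < k \<and> k < max i j \<and> w k > max (w i) (w j))"

definition pos_le :: "(int \<Rightarrow> int) \<Rightarrow> int \<Rightarrow> int \<Rightarrow> bool" where
  "pos_le w i j \<longleftrightarrow> i = j \<or> (\<not> pos_incomparable w i j \<and> w i < w j)"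

definition syl_cong :: "nat \<Rightarrow> ((int \<Rightarrow> int) \<times> (int \<Rightarrow> int)) set" where
  "syl_cong n = {(v, w). v \<in> affine_perms n \<and> w \<in> affine_perms n \<and> pos_le v = pos_le w}"

definition syl_classes :: "nat \<Rightarrow> (int \<Rightarrow> int) set set" where
  "syl_classes n = affine_perms n // syl_cong n"

text \<open>Every class has exactly one \<open>left_weak_le\<close>-minimal element, so the description below
  is proper.\<close>

definition pi_down :: "nat \<Rightarrow> (int \<Rightarrow> int) \<Rightarrow> (int \<Rightarrow> int)" where
  "pi_down n w =
     (THE x. x \<in> syl_cong n `` {w} \<and>
        (\<forall>y \<in> syl_cong n `` {w}. left_weak_le n y x \<longrightarrow> y = x))"

definition affine_stack_sort :: "nat \<Rightarrow> (int \<Rightarrow> int) \<Rightarrow> (int \<Rightarrow> int)" where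
  "affine_stack_sort n w = w \<circ> inv (pi_down n w)"

definition uniquely_sorted :: "nat \<Rightarrow> (int \<Rightarrow> int) \<Rightarrow> bool" where
  "uniquely_sorted n w \<longleftrightarrow> card {v \<in> affine_perms n. affine_stack_sort n v = w} = 1"

definition uniquely_sorted_classes :: "nat \<Rightarrow> (int \<Rightarrow> int) set set" where
  "uniquely_sorted_classes n = {C \<in> syl_classes n. \<forall>w\<in>C. uniquely_sorted n w}"

definition avoids_231 :: "(int \<Rightarrow> int) \<Rightarrow> bool" where
  "avoids_231 w \<longleftrightarrow> \<not> (\<exists>i j k. i < j \<and> j < k \<and> w k < w i \<and> w i < w j)"

end

theory Submission
  imports Defs "HOL-Computational_Algebra.Computational_Algebra"
begin

text \<open>Preimages of \<open>w\<close> under affine stack-sorting correspond to periodic binary plane trees whose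
  nodes are numbered in post-order by the integers and along which \<open>w\<close> decreases from parents to
  children. Two local moves on such trees show that a tree can be the only one for \<open>w\<close> only if
  every internal node has two children and the leaves are exactly the labels preceded by a descent
  of \<open>w\<close>. The tree is then the noncrossing matching of the up-down pattern of \<open>w\<close>, and counting
  internal nodes shows conversely that a tree of this kind is unique.

  A sylvester class is determined by the map \<open>p\<close> sending a position to the next position with a
  larger value, and every periodic noncrossing \<open>p\<close> occurs. In these terms \<open>w\<close> is uniquely sorted
  if and only if its up-down pattern is balanced and \<open>p\<close> never jumps beyond the matching of this
  pattern. Cutting the pattern at its returns to the minimal level yields a catalytic equation for
  the series \<open>A\<close> of finite patterns (the one of Tamari intervals), solved by
  \<open>A = U\<^sup>2 (2 - U)\<close> with \<open>U = 1 + x U\<^sup>4\<close>. The periodic patterns have the series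
  \<open>2 x A'/A = 2 (U - 1)/(2 - U)\<close>, whose coefficients follow by expanding powers of \<open>U - 1\<close>.\<close>

section \<open>Affine permutations and their inversions\<close>

text \<open>Trees enter as follows. If \<open>v\<close> is the minimal element of the class of a
  preimage \<open>x\<close>, then \<open>x = w \<circ> v\<close>, and the only condition is that
  relabelling the tree of \<open>v\<close> by \<open>w\<close> keeps labels decreasing from parents
  to children. Minimal means 231-avoiding, and such \<open>v\<close> are exactly the in-order
  readings of trees labelled in post-order. These trees have an infinite left spine instead of a
  root, so nothing is defined by recursion from the top: inductions run on the distance of two
  labels or the length of an arc, and finiteness is recovered by counting modulo a period. In the
  count, an up step may jump to any point of its arch that no inner arc passes over. The number of
  choices depends on the inside, hence a second variable \<open>u\<close> marking these points. The
  resulting equation involves the value at \<open>u = 1\<close> but determines coefficients only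
  after division by \<open>u - 1\<close>; real polynomials and continuity at 1 resolve this. The
  series \<open>2 x A'/A\<close> comes from marking the arch over position 0: an arch of length
  \<open>2 j\<close> can be placed there in \<open>2 j\<close> ways, and the rest of the period is
  one finite pattern.\<close>

definition equivariant :: "nat \<Rightarrow> (int \<Rightarrow> int) \<Rightarrow> bool" where
  "equivariant n f \<longleftrightarrow> (\<forall>i. f (i + int n) = f i + int n)"

lemma equivariantD: "equivariant n f \<Longrightarrow> f (i + m * int n) = f i + m * int n"
proof (induction m rule: int_induct[where k = 0])
  case (step1 m)
  have "f (i + m * int n + int n) = f (i + m * int n) + int n"
    using step1.prems unfolding equivariant_def by blast
  moreover have "i + m * int n + int n = i + (m + 1) * int n" by (simp add: algebra_simps)
  ultimately show ?case using step1 by (simp add: algebra_simps)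
next
  case (step2 m)
  have "f (i + (m - 1) * int n + int n) = f (i + (m - 1) * int n) + int n"
    using step2.prems unfolding equivariant_def by blast
  moreover have "i + (m - 1) * int n + int n = i + m * int n" by (simp add: algebra_simps)
  ultimately show ?case using step2 by (simp add: algebra_simps)
qed simp

lemma residue_window:
  fixes x :: int
  assumes "n \<ge> 1"
  shows "x - (x - 1) div int n * int n \<in> {1..int n}"
proof -
  have "x - (x - 1) div int n * int n = (x - 1) mod int n + 1"
    by (simp add: minus_div_mult_eq_mod algebra_simps flip: minus_mult_div_eq_mod)
  moreover have "(x - 1) mod int n < int n" "(x - 1) mod int n \<ge> 0" using assms by simp_all
  ultimately show ?thesis by (simp only: atLeastAtMost_iff) linarith
qed

lemma residue_window_unique:
  fixes x :: int
  assumes "x \<in> {1..int n}" "x + m * int n \<in> {1..int n}"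
  shows "m = 0"
proof -
  have "\<bar>m * int n\<bar> < int n" using assms by auto
  then have "\<bar>m\<bar> * int n < 1 * int n" by (simp add: abs_mult)
  then have "\<bar>m\<bar> < 1" by (rule mult_right_less_imp_less) simp
  then show ?thesis by simp
qed

lemma sum_int_window: "(\<Sum>i=1..int n. i) = int ((n + 1) choose 2)"
proof (induction n)
  case (Suc n)
  have "{1..int (Suc n)} = insert (int n + 1) {1..int n}" by auto
  then show ?case using Suc by (simp add: numeral_2_eq_2)
qed simp

lemma affine_perms_iff:
  "w \<in> affine_perms n \<longleftrightarrow> bij w \<and> equivariant n w \<and> (\<Sum>i=1..int n. w i - i) = 0"
  by (simp add: affine_perms_def equivariant_def sum_subtractf sum_int_window)

text \<open>Equivariance turns injectivity of \<open>f\<close> into injectivity modulo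
  \<open>n\<close>, so reducing the values into one window is an injective self-map of a finite
  set.\<close>

lemma residue_map_bij:
  assumes n: "n \<ge> 1" and f: "equivariant n f" "inj f"
  shows "bij_betw (\<lambda>i. f i - (f i - 1) div int n * int n) {1..int n} {1..int n}"
proof -
  define r where "r = (\<lambda>i. f i - (f i - 1) div int n * int n)"
  have inj: "inj_on r {1..int n}"
  proof (rule inj_onI)
    fix i j assume i: "i \<in> {1..int n}" and j: "j \<in> {1..int n}" and eq: "r i = r j"
    define m where "m = (f i - 1) div int n - (f j - 1) div int n"
    have "f i = f (j + m * int n)"
      using eq unfolding equivariantD[OF f(1)] r_def m_def by (simp add: algebra_simps)
    then have "i = j + m * int n" using f(2) by (simp add: inj_eq)
    then show "i = j" using i j residue_window_unique[of j n m] by simp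
  qed
  have "r ` {1..int n} \<subseteq> {1..int n}" unfolding r_def using residue_window[OF n] by auto
  then have "r ` {1..int n} = {1..int n}" using inj by (intro endo_inj_surj) auto
  then show ?thesis using inj by (simp add: bij_betw_def r_def)
qed

text \<open>This makes the normalisation survive composition and inversion: the displacement
  \<open>w i - i\<close> is periodic, so its sum over a window may be taken along any injective
  equivariant relabelling.\<close>

lemma sum_periodic_reindex:
  fixes g :: "int \<Rightarrow> int"
  assumes n: "n \<ge> 1" and g: "\<And>i m. g (i + m * int n) = g i"
    and f: "equivariant n f" "inj f"
  shows "(\<Sum>i=1..int n. g (f i)) = (\<Sum>i=1..int n. g i)"
proof -
  have "(\<Sum>i=1..int n. g (f i - (f i - 1) div int n * int n)) = (\<Sum>i=1..int n. g i)"
    by (rule sum.reindex_bij_betw[OF residue_map_bij[OF n f]])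
  then show ?thesis using g[of "f _" "- ((f _ - 1) div int n)"] by simp
qed

lemma equivariant_inj_imp_bij:
  assumes n: "n \<ge> 1" and f: "equivariant n f" "inj f"
  shows "bij f"
proof -
  have "\<exists>x. f x = y" for y
  proof -
    define m where "m = (y - 1) div int n"
    have "y - m * int n \<in> {1..int n}" unfolding m_def by (rule residue_window[OF n])
    then obtain i where "y - m * int n = f i - (f i - 1) div int n * int n"
      using bij_betw_imp_surj_on[OF residue_map_bij[OF n f]] by (metis (no_types, lifting) imageE)
    then have "f (i + (m - (f i - 1) div int n) * int n) = y"
      unfolding equivariantD[OF f(1)] by (simp add: algebra_simps)
    then show ?thesis ..
  qed
  then have "surj f" by (metis surjI)
  then show ?thesis using f(2) by (simp add: bij_def)
qed

lemma affine_perms_comp: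
  assumes n: "n \<ge> 1" and v: "v \<in> affine_perms n" and w: "w \<in> affine_perms n"
  shows "v \<circ> w \<in> affine_perms n"
proof -
  have b: "bij v" "bij w" and e: "equivariant n v" "equivariant n w"
    and s: "(\<Sum>i=1..int n. v i - i) = 0" "(\<Sum>i=1..int n. w i - i) = 0"
    using v w by (auto simp: affine_perms_iff)
  have "(\<Sum>i=1..int n. (\<lambda>x. v x - x) (w i)) = (\<Sum>i=1..int n. v i - i)"
    using e b by (intro sum_periodic_reindex[OF n]) (auto simp: equivariantD bij_is_inj)
  then have "(\<Sum>i=1..int n. v (w i) - w i) + (\<Sum>i=1..int n. w i - i) = 0" using s by simp
  then have "(\<Sum>i=1..int n. (v \<circ> w) i - i) = 0" by (simp add: sum.distrib[symmetric])
  then show ?thesis using b e by (auto simp: affine_perms_iff bij_comp equivariant_def)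
qed

lemma equivariant_inv:
  assumes "bij w" "equivariant n w"
  shows "equivariant n (inv w)"
  unfolding equivariant_def
proof
  fix i
  have "w (inv w i + int n) = i + int n"
    using assms by (simp add: equivariant_def bij_is_surj surj_f_inv_f)
  then show "inv w (i + int n) = inv w i + int n"
    using assms(1) by (metis bij_inv_eq_iff)
qed

lemma affine_perms_inv:
  assumes n: "n \<ge> 1" and w: "w \<in> affine_perms n"
  shows "inv w \<in> affine_perms n"
proof -
  have b: "bij w" and e: "equivariant n w" and s: "(\<Sum>i=1..int n. w i - i) = 0"
    using w by (auto simp: affine_perms_iff)
  have e': "equivariant n (inv w)" by (rule equivariant_inv[OF b e])
  have b': "bij (inv w)" by (rule bij_imp_bij_inv[OF b])
  have "(\<Sum>i=1..int n. (\<lambda>x. w x - x) (inv w i)) = (\<Sum>i=1..int n. w i - i)"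
    using e e' b' by (intro sum_periodic_reindex[OF n]) (auto simp: equivariantD bij_is_inj)
  then have "(\<Sum>i=1..int n. i - inv w i) = 0" using s b by (simp add: bij_is_surj surj_f_inv_f)
  then have "(\<Sum>i=1..int n. inv w i - i) = 0" by (simp add: sum_subtractf)
  then show ?thesis using b' e' by (simp add: affine_perms_iff)
qed

lemma affine_perms_id: "id \<in> affine_perms n"
  by (simp add: affine_perms_iff equivariant_def)

section \<open>Inversions up to translation\<close>

definition inversions :: "(int \<Rightarrow> int) \<Rightarrow> (int \<times> int) set" where
  "inversions w = {(i, j). i < j \<and> w j < w i}"

text \<open>For a shift-invariant relation this is the number of orbits under the diagonal shift.\<close>

definition window_card :: "nat \<Rightarrow> (int \<times> int) set \<Rightarrow> nat" where
  "window_card n R = card {(a, b) \<in> R. 1 \<le> a \<and> a \<le> int n}"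

lemma inversions_shift:
  "equivariant n w \<Longrightarrow> (a + m * int n, b + m * int n) \<in> inversions w \<longleftrightarrow> (a, b) \<in> inversions w"
  by (simp add: inversions_def equivariantD)

lemma equivariant_bounded:
  assumes n: "n \<ge> 1" and w: "equivariant n w"
  obtains M where "\<And>i. \<bar>w i - i\<bar> \<le> M"
proof
  fix i
  define m where "m = (i - 1) div int n"
  have "w (i - m * int n) = w i - m * int n" using equivariantD[OF w, of i "-m"] by simp
  then have "\<bar>w i - i\<bar> = \<bar>w (i - m * int n) - (i - m * int n)\<bar>" by simp
  also have "\<dots> \<le> (\<Sum>j=1..int n. \<bar>w j - j\<bar>)"
    unfolding m_def by (rule member_le_sum[OF residue_window[OF n]]) auto
  finally show "\<bar>w i - i\<bar> \<le> (\<Sum>j=1..int n. \<bar>w j - j\<bar>)" .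
qed

lemma finite_inversions_window:
  assumes n: "n \<ge> 1" and w: "equivariant n w"
  shows "finite {(a, b) \<in> inversions w. 1 \<le> a \<and> a \<le> int n}"
proof -
  obtain M where M: "\<And>i. \<bar>w i - i\<bar> \<le> M" using equivariant_bounded[OF n w] by blast
  have "{(a, b) \<in> inversions w. 1 \<le> a \<and> a \<le> int n} \<subseteq> {1..int n} \<times> {1..int n + 2 * M}"
  proof clarsimp
    fix a b assume "(a, b) \<in> inversions w" "1 \<le> a" "a \<le> int n"
    then show "1 \<le> b \<and> b \<le> int n + 2 * M"
      using M[of a] M[of b] by (auto simp: inversions_def)
  qed
  then show ?thesis by (rule finite_subset) simp
qed

text \<open>An equivariant injection is injective on translation orbits. It may move first
  coordinates out of the window, so \<open>G\<close> applies \<open>F\<close> and then translates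
  the image back.\<close>

lemma window_card_image:
  assumes n: "n \<ge> 1" and inj: "inj_on F R"
    and R: "\<And>a b m. (a, b) \<in> R \<Longrightarrow> (a + m * int n, b + m * int n) \<in> R"
    and F: "\<And>a b m. (a, b) \<in> R \<Longrightarrow>
      F (a + m * int n, b + m * int n) = (fst (F (a, b)) + m * int n, snd (F (a, b)) + m * int n)"
  shows "window_card n (F ` R) = window_card n R"
proof -
  define q where "q = (\<lambda>z. (fst (F z) - 1) div int n)"
  define G where "G = (\<lambda>z. (fst (F z) - q z * int n, snd (F z) - q z * int n))"
  let ?A = "{(a, b) \<in> R. 1 \<le> a \<and> a \<le> int n}"
  let ?B = "{(a, b) \<in> F ` R. 1 \<le> a \<and> a \<le> int n}"
  have GF: "G (a, b) = F (a + (- q (a, b)) * int n, b + (- q (a, b)) * int n)" if "(a, b) \<in> R" for a b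
    by (subst F[OF that]) (simp add: G_def)
  have "inj_on G ?A"
  proof (rule inj_onI, clarify)
    fix a b c d
    assume ab: "(a, b) \<in> R" "1 \<le> a" "a \<le> int n" and cd: "(c, d) \<in> R" "1 \<le> c" "c \<le> int n"
      and eq: "G (a, b) = G (c, d)"
    have "(a + (- q (a, b)) * int n, b + (- q (a, b)) * int n)
      = (c + (- q (c, d)) * int n, d + (- q (c, d)) * int n)"
      using eq unfolding GF[OF ab(1)] GF[OF cd(1)] 
      by (rule inj_onD[OF inj _ R[OF ab(1)] R[OF cd(1)]])
    then have 1: "a = c + (q (a, b) - q (c, d)) * int n" "b = d + (q (a, b) - q (c, d)) * int n"
      by (auto simp: algebra_simps)
    then have "q (a, b) - q (c, d) = 0" using ab cd by (intro residue_window_unique[of c n]) auto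
    then show "a = c \<and> b = d" using 1 by simp
  qed
  moreover have "G ` ?A = ?B"
  proof (intro equalityI subsetI)
    fix z assume "z \<in> G ` ?A"
    then obtain a b where ab: "(a, b) \<in> R" "z = G (a, b)" by auto
    have "z \<in> F ` R" unfolding ab(2) GF[OF ab(1)] by (intro imageI R ab)
    moreover have "fst z \<in> {1..int n}"
      unfolding ab(2) G_def q_def using residue_window[OF n] by simp
    ultimately show "z \<in> ?B" by (simp add: case_prod_beta)
  next
    fix z assume "z \<in> ?B"
    then have "z \<in> F ` R" and z: "fst z \<in> {1..int n}" by (simp_all add: case_prod_beta)
    then obtain a b where ab: "(a, b) \<in> R" "z = F (a, b)" by auto
    define m where "m = - ((a - 1) div int n)"
    have a_m: "a + m * int n \<in> {1..int n}"
      using residue_window[OF n, of a] by (simp add: m_def)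
    have 1: "(a + m * int n, b + m * int n) \<in> ?A"
      using R[OF ab(1), of m] a_m by simp
    have F': "F (a + m * int n, b + m * int n) = (fst z + m * int n, snd z + m * int n)"
      using F[OF ab(1), of m] ab(2) by simp
    have "q (a + m * int n, b + m * int n) = m"
    proof -
      have "(fst z - 1) div int n = 0" using z by (intro div_pos_pos_trivial) auto
      moreover have "fst (F (a + m * int n, b + m * int n)) - 1 = (fst z - 1) + m * int n"
        unfolding F' by simp
      moreover have "((fst z - 1) + m * int n) div int n = m + (fst z - 1) div int n"
        using n by (intro div_mult_self1) simp
      ultimately show ?thesis unfolding q_def by (simp only: add_0_right)
    qed
    then have "G (a + m * int n, b + m * int n) = z" unfolding G_def F' by simp
    then show "z \<in> G ` ?A" using 1 by force
  qed
  ultimately have "card ?B = card ?A" using card_image[of G ?A] by simp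
  then show ?thesis by (simp add: window_card_def)
qed

text \<open>An increasing bijection of the integers leaves no gaps, hence is a translation, and the
  normalised sum forces the translation by 0.\<close>

lemma inversions_empty_imp_id:
  assumes n: "n \<ge> 1" and w: "w \<in> affine_perms n" and emp: "inversions w = {}"
  shows "w = id"
proof -
  have b: "bij w" and s: "(\<Sum>i=1..int n. w i - i) = 0" using w by (auto simp: affine_perms_iff)
  have mono: "w i < w j" if "i < j" for i j
  proof -
    have "\<not> w j < w i" using emp that unfolding inversions_def by blast
    moreover have "w i \<noteq> w j" using b that by (metis bij_is_inj inj_eq less_irrefl)
    ultimately show ?thesis by simp
  qed
  have step: "w (i + 1) = w i + 1" for i
  proof (rule ccontr)
    assume "w (i + 1) \<noteq> w i + 1"
    then have lt: "w i + 1 < w (i + 1)" using mono[of i "i+1"] by simp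
    obtain j where j: "w j = w i + 1" using b by (metis bij_pointE)
    have "w i < w j" "w j < w (i + 1)" using j lt by simp_all
    then have "i < j" "j < i + 1" using mono by (metis less_asym linorder_neqE)+
    then show False by simp
  qed
  have w0: "w i = i + w 0" for i
  proof (induction i rule: int_induct[where k = 0])
    case (step2 i)
    then show ?case using step[of "i - 1"] by simp
  qed (simp_all add: step)
  have "(\<Sum>i=1..int n. w i - i) = (\<Sum>i=1..int n. w 0)"
    by (intro sum.cong refl) (metis w0 add_diff_cancel_left')
  then have "w 0 = 0" using s n by simp
  have "w i = i" for i using w0[of i] \<open>w 0 = 0\<close> by simp
  then show ?thesis by (simp add: fun_eq_iff)
qed

section \<open>Coxeter length\<close>

text \<open>Under inclusion of inversion sets no pair inverted by \<open>x\<close> is restored by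
  \<open>y\<close>, so the inversions that \<open>y\<close> has beyond those of \<open>x\<close> are
  transported by \<open>x\<close> to the inversions of \<open>y \<circ> inv x\<close>. Counting
  orbits gives additivity of length, the link to the left weak order.\<close>

lemma inversions_split:
  assumes x: "bij x" and y: "bij y" and sub: "inversions x \<subseteq> inversions y"
  defines "F \<equiv> \<lambda>(a, b). (inv x a, inv x b)"
  shows "inversions y = inversions x \<union> F ` inversions (y \<circ> inv x)"
    and "inversions x \<inter> F ` inversions (y \<circ> inv x) = {}"
proof -
  have xi: "x (inv x a) = a" "inv x (x a) = a" for a
    using x by (simp_all add: bij_is_surj surj_f_inv_f bij_is_inj)
  have F: "F (a, b) \<in> inversions y - inversions x" if "(a, b) \<in> inversions (y \<circ> inv x)" for a b
  proof -
    have ab: "a < b" "y (inv x b) < y (inv x a)" using that by (auto simp: inversions_def)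
    have "\<not> inv x b < inv x a"
    proof
      assume "inv x b < inv x a"
      then have "(inv x b, inv x a) \<in> inversions x" using ab xi by (simp add: inversions_def)
      then have "(inv x b, inv x a) \<in> inversions y" using sub by blast
      then show False using ab by (simp add: inversions_def)
    qed
    moreover have "inv x a \<noteq> inv x b" using ab by auto
    ultimately show ?thesis using ab xi by (simp add: inversions_def F_def)
  qed
  have "(i, j) \<in> F ` inversions (y \<circ> inv x)" if "(i, j) \<in> inversions y" "(i, j) \<notin> inversions x" for i j
  proof -
    have "x i \<noteq> x j" using that x by (auto simp: inversions_def bij_is_inj inj_eq)
    then have "(x i, x j) \<in> inversions (y \<circ> inv x)" using that xi by (auto simp: inversions_def)
    then have "F (x i, x j) \<in> F ` inversions (y \<circ> inv x)" by (rule imageI)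
    then show ?thesis by (simp add: F_def xi)
  qed
  moreover have F': "F ` inversions (y \<circ> inv x) \<subseteq> inversions y - inversions x"
    by (rule image_subsetI) (metis F surj_pair)
  ultimately show "inversions y = inversions x \<union> F ` inversions (y \<circ> inv x)"
    using sub by (intro equalityI subrelI) blast+
  show "inversions x \<inter> F ` inversions (y \<circ> inv x) = {}" using F' by blast
qed

lemma window_card_inversions_split:
  assumes n: "n \<ge> 1" and x: "x \<in> affine_perms n" and y: "y \<in> affine_perms n"
    and sub: "inversions x \<subseteq> inversions y"
  shows "window_card n (inversions y) =
    window_card n (inversions (y \<circ> inv x)) + window_card n (inversions x)"
proof -
  define F where "F = (\<lambda>(a, b). (inv x a, inv x b))"
  define u where "u = y \<circ> inv x"
  have b: "bij x" "bij y" "equivariant n x" "equivariant n y"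
    using x y by (auto simp: affine_perms_iff)
  have e: "equivariant n (inv x)" by (rule equivariant_inv[OF b(1,3)])
  have eu: "equivariant n u" using b e by (simp add: u_def equivariant_def)
  note split = inversions_split[OF b(1,2) sub, folded F_def u_def]
  have "inj F"
    using bij_is_inj[OF bij_imp_bij_inv[OF b(1)]] by (auto simp: inj_def F_def)
  then have "window_card n (F ` inversions u) = window_card n (inversions u)"
    by (intro window_card_image[OF n])
      (auto simp: inversions_shift[OF eu] F_def equivariantD[OF e] intro: inj_on_subset)
  moreover have "window_card n (inversions y) = window_card n (inversions x) + window_card n (F ` inversions u)"
  proof -
    let ?W = "{z. 1 \<le> fst z \<and> fst z \<le> int n}"
    have eq: "{(a, b) \<in> R. 1 \<le> a \<and> a \<le> int n} = R \<inter> ?W" for R by auto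
    have fin: "finite (inversions y \<inter> ?W)"
      using finite_inversions_window[OF n b(4)] unfolding eq .
    have "inversions y \<inter> ?W = (inversions x \<inter> ?W) \<union> (F ` inversions u \<inter> ?W)" using split(1) by blast
    moreover have "(inversions x \<inter> ?W) \<inter> (F ` inversions u \<inter> ?W) = {}" using split(2) by blast
    moreover from calculation(1) fin have "finite (inversions x \<inter> ?W)" "finite (F ` inversions u \<inter> ?W)"
      by simp_all
    ultimately show ?thesis unfolding window_card_def eq by (simp add: card_Un_disjoint)
  qed
  ultimately show ?thesis by (simp add: u_def)
qed

lemma window_card_inversions_eq_0:
  assumes n: "n \<ge> 1" and w: "w \<in> affine_perms n" and 0: "window_card n (inversions w) = 0"
  shows "w = id"
proof (rule inversions_empty_imp_id[OF n w])
  have e: "equivariant n w" using w by (simp add: affine_perms_iff)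
  have emp: "{(a, b) \<in> inversions w. 1 \<le> a \<and> a \<le> int n} = {}"
    using 0 finite_inversions_window[OF n e] by (simp add: window_card_def)
  have "z \<notin> inversions w" for z
  proof
    obtain a b where z: "z = (a, b)" by fastforce
    define m where "m = - ((a - 1) div int n)"
    assume "z \<in> inversions w"
    then have "(a + m * int n, b + m * int n) \<in> inversions w"
      by (simp add: inversions_shift[OF e] z)
    moreover have "a + m * int n \<in> {1..int n}" using residue_window[OF n, of a] by (simp add: m_def)
    ultimately show False using emp by auto
  qed
  then show "inversions w = {}" by blast
qed

section \<open>Simple generators\<close>

lemma simple_gen_alt:
  "simple_gen n c x = (if int n dvd x - int c then x + 1
     else if int n dvd x - int c - 1 then x - 1 else x)"
proof -
  have dvd: "(\<exists>m. y = m * int n) \<longleftrightarrow> int n dvd y" for y by (auto simp: dvd_def mult.commute)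
  have eq: "(\<exists>m. x = int c + m * int n) \<longleftrightarrow> (\<exists>m. x - int c = m * int n)"
    "(\<exists>m. x = int c + m * int n + 1) \<longleftrightarrow> (\<exists>m. x - int c - 1 = m * int n)"
    by (simp_all add: algebra_simps)
  show ?thesis unfolding simple_gen_def eq dvd ..
qed

lemma not_dvd_consecutive:
  assumes "n \<ge> 2" "int n dvd x"
  shows "\<not> int n dvd x + 1" "\<not> int n dvd x - 1"
proof -
  have "\<not> int n dvd 1" using assms(1) by (auto dest: zdvd_imp_le)
  then show "\<not> int n dvd x + 1" "\<not> int n dvd x - 1"
    using assms(2) by (metis dvd_add_right_iff, metis dvd_diff_right_iff)
qed

lemma simple_gen_offset:
  "simple_gen n c (int c + y) = int c +
    (if int n dvd y then y + 1 else if int n dvd y - 1 then y - 1 else y)"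
  by (simp add: simple_gen_alt)

lemma simple_gen_involution:
  assumes "n \<ge> 2"
  shows "simple_gen n c (simple_gen n c x) = x"
proof -
  define y where "y = x - int c"
  have "simple_gen n c (simple_gen n c (int c + y)) = int c + y"
  proof (cases "int n dvd y")
    case True
    then show ?thesis using not_dvd_consecutive(1)[OF assms True] by (simp add: simple_gen_offset)
  next
    case False
    then show ?thesis by (simp add: simple_gen_offset)
  qed
  then show ?thesis by (simp add: y_def)
qed

lemma simple_gen_affine:
  assumes n: "n \<ge> 2"
  shows "simple_gen n c \<in> affine_perms n"
proof -
  \<comment> \<open>\<open>g\<close> marks the positions that move up. The displacement is
    \<open>g i - g (i - 1)\<close>, which sums to 0 over a period.\<close>
  define g :: "int \<Rightarrow> int" where "g = (\<lambda>x. if int n dvd x - int c then 1 else 0)"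
  have "bij (simple_gen n c)"
    using simple_gen_involution[OF n] by (intro o_bij[of "simple_gen n c"]) (auto simp: fun_eq_iff)
  moreover have "equivariant n (simple_gen n c)"
    unfolding equivariant_def
  proof
    fix i
    define y where "y = i - int c"
    have "int n dvd y + int n \<longleftrightarrow> int n dvd y" "int n dvd y + int n - 1 \<longleftrightarrow> int n dvd y - 1"
      using dvd_add_triv_right_iff[of "int n" "y - 1"] by (simp_all add: algebra_simps)
    then have "simple_gen n c (int c + (y + int n)) = simple_gen n c (int c + y) + int n"
      unfolding simple_gen_offset by simp
    moreover have "int c + (y + int n) = i + int n" "int c + y = i" by (simp_all add: y_def)
    ultimately show "simple_gen n c (i + int n) = simple_gen n c i + int n" by simp
  qed
  moreover have "(\<Sum>i=1..int n. simple_gen n c i - i) = 0"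
  proof -
    have "simple_gen n c i - i = g i - g (i - 1)" for i
    proof -
      have eq: "i - 1 - int c = i - int c - 1" by simp
      show ?thesis
      proof (cases "int n dvd i - int c")
        case True
        then show ?thesis
          using not_dvd_consecutive(2)[OF n True] unfolding simple_gen_alt g_def eq by simp
      next
        case False
        then show ?thesis unfolding simple_gen_alt g_def eq by simp
      qed
    qed
    moreover have "(\<Sum>i=1..int n. g (i - 1)) = (\<Sum>i=1..int n. g i)"
    proof (rule sum_periodic_reindex)
      show "g (i + m * int n) = g i" for i m
      proof -
        have "i + m * int n - int c = (i - int c) + m * int n" by simp
        then show ?thesis unfolding g_def by (simp only: dvd_add_times_triv_right_iff)
      qed
    qed (use n in \<open>auto simp: equivariant_def inj_def\<close>)
    ultimately show ?thesis by (simp add: sum_subtractf)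
  qed
  ultimately show ?thesis by (simp add: affine_perms_iff)
qed

lemma inversions_simple_gen_iff:
  assumes n: "n \<ge> 2"
  shows "(a, b) \<in> inversions (simple_gen n c) \<longleftrightarrow> int n dvd a - int c \<and> b = a + 1"
proof
  assume "(a, b) \<in> inversions (simple_gen n c)"
  then have ab: "a < b" "simple_gen n c b < simple_gen n c a" by (auto simp: inversions_def)
  have "b = a + 1"
  proof (rule ccontr)
    assume "b \<noteq> a + 1"
    then have "b \<ge> a + 2" using ab by simp
    then show False using ab(2) by (auto simp: simple_gen_alt split: if_splits)
  qed
  then show "int n dvd a - int c \<and> b = a + 1"
    using ab(2) by (auto simp: simple_gen_alt split: if_splits)
next
  assume "int n dvd a - int c \<and> b = a + 1"
  then have d: "int n dvd a - int c" and b: "b = a + 1" by auto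
  have "a + 1 - int c = (a - int c) + 1" by simp
  then have "simple_gen n c b = a"
    using d b not_dvd_consecutive(1)[OF n d] by (simp only: simple_gen_alt) simp
  moreover have "simple_gen n c a = a + 1" using d by (simp add: simple_gen_alt)
  ultimately show "(a, b) \<in> inversions (simple_gen n c)" using b by (simp add: inversions_def)
qed

lemma window_card_inversions_simple_gen:
  assumes n: "n \<ge> 2"
  shows "window_card n (inversions (simple_gen n c)) = 1"
proof -
  note inv = inversions_simple_gen_iff[OF n]
  define a where "a = int c - (int c - 1) div int n * int n"
  have a: "a \<in> {1..int n}" "int n dvd a - int c"
    using residue_window[of n "int c"] n by (auto simp: a_def)
  have "{(a, b) \<in> inversions (simple_gen n c). 1 \<le> a \<and> a \<le> int n} = {(a, a + 1)}"
  proof (intro equalityI subsetI)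
    fix z assume "z \<in> {(a, b) \<in> inversions (simple_gen n c). 1 \<le> a \<and> a \<le> int n}"
    then have z: "int n dvd fst z - int c" "snd z = fst z + 1" "fst z \<in> {1..int n}"
      by (auto simp: inv)
    have "int n dvd (fst z - int c) - (a - int c)" using z(1) a(2) by (rule dvd_diff)
    then obtain m where m: "fst z = a + m * int n" by (auto simp: dvd_def algebra_simps)
    then have "m = 0" using residue_window_unique[OF a(1), of m] z(3) by simp
    then show "z \<in> {(a, a + 1)}" using m z(2) by (cases z) simp
  qed (use a inv in auto)
  then show ?thesis by (simp add: window_card_def)
qed

text \<open>The generator reverses two values only if they are a common translate of
  \<open>c\<close> and \<open>c + 1\<close>. By the hypothesis and equivariance these stand in
  increasing order in \<open>w\<close>, so no inversion is undone.\<close>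

lemma inversions_simple_gen_comp:
  assumes n: "n \<ge> 2" and w: "w \<in> affine_perms n" and c: "inv w (int c) < inv w (int c + 1)"
  shows "inversions w \<subseteq> inversions (simple_gen n c \<circ> w)"
proof
  fix z assume "z \<in> inversions w"
  then obtain a b where z: "z = (a, b)" and ab: "a < b" "w b < w a" by (auto simp: inversions_def)
  have b: "bij w" "equivariant n w" using w by (auto simp: affine_perms_iff)
  have "simple_gen n c (w b) < simple_gen n c (w a)"
  proof (rule ccontr)
    assume *: "\<not> ?thesis"
    have "simple_gen n c (w b) \<noteq> simple_gen n c (w a)"
      using simple_gen_involution[OF n, of c] ab(2) by (metis less_irrefl)
    then have "(w b, w a) \<in> inversions (simple_gen n c)"
      using * ab(2) by (auto simp: inversions_def)
    then have "int n dvd w b - int c" "w a = w b + 1"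
      by (simp_all add: inversions_simple_gen_iff[OF n])
    then obtain m where m: "w b = int c + m * int n" "w a = int c + 1 + m * int n"
      by (auto simp: dvd_def algebra_simps)
    have "inv w (w b) = inv w (int c) + m * int n" "inv w (w a) = inv w (int c + 1) + m * int n"
      unfolding m by (rule equivariantD[OF equivariant_inv[OF b]])+
    then show False using c ab(1) b by (simp add: bij_is_inj)
  qed
  then show "z \<in> inversions (simple_gen n c \<circ> w)" using ab z by (simp add: inversions_def)
qed

lemma word_prod_Cons: "word_prod n (i # is) = simple_gen n i \<circ> word_prod n is"
  by (simp add: word_prod_def)

lemma word_prod_affine:
  assumes "n \<ge> 2"
  shows "word_prod n is \<in> affine_perms n"
proof (induction "is")
  case Nil
  then show ?case using affine_perms_id by (simp add: word_prod_def id_def)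
next
  case (Cons i "is")
  then show ?case
    unfolding word_prod_Cons using assms by (intro affine_perms_comp simple_gen_affine) auto
qed

lemma simple_gen_comp_affine:
  "n \<ge> 2 \<Longrightarrow> w \<in> affine_perms n \<Longrightarrow> simple_gen n c \<circ> w \<in> affine_perms n"
  by (intro affine_perms_comp simple_gen_affine) auto

lemma simple_gen_comp_cancel: "n \<ge> 2 \<Longrightarrow> simple_gen n c \<circ> (simple_gen n c \<circ> w) = w"
  by (simp add: fun_eq_iff simple_gen_involution)

lemma window_card_simple_gen_up:
  assumes n: "n \<ge> 2" and w: "w \<in> affine_perms n" and c: "inv w (int c) < inv w (int c + 1)"
  shows "window_card n (inversions (simple_gen n c \<circ> w)) = Suc (window_card n (inversions w))"
proof -
  have "simple_gen n c \<circ> w \<circ> inv w = simple_gen n c"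
    using w by (metis affine_perms_iff bij_is_surj comp_assoc comp_id surj_iff)
  then show ?thesis
    using window_card_inversions_split[OF _ w simple_gen_comp_affine[OF n w] inversions_simple_gen_comp[OF n w c]]
      window_card_inversions_simple_gen[OF n] n by simp
qed

lemma inv_simple_gen_comp:
  assumes n: "n \<ge> 2" and w: "w \<in> affine_perms n"
  shows "inv (simple_gen n c \<circ> w) x = inv w (simple_gen n c x)"
proof -
  have "inv (simple_gen n c) = simple_gen n c"
    using simple_gen_involution[OF n] by (intro inv_equality) auto
  then show ?thesis
    using w simple_gen_affine[OF n, of c] by (simp add: affine_perms_iff o_inv_distrib)
qed

lemma window_card_simple_gen_down:
  assumes n: "n \<ge> 2" and w: "w \<in> affine_perms n" and c: "inv w (int c + 1) < inv w (int c)"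
  shows "window_card n (inversions w) = Suc (window_card n (inversions (simple_gen n c \<circ> w)))"
proof -
  have "simple_gen n c (int c) = int c + 1" "simple_gen n c (int c + 1) = int c"
    using not_dvd_consecutive(1)[OF n, of 0] by (simp_all add: simple_gen_alt)
  then have "inv (simple_gen n c \<circ> w) (int c) < inv (simple_gen n c \<circ> w) (int c + 1)"
    using c by (simp add: inv_simple_gen_comp[OF n w])
  from window_card_simple_gen_up[OF n simple_gen_comp_affine[OF n w] this] show ?thesis
    by (simp add: simple_gen_comp_cancel[OF n])
qed

lemma window_card_simple_gen_le:
  assumes n: "n \<ge> 2" and w: "w \<in> affine_perms n"
  shows "window_card n (inversions (simple_gen n c \<circ> w)) \<le> Suc (window_card n (inversions w))"
proof (cases "inv w (int c) < inv w (int c + 1)")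
  case False
  moreover have "inv w (int c) \<noteq> inv w (int c + 1)"
    using bij_is_inj[OF bij_imp_bij_inv, of w] w by (simp add: affine_perms_iff inj_eq)
  ultimately show ?thesis using window_card_simple_gen_down[OF n w, of c] by simp
qed (use window_card_simple_gen_up[OF n w] in simp)

text \<open>If every value stood before its successor, the inverse would be increasing and therefore
  the identity.\<close>

lemma exists_descent_of_inverse:
  assumes n: "n \<ge> 2" and w: "w \<in> affine_perms n" and ne: "w \<noteq> id"
  shows "\<exists>c\<in>{1..n}. inv w (int c + 1) < inv w (int c)"
proof (rule ccontr)
  assume neg: "\<not> ?thesis"
  have wi: "inv w \<in> affine_perms n" using n w by (intro affine_perms_inv) auto
  then have b: "bij (inv w)" "equivariant n (inv w)" by (auto simp: affine_perms_iff)
  have step: "inv w x < inv w (x + 1)" for x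
  proof -
    define m where "m = (x - 1) div int n"
    have x: "x - m * int n \<in> {1..int n}" using residue_window[of n x] n by (simp add: m_def)
    define c where "c = nat (x - m * int n)"
    have c: "c \<in> {1..n}" "int c = x - m * int n" using x by (auto simp: c_def)
    have "\<not> inv w (int c + 1) < inv w (int c)" using neg c by blast
    moreover have "x = int c + m * int n" "x + 1 = (int c + 1) + m * int n" using c by simp_all
    then have "inv w x = inv w (int c) + m * int n" "inv w (x + 1) = inv w (int c + 1) + m * int n"
      using equivariantD[OF b(2)] by metis+
    ultimately have "\<not> inv w (x + 1) < inv w x" by simp
    moreover have "inv w x \<noteq> inv w (x + 1)"
      using bij_is_inj[OF b(1)] by (simp add: inj_eq)
    ultimately show ?thesis by simp
  qed
  have "inv w x < inv w (x + int (Suc d))" for x d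
  proof (induction d)
    case (Suc d)
    then show ?case using step[of "x + int (Suc d)"] by (simp add: algebra_simps)
  qed (use step in simp)
  then have "inv w a < inv w b" if "a < b" for a b
    using that by (metis zless_iff_Suc_zadd)
  then have "inversions (inv w) = {}" by (auto simp: inversions_def) (metis less_asym)
  then have "inv w = id" using n by (intro inversions_empty_imp_id[OF _ wi]) auto
  then have "w = id" using w by (metis affine_perms_iff inv_id inv_inv_eq)
  then show False using ne by simp
qed

lemma window_card_inversions_id: "window_card n (inversions id) = 0"
proof -
  have "inversions id = {}" by (auto simp: inversions_def)
  then show ?thesis by (simp add: window_card_def)
qed

lemma word_prod_Nil: "word_prod n [] = id"
  by (simp add: word_prod_def id_def)

lemma exists_word_of_window_card:
  assumes n: "n \<ge> 2" and w: "w \<in> affine_perms n"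
  shows "\<exists>is. length is = window_card n (inversions w) \<and> set is \<subseteq> {1..n} \<and> word_prod n is = w"
  using w
proof (induction "window_card n (inversions w)" arbitrary: w)
  case 0
  have "w = id" using n "0.hyps" by (intro window_card_inversions_eq_0[OF _ "0.prems"]) simp_all
  have "length [] = window_card n (inversions w) \<and> set [] \<subseteq> {1..n} \<and> word_prod n [] = w"
    unfolding word_prod_Nil \<open>w = id\<close> window_card_inversions_id by simp
  then show ?case ..
next
  case (Suc l)
  then have "w \<noteq> id" using window_card_inversions_id[of n] by auto
  then obtain c where c: "c \<in> {1..n}" "inv w (int c + 1) < inv w (int c)"
    using exists_descent_of_inverse[OF n Suc.prems] by blast
  have "l = window_card n (inversions (simple_gen n c \<circ> w))"
    using window_card_simple_gen_down[OF n Suc.prems c(2)] Suc.hyps(2) by simp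
  note Suc.hyps(1)[OF this simple_gen_comp_affine[OF n Suc.prems], folded this]
  then obtain "is" where
    "is": "length is = l" "set is \<subseteq> {1..n}" "word_prod n is = simple_gen n c \<circ> w" by blast
  show ?case
    using "is" c(1) Suc.hyps(2)
    by (intro exI[of _ "c # is"]) (simp add: word_prod_Cons simple_gen_comp_cancel[OF n])
qed

text \<open>A generator adds at most one orbit of inversions, which bounds the length from below;
  removing descents of the inverse one at a time gives a word attaining the bound.\<close>

lemma coxeter_length_eq:
  assumes n: "n \<ge> 2" and w: "w \<in> affine_perms n"
  shows "coxeter_length n w = window_card n (inversions w)"
  unfolding coxeter_length_def
proof (rule Least_equality)
  show "\<exists>is. length is = window_card n (inversions w) \<and> set is \<subseteq> {1..n} \<and> word_prod n is = w"
    by (rule exists_word_of_window_card[OF n w])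
next
  have *: "window_card n (inversions (word_prod n is)) \<le> length is" for "is"
  proof (induction "is")
    case Nil
    show ?case unfolding word_prod_Nil window_card_inversions_id by simp
  next
    case (Cons i "is")
    have "window_card n (inversions (word_prod n (i # is))) \<le> Suc (window_card n (inversions (word_prod n is)))"
      unfolding word_prod_Cons by (rule window_card_simple_gen_le[OF n word_prod_affine[OF n]])
    then show ?case using Cons.IH by simp
  qed
  fix l assume "\<exists>is. length is = l \<and> set is \<subseteq> {1..n} \<and> word_prod n is = w"
  then show "window_card n (inversions w) \<le> l" using * by blast
qed

lemma left_weak_le_if_inversions_subset:
  assumes n: "n \<ge> 2" and x: "x \<in> affine_perms n" and y: "y \<in> affine_perms n"
    and sub: "inversions x \<subseteq> inversions y"
  shows "left_weak_le n x y"
proof -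
  have "y \<circ> inv x \<in> affine_perms n" using n x y by (intro affine_perms_comp affine_perms_inv) auto
  then show ?thesis
    using window_card_inversions_split[OF _ x y sub] n x y
    by (simp add: left_weak_le_def coxeter_length_eq)
qed

lemma coxeter_length_0_imp_id:
  assumes n: "n \<ge> 2" and w: "w \<in> affine_perms n" and "coxeter_length n w = 0"
  shows "w = id"
  using assms window_card_inversions_eq_0[of n w] by (simp add: coxeter_length_eq)

section \<open>Bracketings and sylvester classes\<close>

text \<open>Searching over a natural offset makes \<open>LEAST\<close> meaningful on the integers.
  For equivariant \<open>w\<close> the search ends within one period, since
  \<open>w (i + n) = w i + n\<close>.\<close>

definition next_greater :: "(int \<Rightarrow> int) \<Rightarrow> int \<Rightarrow> int" where
  "next_greater w i = i + 1 + int (LEAST m. w i < w (i + 1 + int m))"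

definition bracketing :: "nat \<Rightarrow> (int \<Rightarrow> int) \<Rightarrow> bool" where
  "bracketing n p \<longleftrightarrow> equivariant n p \<and> (\<forall>i. i < p i) \<and> (\<forall>i j. i < j \<longrightarrow> j < p i \<longrightarrow> p j \<le> p i)"

lemma next_greater_gt: "i < next_greater w i"
  by (simp add: next_greater_def)

lemma next_greater_value:
  assumes n: "n \<ge> 1" and w: "equivariant n w"
  shows "w i < w (next_greater w i)"
proof -
  have "w (i + 1 * int n) = w i + 1 * int n" by (rule equivariantD[OF w])
  then have "w i < w (i + 1 + int (n - 1))" using n by (simp add: of_nat_diff)
  then show ?thesis unfolding next_greater_def by (rule LeastI)
qed

lemma next_greater_between:
  assumes w: "inj w" and ij: "i < j" "j < next_greater w i"
  shows "w j < w i"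
proof -
  define m where "m = nat (j - i - 1)"
  have j: "j = i + 1 + int m" using ij(1) by (simp add: m_def)
  have "m < (LEAST m. w i < w (i + 1 + int m))" using ij(2) unfolding next_greater_def j by simp
  then have "\<not> w i < w (i + 1 + int m)" by (rule not_less_Least)
  moreover have "w i \<noteq> w j" using w ij(1) by (simp add: inj_eq)
  ultimately show ?thesis by (simp add: j)
qed

lemma next_greater_eqI:
  assumes ij: "i < j" "w i < w j" and between: "\<And>k. i < k \<Longrightarrow> k < j \<Longrightarrow> w k < w i"
  shows "next_greater w i = j"
proof -
  define m where "m = nat (j - i - 1)"
  have j: "j = i + 1 + int m" using ij(1) by (simp add: m_def)
  have "(LEAST m. w i < w (i + 1 + int m)) = m"
  proof (rule Least_equality)
    show "w i < w (i + 1 + int m)" using ij(2) by (simp add: j)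
    fix l assume l: "w i < w (i + 1 + int l)"
    show "m \<le> l" using between[of "i + 1 + int l"] l by (auto simp: j not_le[symmetric])
  qed
  then show ?thesis by (simp add: next_greater_def j)
qed

lemma bracketing_next_greater:
  assumes n: "n \<ge> 1" and w: "inj w" "equivariant n w"
  shows "bracketing n (next_greater w)"
  unfolding bracketing_def
proof (intro conjI allI impI)
  show "equivariant n (next_greater w)" unfolding equivariant_def
  proof (intro allI next_greater_eqI)
    fix i
    show "i + int n < next_greater w i + int n" by (simp add: next_greater_gt)
    have e: "w (x + int n) = w x + int n" for x using w(2) by (simp add: equivariant_def)
    show "w (i + int n) < w (next_greater w i + int n)"
      using next_greater_value[OF n w(2)] by (simp add: e)
    fix k assume "i + int n < k" "k < next_greater w i + int n"
    then have "w (k - int n) < w i" by (intro next_greater_between[OF w(1)]) auto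
    then show "w k < w (i + int n)" using e[of "k - int n"] e[of i] by simp
  qed
next
  fix i j assume ij: "i < j" "j < next_greater w i"
  show "next_greater w j \<le> next_greater w i"
  proof (rule ccontr)
    assume "\<not> ?thesis"
    then have "w (next_greater w i) < w j" by (intro next_greater_between[OF w(1) ij(2)]) simp
    then show False
      using next_greater_between[OF w(1) ij] next_greater_value[OF n w(2), of i] by simp
  qed
qed (rule next_greater_gt)

text \<open>The descendants of \<open>i\<close> on its right are the positions strictly under the
  arc from \<open>i\<close> to its next larger entry. Thus the order on positions determines
  \<open>next_greater\<close>.\<close>

lemma pos_le_back_iff:
  assumes n: "n \<ge> 1" and w: "inj w" "equivariant n w" and ij: "i < j"
  shows "pos_le w j i \<longleftrightarrow> j < next_greater w i"
proof
  assume "pos_le w j i"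
  then have lt: "w j < w i" and nk: "\<And>k. i < k \<Longrightarrow> k < j \<Longrightarrow> \<not> w k > w i"
    using ij by (auto simp: pos_le_def pos_incomparable_def max_def min_def)
  show "j < next_greater w i"
  proof (rule ccontr)
    assume "\<not> ?thesis"
    moreover have "next_greater w i \<noteq> j" using lt next_greater_value[OF n w(2), of i] by auto
    ultimately have "\<not> w (next_greater w i) > w i" by (intro nk) (auto simp: next_greater_gt)
    then show False using next_greater_value[OF n w(2)] by blast
  qed
next
  assume j: "j < next_greater w i"
  have lt: "w j < w i" by (rule next_greater_between[OF w(1) ij j])
  have "w k < w i" if "i < k" "k < j" for k
    using that j by (intro next_greater_between[OF w(1)]) auto
  then show "pos_le w j i" using lt ij by (fastforce simp: pos_le_def pos_incomparable_def)
qed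

text \<open>The counterpart for descendants on the left: \<open>j\<close> dominates the whole
  stretch from \<open>i\<close> when no arc starting there passes over \<open>j\<close>. With the
  preceding lemma, \<open>next_greater\<close> determines the order on positions.\<close>

lemma pos_le_forth_iff:
  assumes n: "n \<ge> 1" and w: "inj w" "equivariant n w" and ij: "i < j"
  shows "pos_le w i j \<longleftrightarrow> (\<forall>k. i \<le> k \<and> k < j \<longrightarrow> next_greater w k \<le> j)"
proof
  assume "pos_le w i j"
  then have lt: "w i < w j" and nk: "\<And>k. i < k \<Longrightarrow> k < j \<Longrightarrow> \<not> w k > w j"
    using ij by (auto simp: pos_le_def pos_incomparable_def max_def min_def)
  show "\<forall>k. i \<le> k \<and> k < j \<longrightarrow> next_greater w k \<le> j"
  proof (intro allI impI, elim conjE)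
    fix k assume k: "i \<le> k" "k < j"
    have "w k < w j"
      using lt nk[of k] k w(1) by (cases "k = i") (auto simp: inj_eq not_less order_less_le)
    then show "next_greater w k \<le> j"
      using next_greater_between[OF w(1) k(2)] by (metis less_asym not_le)
  qed
next
  assume *: "\<forall>k. i \<le> k \<and> k < j \<longrightarrow> next_greater w k \<le> j"
  have fin: "finite (w ` {i..<j})" and ne: "w ` {i..<j} \<noteq> {}" using ij by auto
  \<comment> \<open>The arc from the maximum of the stretch cannot end inside the stretch, nor
    beyond \<open>j\<close>, so it ends at \<open>j\<close>; hence \<open>j\<close> exceeds the
    maximum.\<close>
  obtain m where m: "m \<in> {i..<j}" "w m = Max (w ` {i..<j})" using Max_in[OF fin ne] by auto
  have le: "w k \<le> w m" if "k \<in> {i..<j}" for k using that fin by (simp add: m(2))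
  have "next_greater w m = j"
  proof (rule ccontr)
    assume "next_greater w m \<noteq> j"
    then have "next_greater w m \<in> {i..<j}" using * m(1) next_greater_gt[of m w] by force
    then show False using le next_greater_value[OF n w(2), of m] by force
  qed
  then have "w m < w j" using next_greater_value[OF n w(2), of m] by simp
  then have "w k < w j" if "k \<in> {i..<j}" for k using le[OF that] by simp
  then have "w i < w j" "\<And>k. i < k \<Longrightarrow> k < j \<Longrightarrow> w k < w j" using ij by auto
  then show "pos_le w i j" using ij by (fastforce simp: pos_le_def pos_incomparable_def)
qed

lemma pos_le_eq_iff:
  assumes n: "n \<ge> 1" and v: "v \<in> affine_perms n" and w: "w \<in> affine_perms n"
  shows "pos_le v = pos_le w \<longleftrightarrow> next_greater v = next_greater w"
proof
  have V: "inj v" "equivariant n v" and W: "inj w" "equivariant n w"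
    using v w by (auto simp: affine_perms_iff bij_is_inj)
  { assume eq: "pos_le v = pos_le w"
    show "next_greater v = next_greater w"
    proof
      fix i
      have "j < next_greater v i \<longleftrightarrow> j < next_greater w i" if "i < j" for j
        using pos_le_back_iff[OF n V that] pos_le_back_iff[OF n W that] eq by simp
      then show "next_greater v i = next_greater w i"
        using next_greater_gt[of i v] next_greater_gt[of i w] by (metis linorder_neqE less_irrefl)
    qed }
  { assume eq: "next_greater v = next_greater w"
    show "pos_le v = pos_le w"
    proof (intro ext)
      fix i j :: int
      consider "i < j" | "i = j" | "j < i" by linarith
      then show "pos_le v i j = pos_le w i j"
      proof cases
        case 1 then show ?thesis using pos_le_forth_iff[OF n V] pos_le_forth_iff[OF n W] eq by simp
      next
        case 2 then show ?thesis by (simp add: pos_le_def)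
      next
        case 3 then show ?thesis using pos_le_back_iff[OF n V] pos_le_back_iff[OF n W] eq by simp
      qed
    qed }
qed

section \<open>The 231-avoiding member of a class\<close>

text \<open>A smaller entry beyond the next larger one would complete a 231 with \<open>i\<close>
  and \<open>next_greater w i\<close>. So all inversions lie under arcs, and the bracketing
  determines them.\<close>

lemma avoids_231_inversion_iff:
  assumes n: "n \<ge> 1" and w: "inj w" "equivariant n w" and av: "avoids_231 w" and ij: "i < j"
  shows "w j < w i \<longleftrightarrow> j < next_greater w i"
proof
  assume lt: "w j < w i"
  show "j < next_greater w i"
  proof (rule ccontr)
    assume "\<not> ?thesis"
    moreover have "next_greater w i \<noteq> j" using lt next_greater_value[OF n w(2), of i] by auto
    ultimately have "next_greater w i < j" by simp
    then show False
      using av lt next_greater_gt[of i w] next_greater_value[OF n w(2), of i]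
        unfolding avoids_231_def by blast
  qed
qed (rule next_greater_between[OF w(1) ij])

text \<open>Additivity of length for equal inversion sets leaves \<open>v \<circ> inv w\<close>
  without inversions.\<close>

lemma affine_perms_eqI_inversions:
  assumes n: "n \<ge> 1" and v: "v \<in> affine_perms n" and w: "w \<in> affine_perms n"
    and eq: "inversions v = inversions w"
  shows "v = w"
proof -
  have "window_card n (inversions (v \<circ> inv w)) = 0"
    using window_card_inversions_split[OF n w v] eq by simp
  then have "v \<circ> inv w = id"
    using n v w by (intro window_card_inversions_eq_0[OF n] affine_perms_comp affine_perms_inv) auto
  then have "v \<circ> inv w \<circ> w = w" by simp
  then show ?thesis using w by (simp add: comp_assoc affine_perms_iff bij_is_inj)
qed

lemma avoids_231_unique:
  assumes n: "n \<ge> 1" and v: "v \<in> affine_perms n" "avoids_231 v" and w: "w \<in> affine_perms n" "avoids_231 w"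
    and eq: "next_greater v = next_greater w"
  shows "v = w"
proof (rule affine_perms_eqI_inversions[OF n v(1) w(1)])
  have V: "inj v" "equivariant n v" and W: "inj w" "equivariant n w"
    using v w by (auto simp: affine_perms_iff bij_is_inj)
  show "inversions v = inversions w"
    using avoids_231_inversion_iff[OF n V v(2)] avoids_231_inversion_iff[OF n W w(2)] eq
    by (auto simp: inversions_def)
qed

lemma window_card_sum:
  assumes "\<And>a. finite {b. (a, b) \<in> R}"
  shows "window_card n R = (\<Sum>a=1..int n. card {b. (a, b) \<in> R})"
proof -
  have "{(a, b) \<in> R. 1 \<le> a \<and> a \<le> int n} = Sigma {1..int n} (\<lambda>a. {b. (a, b) \<in> R})" by auto
  then show ?thesis using assms by (simp add: window_card_def)
qed

text \<open>In a \<open>231\<close>-avoiding affine permutation the entries right of \<open>i\<close> that are smaller than the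
  entry at \<open>i\<close> are those strictly between \<open>i\<close> and \<open>p i\<close>; this determines the value at \<open>i\<close>.\<close>

lemma exists_231_avoiding_of_bracketing:
  assumes n: "n \<ge> 1" and p: "bracketing n p"
  shows "\<exists>w\<in>affine_perms n. avoids_231 w \<and> next_greater w = p"
proof -
  have e: "equivariant n p" and gt: "i < p i" and nc: "i < j \<Longrightarrow> j < p i \<Longrightarrow> p j \<le> p i" for i j
    using p by (auto simp: bracketing_def)
  \<comment> \<open>An arc longer than a period would pass over the start of its own translate,
    whose end lies a full period further right.\<close>
  have bound: "p i \<le> i + int n" for i
  proof (rule ccontr)
    assume "\<not> ?thesis"
    then have "p (i + int n) \<le> p i" using n by (intro nc) auto
    then show False using e n by (simp add: equivariant_def)
  qed
  define L where "L = (\<lambda>i. {j. j < i \<and> i < p j})"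
  have finL: "finite (L i)" for i
  proof (rule finite_subset)
    show "L i \<subseteq> {i - int n..i}"
    proof
      fix j assume "j \<in> L i"
      then show "j \<in> {i - int n..i}" using bound[of j] by (simp add: L_def)
    qed
  qed simp
  \<comment> \<open>A value of an affine permutation is its position, plus the number of smaller
    entries to the right, minus the number of larger entries to the left. Here these numbers have to
    be \<open>p i - i - 1\<close> and \<open>card (L i)\<close>, the number of arcs passing over
    \<open>i\<close>.\<close>
  define w where "w = (\<lambda>i. p i - 1 - int (card (L i)))"
  have down: "w j < w i" if ij: "i < j" "j < p i" for i j
  proof -
    have "insert i (L i) \<subseteq> L j" using ij nc by (fastforce simp: L_def)
    then have "card (insert i (L i)) \<le> card (L j)" by (rule card_mono[OF finL])
    then have "card (L i) < card (L j)" using finL[of i] by (simp add: L_def card_insert_if)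
    then show ?thesis using nc[OF ij] by (simp add: w_def)
  qed
  have up: "w i < w j" if ij: "i < j" "p i \<le> j" for i j
  proof -
    \<comment> \<open>An arc over \<open>j\<close> that starts at \<open>i\<close> or under the arc
      of \<open>i\<close> would have to end by \<open>p i\<close>, hence not beyond
      \<open>j\<close>.\<close>
    have "L j \<subseteq> L i \<union> {p i..<j}"
    proof
      fix l assume "l \<in> L j"
      then have l: "l < j" "j < p l" by (auto simp: L_def)
      have "l \<noteq> i" using l ij by auto
      moreover have "\<not> (i < l \<and> l < p i)" using nc[of i l] l ij by auto
      ultimately show "l \<in> L i \<union> {p i..<j}" using l ij by (auto simp: L_def)
    qed
    then have "card (L j) \<le> card (L i \<union> {p i..<j})" by (rule card_mono[rotated]) (simp add: finL)
    also have "\<dots> \<le> card (L i) + card {p i..<j}" by (rule card_Un_le)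
    finally have "int (card (L j)) \<le> int (card (L i)) + (j - p i)" using ij by simp
    then show ?thesis using gt[of j] by (simp add: w_def)
  qed
  have inv_iff: "w j < w i \<longleftrightarrow> j < p i" if "i < j" for i j
    using down[OF that] up[OF that] by (metis less_asym not_le)
  have inj: "inj w"
  proof (rule injI)
    fix i j assume "w i = w j"
    then show "i = j"
      using down[of i j] up[of i j] down[of j i] up[of j i] by (metis less_irrefl linorder_neqE not_le)
  qed
  have ew: "equivariant n w" unfolding equivariant_def
  proof
    fix i
    have "L (i + int n) = (\<lambda>j. j + int n) ` L i"
    proof (intro equalityI subsetI)
      fix j assume "j \<in> L (i + int n)"
      moreover have "p j = p (j - int n) + int n" using equivariantD[OF e, of "j - int n" 1] by simp
      ultimately have "j - int n \<in> L i" by (simp add: L_def)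
      then have "j - int n + int n \<in> (\<lambda>j. j + int n) ` L i" by (rule imageI)
      then show "j \<in> (\<lambda>j. j + int n) ` L i" by simp
    next
      fix j assume "j \<in> (\<lambda>j. j + int n) ` L i"
      then show "j \<in> L (i + int n)" using e by (auto simp: L_def equivariant_def)
    qed
    then have "card (L (i + int n)) = card (L i)" by (simp add: card_image)
    then show "w (i + int n) = w i + int n" using e by (simp add: w_def equivariant_def)
  qed
  have "(\<Sum>i=1..int n. w i - i) = 0"
  proof -
    \<comment> \<open>Pairs of an arc and a position strictly under it. Counted per period by arcs
      they give the terms \<open>p i - i - 1\<close>, counted by positions the terms
      \<open>card (L i)\<close>; the two totals agree, so the displacements cancel.\<close>
    define R where "R = {(a, b). a < b \<and> b < p a}"
    have R: "{b. (a, b) \<in> R} = {a<..<p a}" for a by (auto simp: R_def)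
    have R': "{b. (a, b) \<in> prod.swap ` R} = L a" for a by (force simp: R_def L_def)
    have "window_card n (prod.swap ` R) = window_card n R"
      by (rule window_card_image[OF n]) (auto simp: R_def equivariantD[OF e])
    then have "(\<Sum>a=1..int n. card (L a)) = (\<Sum>a=1..int n. card {a<..<p a})"
      using window_card_sum[of R n, unfolded R] window_card_sum[of "prod.swap ` R" n, unfolded R', OF finL]
      by simp
    then have "(\<Sum>a=1..int n. int (card (L a))) = (\<Sum>a=1..int n. int (card {a<..<p a}))"
      by (metis of_nat_sum)
    also have "\<dots> = (\<Sum>a=1..int n. p a - a - 1)"
    proof (intro sum.cong refl)
      fix x
      have "x < p x" by (rule gt)
      then show "int (card {x<..<p x}) = p x - x - 1" by simp
    qed
    finally show ?thesis by (simp add: w_def sum_subtractf)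
  qed
  then have w: "w \<in> affine_perms n"
    using equivariant_inj_imp_bij[OF n ew inj] ew by (simp add: affine_perms_iff)
  have "avoids_231 w" unfolding avoids_231_def
  proof clarify
    fix i j k assume "i < j" "j < k" "w k < w i" "w i < w j"
    then show False using inv_iff[of i k] inv_iff[of i j] by simp
  qed
  moreover have "next_greater w = p"
    using up down gt by (intro ext next_greater_eqI) auto
  ultimately show ?thesis using w by blast
qed

lemma exists_231_avoiding_in_class:
  assumes n: "n \<ge> 1" and w: "w \<in> affine_perms n"
  shows "\<exists>v\<in>affine_perms n. avoids_231 v \<and> next_greater v = next_greater w"
  using w by (intro exists_231_avoiding_of_bracketing[OF n] bracketing_next_greater[OF n])
    (auto simp: affine_perms_iff bij_is_inj)

lemma syl_cong_iff:
  assumes n: "n \<ge> 1"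
  shows "(v, w) \<in> syl_cong n \<longleftrightarrow>
    v \<in> affine_perms n \<and> w \<in> affine_perms n \<and> next_greater v = next_greater w"
  using pos_le_eq_iff[OF n] by (auto simp: syl_cong_def)

text \<open>Pairs under an arc are inverted in every member of the class, and the avoiding member
  has no other inversions.\<close>

lemma inversions_231_avoiding_minimal:
  assumes n: "n \<ge> 1" and v: "v \<in> affine_perms n" "avoids_231 v" and w: "w \<in> affine_perms n"
    and eq: "next_greater v = next_greater w"
  shows "inversions v \<subseteq> inversions w"
proof -
  have V: "inj v" "equivariant n v" and W: "inj w" "equivariant n w"
    using v w by (auto simp: affine_perms_iff bij_is_inj)
  show ?thesis
    using avoids_231_inversion_iff[OF n V v(2)] next_greater_between[OF W(1)] eq
    by (auto simp: inversions_def)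
qed

lemma left_weak_le_antisym_in_class:
  assumes n: "n \<ge> 2" and v: "v \<in> affine_perms n" "avoids_231 v" and w: "w \<in> affine_perms n"
    and eq: "next_greater v = next_greater w" and le: "left_weak_le n w v"
  shows "w = v"
proof -
  have "left_weak_le n v w"
    using n v w eq by (intro left_weak_le_if_inversions_subset inversions_231_avoiding_minimal) auto
  then have "coxeter_length n (w \<circ> inv v) = 0" using le by (simp add: left_weak_le_def)
  then have "w \<circ> inv v = id"
    using n v w by (intro coxeter_length_0_imp_id[OF n] affine_perms_comp affine_perms_inv) auto
  then have "w \<circ> inv v \<circ> v = v" by simp
  then show ?thesis using v by (simp add: comp_assoc affine_perms_iff bij_is_inj)
qed

text \<open>The 231-avoiding member has the least inversion set of its class, so it is below every
  other member, while a member below it must coincide with it because the lengths then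
  agree.\<close>

lemma pi_down_eq:
  assumes n: "n \<ge> 2" and v: "v \<in> affine_perms n" "avoids_231 v" and w: "w \<in> affine_perms n"
    and eq: "next_greater v = next_greater w"
  shows "pi_down n w = v"
  unfolding pi_down_def
proof (rule the_equality)
  have n1: "n \<ge> 1" using n by simp
  have cls: "(w, y) \<in> syl_cong n \<longleftrightarrow> y \<in> affine_perms n \<and> next_greater v = next_greater y" for y
    using w eq by (auto simp: syl_cong_iff[OF n1])
  show "v \<in> syl_cong n `` {w} \<and> (\<forall>y\<in>syl_cong n `` {w}. left_weak_le n y v \<longrightarrow> y = v)"
    using left_weak_le_antisym_in_class[OF n v] v(1) by (auto simp: cls)
  fix x assume x: "x \<in> syl_cong n `` {w} \<and> (\<forall>y\<in>syl_cong n `` {w}. left_weak_le n y x \<longrightarrow> y = x)"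
  then have "left_weak_le n v x"
    using n v
      by (intro left_weak_le_if_inversions_subset inversions_231_avoiding_minimal) (auto simp: cls)
  then show "x = v" using x v(1) by (auto simp: cls)
qed

lemma pi_down_props:
  assumes n: "n \<ge> 2" and w: "w \<in> affine_perms n"
  shows "pi_down n w \<in> affine_perms n" "avoids_231 (pi_down n w)" "next_greater (pi_down n w) = next_greater w"
proof -
  obtain v where "v \<in> affine_perms n" "avoids_231 v" "next_greater v = next_greater w"
    using exists_231_avoiding_in_class[OF _ w] n by auto
  then show "pi_down n w \<in> affine_perms n" "avoids_231 (pi_down n w)" "next_greater (pi_down n w) = next_greater w"
    using pi_down_eq[OF n _ _ w] by auto
qed

section \<open>Preimages under stack-sorting\<close>

text \<open>The right subtree of the node with post-order label \<open>b\<close> consists of the labels in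
  \<open>{l b..<b}\<close>; in this encoding, \<open>descends l a b\<close> says that \<open>a\<close> is a proper descendant
  of \<open>b\<close>.\<close>

definition postorder_bracketing :: "nat \<Rightarrow> (int \<Rightarrow> int) \<Rightarrow> bool" where
  "postorder_bracketing n l \<longleftrightarrow>
     equivariant n l \<and> (\<forall>b. l b \<le> b) \<and> (\<forall>a b. l b \<le> a \<longrightarrow> a < b \<longrightarrow> l b \<le> l a)"

definition descends :: "(int \<Rightarrow> int) \<Rightarrow> int \<Rightarrow> int \<Rightarrow> bool" where
  "descends l a b \<longleftrightarrow> a < b \<and> (\<forall>c>b. l c \<le> b \<longrightarrow> l c \<le> a)"

definition compatible :: "(int \<Rightarrow> int) \<Rightarrow> (int \<Rightarrow> int) \<Rightarrow> bool" where
  "compatible w l \<longleftrightarrow> (\<forall>a b. descends l a b \<longrightarrow> w a < w b)"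

text \<open>\<open>v\<close> is the in-order reading of the tree: a larger label stands before a
  smaller one exactly if the smaller one lies in its right subtree.\<close>

definition encodes :: "(int \<Rightarrow> int) \<Rightarrow> (int \<Rightarrow> int) \<Rightarrow> bool" where
  "encodes l v \<longleftrightarrow> (\<forall>a b. a < b \<longrightarrow> (inv v b < inv v a \<longleftrightarrow> l b \<le> a))"

lemma affine_perms_reflect:
  assumes n: "n \<ge> 1" and w: "w \<in> affine_perms n"
  shows "(\<lambda>i. - w (- i)) \<in> affine_perms n"
proof -
  have b: "bij w" and e: "equivariant n w" and s: "(\<Sum>i=1..int n. w i - i) = 0"
    using w by (auto simp: affine_perms_iff)
  define g where "g = (\<lambda>i. w i - i)"
  have g: "g (i + m * int n) = g i" for i m by (simp add: g_def equivariantD[OF e])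
  have "bij (\<lambda>i. - w (- i))"
    using bij_comp[OF bij_comp[OF bij_uminus b] bij_uminus] by (simp add: comp_def)
  moreover have "equivariant n (\<lambda>i. - w (- i))"
    using equivariantD[OF e, of _ "- 1"] by (simp add: equivariant_def)
  moreover have "(\<Sum>i=1..int n. - w (- i) - i) = 0"
  proof -
    have "(\<Sum>i=1..int n. g (- i)) = (\<Sum>i=1..int n. g (i - 1))"
    proof (rule sum.reindex_bij_witness[of _ "\<lambda>i. int n + 1 - i" "\<lambda>i. int n + 1 - i"])
      fix i
      show "g (int n + 1 - i - 1) = g (- i)" using g[of "- i" 1] by simp
    qed auto
    also have "\<dots> = (\<Sum>i=1..int n. g i)"
      by (rule sum_periodic_reindex[OF n g]) (auto simp: equivariant_def inj_def)
    finally have "(\<Sum>i=1..int n. g (- i)) = 0" using s by (simp add: g_def)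
    moreover have "(\<Sum>i=1..int n. - w (- i) - i) = - (\<Sum>i=1..int n. g (- i))"
      by (simp add: g_def flip: sum_negf)
    ultimately show ?thesis by simp
  qed
  ultimately show ?thesis by (simp add: affine_perms_iff)
qed

lemma affine_perm_inverse_simps:
  assumes "w \<in> affine_perms n"
  shows "w (inv w x) = x" "inv w (w x) = x"
  using assms by (auto simp: affine_perms_iff bij_is_surj surj_f_inv_f bij_is_inj)

text \<open>Inversion turns the pattern 231 into 312, and conjugation by negation turns 312 back
  into 231. So \<open>x\<close> avoids 231, its arcs record all its inversions, and reflecting these
  arcs yields the code of \<open>v\<close>.\<close>

lemma encoding_exists:
  assumes n: "n \<ge> 1" and v: "v \<in> affine_perms n" "avoids_231 v"
  shows "\<exists>l. postorder_bracketing n l \<and> encodes l v"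
proof -
  define x where "x = (\<lambda>i. - inv v (- i))"
  have x: "x \<in> affine_perms n"
    unfolding x_def by (intro affine_perms_reflect[OF n] affine_perms_inv[OF n v(1)])
  then have X: "inj x" "equivariant n x" by (auto simp: affine_perms_iff bij_is_inj)
  have av: "avoids_231 x" unfolding avoids_231_def
  proof clarify
    fix i j k assume *: "i < j" "j < k" "x k < x i" "x i < x j"
    then have "inv v (- j) < inv v (- i)" "inv v (- i) < inv v (- k)" by (auto simp: x_def)
    moreover have "v (inv v (- k)) < v (inv v (- j))" "v (inv v (- j)) < v (inv v (- i))"
      unfolding affine_perm_inverse_simps[OF v(1)] using * by auto
    ultimately show False using v(2) unfolding avoids_231_def by blast
  qed
  define p where "p = next_greater x"
  \<comment> \<open>The 1 turns the strict bound \<open>- a < p (- b)\<close> into the weak bound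
    \<open>l b \<le> a\<close>.\<close>
  define l where "l = (\<lambda>b. 1 - p (- b))"
  have p: "bracketing n p" unfolding p_def by (rule bracketing_next_greater[OF n X])
  have "postorder_bracketing n l" unfolding postorder_bracketing_def
  proof (intro conjI allI impI)
    have "equivariant n p" using p by (simp add: bracketing_def)
    then show "equivariant n l"
      using equivariantD[of n p _ "- 1"] by (simp add: equivariant_def l_def)
    show "l b \<le> b" for b
    proof -
      have "- b < p (- b)" using p by (simp add: bracketing_def)
      then show ?thesis by (simp add: l_def)
    qed
    fix a b assume "l b \<le> a" "a < b"
    then have "- b < - a" "- a < p (- b)" by (auto simp: l_def)
    then have "p (- a) \<le> p (- b)" using p by (auto simp: bracketing_def)
    then show "l b \<le> l a" by (simp add: l_def)
  qed
  moreover have "encodes l v" unfolding encodes_def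
  proof (intro allI impI)
    fix a b :: int assume "a < b"
    then have "x (- a) < x (- b) \<longleftrightarrow> - a < p (- b)"
      unfolding p_def by (intro avoids_231_inversion_iff[OF n X av]) simp
    then show "inv v b < inv v a \<longleftrightarrow> l b \<le> a" by (auto simp: x_def l_def)
  qed
  ultimately show ?thesis by blast
qed

lemma encoded_exists:
  assumes n: "n \<ge> 1" and l: "postorder_bracketing n l"
  shows "\<exists>v\<in>affine_perms n. avoids_231 v \<and> encodes l v"
proof -
  define p where "p = (\<lambda>i. 1 - l (- i))"
  have "bracketing n p" unfolding bracketing_def
  proof (intro conjI allI impI)
    have "equivariant n l" using l by (simp add: postorder_bracketing_def)
    then show "equivariant n p"
      using equivariantD[of n l _ "- 1"] by (simp add: equivariant_def p_def)
    show "i < p i" for i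
    proof -
      have "l (- i) \<le> - i" using l by (simp add: postorder_bracketing_def)
      then show ?thesis by (simp add: p_def)
    qed
    fix i j assume "i < j" "j < p i"
    then have "l (- i) \<le> - j" "- j < - i" by (auto simp: p_def)
    then have "l (- i) \<le> l (- j)" using l by (simp add: postorder_bracketing_def)
    then show "p j \<le> p i" by (simp add: p_def)
  qed
  then obtain x where x: "x \<in> affine_perms n" "avoids_231 x" "next_greater x = p"
    using exists_231_avoiding_of_bracketing[OF n] by blast
  then have X: "inj x" "equivariant n x" by (auto simp: affine_perms_iff bij_is_inj)
  define \<theta> where "\<theta> = (\<lambda>i. - x (- i))"
  define v where "v = inv \<theta>"
  have \<theta>: "\<theta> \<in> affine_perms n" unfolding \<theta>_def by (rule affine_perms_reflect[OF n x(1)])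
  have v: "v \<in> affine_perms n" unfolding v_def by (rule affine_perms_inv[OF n \<theta>])
  have inv_v: "inv v = \<theta>" unfolding v_def using \<theta> by (intro inv_inv_eq) (simp add: affine_perms_iff)
  have enc: "encodes l v" unfolding encodes_def inv_v
  proof (intro allI impI)
    fix a b :: int assume "a < b"
    then have "x (- a) < x (- b) \<longleftrightarrow> - a < p (- b)"
      unfolding x(3)[symmetric] by (intro avoids_231_inversion_iff[OF n X x(2)]) simp
    then show "\<theta> b < \<theta> a \<longleftrightarrow> l b \<le> a" by (auto simp: \<theta>_def p_def)
  qed
  have "avoids_231 v" unfolding avoids_231_def
  proof clarify
    fix i j k assume *: "i < j" "j < k" "v k < v i" "v i < v j"
    have "inv v (v i) < inv v (v j) \<and> inv v (v j) < inv v (v k)"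
      unfolding affine_perm_inverse_simps[OF v] using * by simp
    then have "l (v j) \<le> v k" "\<not> l (v j) \<le> v i"
      using enc * unfolding encodes_def by (metis less_trans, metis less_asym)
    then show False using * by simp
  qed
  then show ?thesis using v enc by blast
qed

lemma encodes_unique_perm:
  assumes n: "n \<ge> 1" and v: "v \<in> affine_perms n" and w: "w \<in> affine_perms n"
    and e: "encodes l v" "encodes l w"
  shows "v = w"
proof -
  have "inversions (inv v) = inversions (inv w)"
    using e by (auto simp: inversions_def encodes_def)
  then have "inv v = inv w" using v w n by (intro affine_perms_eqI_inversions affine_perms_inv) auto
  then have "inv (inv v) = inv (inv w)" by simp
  then show ?thesis using v w by (simp add: inv_inv_eq affine_perms_iff)
qed

lemma encodes_unique_code:
  assumes "postorder_bracketing n l" "postorder_bracketing n m" "encodes l v" "encodes m v"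
  shows "l = m"
proof
  fix b
  have "l b \<le> a \<longleftrightarrow> m b \<le> a" if "a < b" for a
    using assms(3,4) that by (simp add: encodes_def)
  moreover have "l b \<le> b" "m b \<le> b" using assms(1,2) by (auto simp: postorder_bracketing_def)
  ultimately show "l b = m b" by (metis linorder_neqE not_le order_less_le_trans order_refl)
qed

text \<open>For \<open>a < b\<close>, the positions are separated by a label \<open>c > b\<close>
  exactly if \<open>c\<close> has \<open>b\<close> but not \<open>a\<close> in its right subtree,
  that is, \<open>l c \<le> b\<close> and not \<open>l c \<le> a\<close>. The reading order is then
  \<open>a\<close>, \<open>c\<close>, \<open>b\<close>.\<close>

lemma pos_le_encodes:
  assumes v: "v \<in> affine_perms n" and e: "encodes l v" and ne: "a \<noteq> b"
  shows "pos_le v (inv v a) (inv v b) \<longleftrightarrow> descends l a b"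
proof
  note s = affine_perm_inverse_simps[OF v]
  have inj: "inv v x = inv v y \<longleftrightarrow> x = y" for x y by (metis s(1))
  { assume "pos_le v (inv v a) (inv v b)"
    then have ab: "a < b" and nk: "\<not> pos_incomparable v (inv v a) (inv v b)"
      using ne by (auto simp: pos_le_def s inj)
    have "l c \<le> a" if "c > b" "l c \<le> b" for c
    proof (rule ccontr)
      assume "\<not> l c \<le> a"
      then have "inv v c < inv v b" "\<not> inv v c < inv v a"
        using e that ab by (auto simp: encodes_def)
      moreover have "inv v c \<noteq> inv v a" using that ab by (simp add: inj)
      moreover have "v (inv v c) > max (v (inv v a)) (v (inv v b))"
        unfolding s using that ab by simp
      ultimately show False
        using nk unfolding pos_incomparable_def by (metis linorder_neqE max.strict_coboundedI2 min.strict_coboundedI1)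
    qed
    then show "descends l a b" using ab by (simp add: descends_def) }
  { assume d: "descends l a b"
    then have ab: "a < b" by (simp add: descends_def)
    have "\<not> pos_incomparable v (inv v a) (inv v b)"
    proof
      assume "pos_incomparable v (inv v a) (inv v b)"
      then obtain k where k: "min (inv v a) (inv v b) < k" "k < max (inv v a) (inv v b)" "v k > b"
        using ab by (auto simp: pos_incomparable_def s)
      define c where "c = v k"
      have c: "inv v c = k" "c > b" using k by (auto simp: c_def s)
      have "k < inv v b \<longleftrightarrow> l c \<le> b" "k < inv v a \<longleftrightarrow> l c \<le> a"
        using e c ab unfolding encodes_def by auto
      then show False
        using k(1,2) d c ab by (auto simp: descends_def min_def max_def split: if_splits)
    qed
    then show "pos_le v (inv v a) (inv v b)" using ab by (simp add: pos_le_def s) }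
qed

text \<open>\<open>w \<circ> v\<close> puts new labels on the tree read by \<open>v\<close>; the
  tree stays the decreasing tree of the reading if and only if the new labels still grow from
  descendants to ancestors.\<close>

lemma class_preserved_iff_compatible:
  assumes n: "n \<ge> 1" and v: "v \<in> affine_perms n" and w: "w \<in> affine_perms n"
    and e: "encodes l v"
  shows "next_greater (w \<circ> v) = next_greater v \<longleftrightarrow> compatible w l"
proof
  note s = affine_perm_inverse_simps[OF v]
  have V: "inj v" "equivariant n v" using v by (auto simp: affine_perms_iff bij_is_inj)
  have wv: "w \<circ> v \<in> affine_perms n" by (rule affine_perms_comp[OF n w v])
  { assume "next_greater (w \<circ> v) = next_greater v"
    then have eq: "pos_le (w \<circ> v) = pos_le v" by (simp add: pos_le_eq_iff[OF n wv v])
    show "compatible w l" unfolding compatible_def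
    proof (intro allI impI)
      fix a b assume d: "descends l a b"
      then have "a \<noteq> b" by (simp add: descends_def)
      then have "pos_le (w \<circ> v) (inv v a) (inv v b)"
        unfolding eq using pos_le_encodes[OF v e] d by blast
      moreover have "inv v a \<noteq> inv v b" using \<open>a \<noteq> b\<close> by (metis s(1))
      ultimately show "w a < w b" by (simp add: pos_le_def s)
    qed }
  { assume c: "compatible w l"
    have less: "w (v i) < w (v j)" if "pos_le v i j" "i \<noteq> j" for i j
    proof -
      have "v i \<noteq> v j" using that(2) V(1) by (simp add: inj_eq)
      then have "descends l (v i) (v j)"
        using that(1) pos_le_encodes[OF v e, of "v i" "v j"] by (simp add: s)
      then show ?thesis using c by (simp add: compatible_def)
    qed
    show "next_greater (w \<circ> v) = next_greater v"
    proof (rule ext, rule next_greater_eqI)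
      fix i
      define q where "q = next_greater v i"
      have q: "i < q" "v i < v q"
        using next_greater_gt next_greater_value[OF n V(2)] by (auto simp: q_def)
      have btw: "v k < v i" if "i < k" "k < q" for k
        using that unfolding q_def by (intro next_greater_between[OF V(1)])
      show "i < next_greater v i" by (rule next_greater_gt)
      \<comment> \<open>Two kinds of comparisons already fix the next larger entry of
        \<open>i\<close>: \<open>i\<close> lies below \<open>q\<close>, and everything strictly
        between them lies below \<open>i\<close>.\<close>
      have "pos_le v i q" using q btw by (fastforce simp: pos_le_def pos_incomparable_def)
      then show "(w \<circ> v) i < (w \<circ> v) (next_greater v i)" using less[of i q] q by (simp add: q_def)
      fix k assume k: "i < k" "k < next_greater v i"
      then have "pos_le v k i" using pos_le_back_iff[OF n V k(1)] by simp
      then show "(w \<circ> v) k < (w \<circ> v) i" using less[of k i] k by simp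
    qed }
qed

text \<open>A preimage \<open>x\<close> is recovered from \<open>v = pi_down n x\<close> as
  \<open>w \<circ> v\<close>. So preimages correspond to 231-avoiding \<open>v\<close> whose class
  contains \<open>w \<circ> v\<close>, and these to compatible codes.\<close>

lemma uniquely_sorted_iff_unique_compatible:
  assumes n: "n \<ge> 2" and w: "w \<in> affine_perms n"
  shows "uniquely_sorted n w \<longleftrightarrow> (\<exists>!l. postorder_bracketing n l \<and> compatible w l)"
proof -
  have n1: "n \<ge> 1" using n by simp
  define A where "A = {v \<in> affine_perms n. affine_stack_sort n v = w}"
  define B where "B = {v \<in> affine_perms n. avoids_231 v \<and> next_greater (w \<circ> v) = next_greater v}"
  define L where "L = {l. postorder_bracketing n l \<and> compatible w l}"
  have "A = (\<lambda>v. w \<circ> v) ` B"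
  proof (intro equalityI subsetI)
    fix x assume x: "x \<in> A"
    then have xa: "x \<in> affine_perms n" by (simp add: A_def)
    let ?v = "pi_down n x"
    note v = pi_down_props[OF n xa]
    have xw: "x \<circ> inv ?v = w" using x by (simp add: A_def affine_stack_sort_def)
    have "w \<circ> ?v = x \<circ> (inv ?v \<circ> ?v)" unfolding xw[symmetric] by (rule comp_assoc)
    also have "\<dots> = x" using v(1) by (simp add: affine_perms_iff bij_is_inj)
    finally have "w \<circ> ?v = x" .
    then show "x \<in> (\<lambda>v. w \<circ> v) ` B" using v by (intro image_eqI[of _ _ ?v]) (auto simp: B_def)
  next
    fix x assume "x \<in> (\<lambda>v. w \<circ> v) ` B"
    then obtain v where v: "v \<in> affine_perms n" "avoids_231 v" "next_greater (w \<circ> v) = next_greater v" "x = w \<circ> v"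
      by (auto simp: B_def)
    have x: "x \<in> affine_perms n" unfolding v(4) by (rule affine_perms_comp[OF n1 w v(1)])
    have "pi_down n x = v" by (rule pi_down_eq[OF n v(1,2) x]) (simp add: v)
    moreover have "w \<circ> v \<circ> inv v = w"
      using v(1) by (metis affine_perms_iff bij_is_surj comp_assoc comp_id surj_iff)
    ultimately show "x \<in> A" using x by (simp add: A_def affine_stack_sort_def v(4))
  qed
  moreover have "inj_on (\<lambda>v. w \<circ> v) B"
  proof (rule inj_onI, rule ext)
    fix u v i assume "w \<circ> u = w \<circ> v"
    then have "w (u i) = w (v i)" by (metis comp_apply)
    then show "u i = v i" using w by (simp add: affine_perms_iff bij_is_inj inj_eq)
  qed
  ultimately have "card A = card B" by (simp add: card_image)
  also have "card B = card L"
  proof -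
    define f where "f = (\<lambda>l. SOME v. v \<in> affine_perms n \<and> avoids_231 v \<and> encodes l v)"
    have f: "f l \<in> affine_perms n" "avoids_231 (f l)" "encodes l (f l)" if "postorder_bracketing n l" for l
    proof -
      have "\<exists>v. v \<in> affine_perms n \<and> avoids_231 v \<and> encodes l v"
        using encoded_exists[OF n1 that] by blast
      from someI_ex[OF this] show "f l \<in> affine_perms n" "avoids_231 (f l)" "encodes l (f l)"
        by (auto simp: f_def)
    qed
    have "bij_betw f L B" unfolding bij_betw_def
    proof
      show "inj_on f L"
      proof (rule inj_onI)
        fix l m assume "l \<in> L" "m \<in> L" and eq: "f l = f m"
        then have l: "postorder_bracketing n l" and m: "postorder_bracketing n m"
          by (auto simp: L_def)
        show "l = m" using f(3)[OF l] f(3)[OF m] unfolding eq by (rule encodes_unique_code[OF l m])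
      qed
      show "f ` L = B"
      proof (intro equalityI subsetI)
        fix v assume "v \<in> f ` L"
        then obtain l where l: "postorder_bracketing n l" "compatible w l" "v = f l"
          by (auto simp: L_def)
        then show "v \<in> B"
          using f[OF l(1)] class_preserved_iff_compatible[OF n1 _ w] by (simp add: B_def)
      next
        fix v assume "v \<in> B"
        then have v: "v \<in> affine_perms n" "avoids_231 v" "next_greater (w \<circ> v) = next_greater v"
          by (auto simp: B_def)
        obtain l where l: "postorder_bracketing n l" "encodes l v"
          using encoding_exists[OF n1 v(1,2)] by blast
        have "l \<in> L"
          using l class_preserved_iff_compatible[OF n1 v(1) w l(2)] v(3) by (simp add: L_def)
        moreover have "f l = v"
          using encodes_unique_perm[OF n1 f(1)[OF l(1)] v(1) f(3)[OF l(1)] l(2)] .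
        ultimately show "v \<in> f ` L" by blast
      qed
    qed
    then show ?thesis by (simp add: bij_betw_same_card)
  qed
  finally have "uniquely_sorted n w \<longleftrightarrow> card L = 1" by (simp add: uniquely_sorted_def A_def)
  also have "\<dots> \<longleftrightarrow> (\<exists>!l. l \<in> L)" by (auto simp: card_1_singleton_iff)
  finally show ?thesis by (simp add: L_def)
qed

section \<open>Uniquely sorted permutations\<close>

text \<open>The possible ends, up to \<open>y\<close>, of an arc that starts an up step at
  \<open>x - 1\<close> and crosses none of the arcs starting from \<open>x\<close> on.\<close>

definition landings :: "(int \<Rightarrow> int) \<Rightarrow> int \<Rightarrow> int \<Rightarrow> int set" where
  "landings p x y = {j. x < j \<and> j \<le> y \<and> (\<forall>i. x \<le> i \<and> i < j \<longrightarrow> p i \<le> j)}"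

text \<open>Read \<open>p i > i + 1\<close> as an up step and \<open>p i = i + 1\<close> as a down step from \<open>i\<close> to \<open>i + 1\<close>.
  The predicate says that the steps in the window of length \<open>2 k\<close> starting at \<open>x\<close> form a Dyck path
  in which \<open>p\<close> never leaves an up step beyond its matching down step.\<close>

inductive dyck_window :: "(int \<Rightarrow> int) \<Rightarrow> int \<Rightarrow> nat \<Rightarrow> bool" for p where
  dyck_window_0: "dyck_window p x 0"
| dyck_window_step: "dyck_window p (x + 1) j \<Longrightarrow> p (x + 2 * int j + 1) = x + 2 * int j + 2 \<Longrightarrow>
    p x \<in> landings p (x + 1) (x + 2 * int j + 2) \<Longrightarrow> dyck_window p (x + 2 * int j + 2) m \<Longrightarrow>
    dyck_window p x (j + m + 1)"

text \<open>Here \<open>l\<close> sends the endpoint of a down step to the endpoint of the matching up step.\<close>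

definition dyck_matching :: "nat \<Rightarrow> (int \<Rightarrow> int) \<Rightarrow> (int \<Rightarrow> int) \<Rightarrow> bool" where
  "dyck_matching n p l \<longleftrightarrow> postorder_bracketing n l \<and>
     (\<forall>c. p (c - 1) = c \<longrightarrow> l c < c \<and> p (l c - 1) \<noteq> l c \<and> p (l c - 1) \<le> c) \<and>
     (\<forall>c. p (c - 1) \<noteq> c \<longrightarrow> l c = c \<and> (\<exists>d>c. l d = c)) \<and>
     (\<forall>c d. l c < c \<longrightarrow> l d < d \<longrightarrow> l c = l d \<longrightarrow> c = d)"

lemma postorder_bracketingD:
  assumes "postorder_bracketing n l"
  shows "equivariant n l" "l b \<le> b" "l b \<le> a \<Longrightarrow> a < b \<Longrightarrow> l b \<le> l a"
  using assms by (auto simp: postorder_bracketing_def)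

text \<open>At a descent, \<open>a\<close> must not lie below \<open>a + 1\<close>, so some later
  node \<open>c\<close> has \<open>a + 1\<close> but not \<open>a\<close> in its right subtree. For
  consecutive post-order labels this means that the right subtree of \<open>c\<close> opens with the
  leaf \<open>a + 1\<close>.\<close>

lemma compatible_descent:
  assumes l: "postorder_bracketing n l" and c: "compatible w l" and d: "w (a + 1) < w a"
  shows "l (a + 1) = a + 1" "\<exists>c>a + 1. l c = a + 1"
proof -
  note L = postorder_bracketingD[OF l]
  have nd: "\<not> descends l a (a + 1)" using c d by (metis compatible_def less_asym)
  then obtain c where "c > a + 1" "l c \<le> a + 1" "\<not> l c \<le> a" by (auto simp: descends_def)
  then show "\<exists>c>a + 1. l c = a + 1" by force
  show "l (a + 1) = a + 1"
  proof (rule ccontr)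
    assume "l (a + 1) \<noteq> a + 1"
    then have "l (a + 1) \<le> a" using L(2)[of "a + 1"] by simp
    then have "l c \<le> a" if "c > a + 1" "l c \<le> a + 1" for c using L(3)[of c "a + 1"] that by simp
    then show False using nd by (auto simp: descends_def)
  qed
qed

text \<open>Moving the leaf \<open>a + 1\<close> of the tree just in front of \<open>a\<close> turns it into the parent of \<open>a\<close>.\<close>

lemma move_leaf:
  assumes n: "n \<ge> 2" and l: "postorder_bracketing n l" and c: "compatible w l"
    and w: "equivariant n w" and asc: "w a < w (a + 1)" and leaf: "l (a + 1) = a + 1"
  shows "\<exists>l'. postorder_bracketing n l' \<and> compatible w l' \<and> l' \<noteq> l"
proof -
  note L = postorder_bracketingD[OF l]
  define P where "P = (\<lambda>y. int n dvd y - (a + 1))"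
  define h where "h = (\<lambda>y. if P y then y + 1 else y)"
  define g where "g = (\<lambda>y. if P y then y - 1 else y)"
  have P_shift: "P (y + int n) = P y" for y
    using dvd_add_triv_right_iff[of "int n" "y - (a + 1)"] by (simp add: P_def algebra_simps)
  have P_next: "P y \<Longrightarrow> \<not> P (y + 1)" and P_prev: "P y \<Longrightarrow> \<not> P (y - 1)" for y
    using not_dvd_consecutive[OF n, of "y - (a + 1)"] by (simp_all add: P_def algebra_simps)
  have P_rep: "\<exists>m. y = a + 1 + m * int n" if "P y" for y
    using that by (auto simp: P_def dvd_def algebra_simps)
  \<comment> \<open>\<open>h\<close> and \<open>g\<close> are adjoint monotone maps, so the
    conditions on \<open>l'\<close> below reduce to those on \<open>l\<close>:
    \<open>l' b \<le> x\<close> means \<open>l (g b) \<le> g x\<close>.\<close>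
  have hg: "h y \<le> z \<longleftrightarrow> y \<le> g z" for y z
    using P_next by (cases "y = z") (auto simp: h_def g_def)
  have hP: "\<not> P (h y)" for y using P_next by (simp add: h_def)
  have h_mono: "h y \<le> h z" if "y \<le> z" for y z using that by (cases "y = z") (auto simp: h_def)
  have g_mono: "g y \<le> g z" if "y \<le> z" for y z using that by (cases "y = z") (auto simp: g_def)
  have h_shift: "h (y + int n) = h y + int n" and g_shift: "g (y + int n) = g y + int n" for y
    by (simp_all add: h_def g_def P_shift)
  have leafP: "l y = y" if "P y" for y
    using P_rep[OF that] equivariantD[OF L(1), of "a + 1"] leaf by auto
  have ascP: "w (y - 1) < w y" if y: "P y" for y
  proof -
    obtain m where m: "y = a + 1 + m * int n" using P_rep[OF y] by blast
    then have "y - 1 = a + m * int n" by simp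
    then show ?thesis
      using asc equivariantD[OF w, of "a + 1" m] equivariantD[OF w, of a m] m by simp
  qed
  \<comment> \<open>Through \<open>g\<close>, the label \<open>a + 1\<close> receives the subtree of
    labels from \<open>l a\<close> up to \<open>a\<close> as its right subtree; through
    \<open>h\<close>, right subtrees that opened with the leaf \<open>a + 1\<close> open one label
    later. All translates are moved at once.\<close>
  define l' where "l' = (\<lambda>c. h (l (g c)))"
  have "postorder_bracketing n l'" unfolding postorder_bracketing_def
  proof (intro conjI allI impI)
    show "equivariant n l'" using L(1) by (simp add: equivariant_def l'_def h_shift g_shift)
    show "l' b \<le> b" for b by (simp add: l'_def hg L(2))
    fix x b assume "l' b \<le> x" "x < b"
    then have "l (g b) \<le> g x" "g x \<le> g b" by (simp_all add: l'_def hg g_mono)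
    then have "l (g b) \<le> l (g x)" using L(3)[of "g b" "g x"] by (cases "g x = g b") auto
    then show "l' b \<le> l' x" by (simp add: l'_def h_mono)
  qed
  moreover have "compatible w l'" unfolding compatible_def
  proof (intro allI impI)
    fix x y assume d: "descends l' x y"
    then have xy: "x < y" by (simp add: descends_def)
    have gy: "g y \<le> y" "y \<le> g y + 1" and gx: "g x \<le> x" by (auto simp: g_def)
    have le: "w (g y) \<le> w y" using ascP[of y] by (auto simp: g_def)
    show "w x < w y"
    proof (cases "x < g y")
      case True
      have "l c \<le> x" if c: "c > g y" "l c \<le> g y" for c
      proof -
        have "\<not> P c" using leafP[of c] c by auto
        then have gc: "g c = c" by (simp add: g_def)
        have "c \<noteq> y" using \<open>\<not> P c\<close> c by (auto simp: g_def)
        then have "c > y" using c gy by simp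
        moreover have "l' c \<le> y" using c by (simp add: l'_def hg gc)
        ultimately have "l' c \<le> x" using d by (simp add: descends_def)
        then show ?thesis using gx by (simp add: l'_def hg gc)
      qed
      then have "descends l x (g y)" using True by (simp add: descends_def)
      then show ?thesis using c le by (force simp: compatible_def)
    next
      case False
      then have "x = g y" "y = x + 1" "g y \<noteq> y" using xy gy by auto
      then show ?thesis using ascP[of y] by (auto simp: g_def split: if_splits)
    qed
  qed
  moreover have "l' (a + 1) \<noteq> l (a + 1)"
    unfolding leaf using hP[of "l (g (a + 1))"] by (auto simp: l'_def P_def)
  ultimately show ?thesis by metis
qed

text \<open>A right child without left sibling may as well be a left child when its parent is not on
  the infinite left spine.\<close>

lemma move_only_child:
  assumes l: "postorder_bracketing n l" and c: "compatible w l"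
    and ne: "l b < b" and d: "d > b" "l d = l b"
  shows "\<exists>l'. postorder_bracketing n l' \<and> compatible w l' \<and> l' \<noteq> l"
proof -
  note L = postorder_bracketingD[OF l]
  define P where "P = (\<lambda>y. int n dvd y - b)"
  have P_shift: "P (y + m * int n) = P y" for y m
    using dvd_add_times_triv_right_iff[of "int n" "y - b" m] by (simp add: P_def algebra_simps)
  have P_rep: "\<exists>m. y = b + m * int n" if "P y" for y
    using that by (auto simp: P_def dvd_def algebra_simps)
  have nPd: "\<not> P d"
  proof
    assume "P d"
    then obtain m where "d = b + m * int n" using P_rep by blast
    then show False using equivariantD[OF L(1), of b m] d by auto
  qed
  \<comment> \<open>Emptying the right subtree of \<open>b\<close> turns it into the left subtree,
    without changing any label.\<close>
  define l' where "l' = (\<lambda>c. if P c then c else l c)"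
  have "postorder_bracketing n l'" unfolding postorder_bracketing_def
  proof (intro conjI allI impI)
    show "equivariant n l'" using L(1) P_shift[of _ 1] by (simp add: equivariant_def l'_def)
    show "l' b \<le> b" for b using L(2) by (simp add: l'_def)
    fix x y assume *: "l' y \<le> x" "x < y"
    then have "l' y = l y" by (auto simp: l'_def)
    then have "l' y \<le> l x" using * L(3)[of y x] by simp
    then show "l' y \<le> l' x" using L(2)[of x] by (auto simp: l'_def)
  qed
  moreover have "compatible w l'" unfolding compatible_def
  proof (intro allI impI)
    fix x y assume xy: "descends l' x y"
    have "l c \<le> x" if c': "c > y" "l c \<le> y" for c
    proof (cases "P c")
      case True
      then obtain m where m: "c = b + m * int n" using P_rep by blast
      \<comment> \<open>The translate \<open>e\<close> of \<open>d\<close> has the same left end as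
        \<open>c\<close> and is not altered, so resetting \<open>c\<close> creates no new
        descendants.\<close>
      define e where "e = d + m * int n"
      have e: "e > y" "l e = l c" "\<not> P e"
        using d m c' nPd equivariantD[OF L(1)] by (simp_all add: e_def P_shift)
      then show ?thesis using xy c' by (auto simp: descends_def l'_def)
    next
      case False
      then show ?thesis using xy c' by (auto simp: descends_def l'_def)
    qed
    then have "descends l x y" using xy by (simp add: descends_def)
    then show "w x < w y" using c by (simp add: compatible_def)
  qed
  moreover have "l' b \<noteq> l b" using ne by (simp add: l'_def P_def)
  ultimately show ?thesis by metis
qed

lemma next_greater_eq_Suc_iff:
  assumes n: "n \<ge> 1" and w: "inj w" "equivariant n w"
  shows "next_greater w a = a + 1 \<longleftrightarrow> w a < w (a + 1)"
proof
  show "w a < w (a + 1)" if "next_greater w a = a + 1"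
    using next_greater_value[OF n w(2), of a] that by simp
  show "next_greater w a = a + 1" if "w a < w (a + 1)"
    using that by (intro next_greater_eqI) auto
qed

text \<open>By uniqueness neither move applies: the first forces a right subtree at every end of an
  ascent, the second forbids shared left ends. Descents force leaves that open a right subtree, so
  \<open>l\<close> pairs ends of down steps with ends of up steps.\<close>

lemma unique_imp_dyck_matching:
  assumes n: "n \<ge> 2" and w: "inj w" "equivariant n w"
    and l: "postorder_bracketing n l" and c: "compatible w l"
    and uniq: "\<And>m. postorder_bracketing n m \<Longrightarrow> compatible w m \<Longrightarrow> m = l"
  shows "dyck_matching n (next_greater w) l"
proof -
  note L = postorder_bracketingD[OF l]
  define p where "p = next_greater w"
  have asc: "p (b - 1) = b \<longleftrightarrow> w (b - 1) < w b" for b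
    using next_greater_eq_Suc_iff[OF _ w, of "b - 1"] n by (simp add: p_def)
  have dsc: "p (b - 1) \<noteq> b \<longleftrightarrow> w b < w (b - 1)" for b
    unfolding asc
      using w(1) by (metis inj_eq less_asym linorder_neqE add_cancel_right_right diff_eq_eq zero_neq_one)
  have down: "l b < b" if "p (b - 1) = b" for b
  proof (rule ccontr)
    assume "\<not> l b < b"
    then have "l (b - 1 + 1) = b - 1 + 1" using L(2)[of b] by simp
    moreover have "w (b - 1) < w (b - 1 + 1)" using that asc by simp
    ultimately show False using move_leaf[OF n l c w(2), of "b - 1"] uniq by blast
  qed
  have up: "l b = b" "\<exists>d>b. l d = b" if "p (b - 1) \<noteq> b" for b
    using compatible_descent[OF l c, of "b - 1"] that dsc by auto
  have lt: "d \<le> b" if "l b < b" "l d < d" "l b = l d" for b d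
    using move_only_child[OF l c that(1), of d] that uniq by (metis not_le)
  have inj: "b = d" if "l b < b" "l d < d" "l b = l d" for b d
    using lt[OF that] lt[OF that(2,1) that(3)[symmetric]] by simp
  have "p (l b - 1) \<noteq> l b \<and> p (l b - 1) \<le> b" if b: "l b < b" for b
  proof
    show "p (l b - 1) \<noteq> l b" using down[of "l b"] L(3)[of b "l b"] b by auto
    \<comment> \<open>\<open>l b - 1\<close> is the left child of \<open>b\<close>: a later node
      whose right subtree contains \<open>b\<close> cannot start at \<open>l b\<close> as well,
      hence contains \<open>l b - 1\<close> too.\<close>
    have "descends l (l b - 1) b" unfolding descends_def
    proof (intro conjI allI impI)
      show "l b - 1 < b" using b by simp
      fix c assume c: "c > b" "l c \<le> b"
      then have "l c \<le> l b" by (intro L(3))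
      moreover have "l c \<noteq> l b" using inj[of b c] b c by auto
      ultimately show "l c \<le> l b - 1" by simp
    qed
    then have "w (l b - 1) < w b" using c by (simp add: compatible_def)
    then have "\<not> b < p (l b - 1)"
      using next_greater_between[OF w(1), of "l b - 1" b] b unfolding p_def by force
    then show "p (l b - 1) \<le> b" by simp
  qed
  note bound = this
  show ?thesis unfolding dyck_matching_def p_def[symmetric]
  proof (intro conjI allI impI)
    fix b
    assume "p (b - 1) = b"
    then have b: "l b < b" by (rule down)
    then show "l b < b" "p (l b - 1) \<noteq> l b" "p (l b - 1) \<le> b" using bound[OF b] by blast+
  next
    fix b d assume "l b < b" "l d < d" "l b = l d"
    then show "b = d" by (rule inj)
  qed (fact l up)+
qed

text \<open>From \<open>x\<close> one climbs to \<open>y\<close> by shorter steps: to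
  \<open>x + 1\<close> if this is an ascent, and otherwise along
  \<open>w x < w (p x) \<le> w c \<le> w y\<close>, where \<open>c\<close> is matched with the up
  step leaving \<open>x\<close>. The bound \<open>p x \<le> c\<close> in the matching makes this
  chain possible.\<close>

lemma dyck_matching_imp_compatible:
  assumes n: "n \<ge> 1" and w: "inj w" "equivariant n w" and m: "dyck_matching n (next_greater w) l"
  shows "compatible w l"
  unfolding compatible_def
proof (intro allI impI)
  define p where "p = next_greater w"
  have l: "postorder_bracketing n l" using m by (simp add: dyck_matching_def)
  note L = postorder_bracketingD[OF l]
  have pw: "w i < w (p i)" "i < p i" for i
    using next_greater_value[OF n w(2)] next_greater_gt by (auto simp: p_def)
  fix x y assume "descends l x y"
  then show "w x < w y"
  proof (induction "nat (y - x)" arbitrary: x y rule: less_induct)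
    case less
    have xy: "x < y" and d: "\<And>c. c > y \<Longrightarrow> l c \<le> y \<Longrightarrow> l c \<le> x"
      using less.prems by (auto simp: descends_def)
    show ?case
    proof (cases "p x = x + 1")
      case True
      have "w (x + 1) < w y \<or> x + 1 = y"
      proof (cases "x + 1 = y")
        case False
        then have "descends l (x + 1) y" using xy d by (force simp: descends_def)
        then show ?thesis using xy by (intro disjI1 less.hyps) auto
      qed simp
      then show ?thesis using pw(1)[of x] True by auto
    next
      case False
      then obtain c where c: "c > x + 1" "l c = x + 1"
        using m unfolding dyck_matching_def p_def[symmetric] by (metis add_diff_cancel_right')
      have cy: "c \<le> y" using d[of c] c xy by force
      have "p (c - 1) = c"
        using m c unfolding dyck_matching_def p_def[symmetric] by (metis less_irrefl)
      then have pc: "p x \<le> c"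
        using m c unfolding dyck_matching_def p_def[symmetric] by (metis add_diff_cancel_right')
      have 1: "w (p x) \<le> w c"
      proof (cases "p x = c")
        case False
        have "descends l (p x) c" unfolding descends_def
        proof (intro conjI allI impI)
          show "p x < c" using pc False by simp
          fix e assume "e > c" "l e \<le> c"
          then have "l e \<le> x + 1" using L(3)[of e c] c by simp
          then show "l e \<le> p x" using pw(2)[of x] by simp
        qed
        moreover have "nat (c - p x) < nat (y - x)" using pw(2)[of x] cy xy by simp
        ultimately have "w (p x) < w c" by (intro less.hyps)
        then show ?thesis by simp
      qed simp
      have 2: "w c \<le> w y"
      proof (cases "c = y")
        case False
        have "descends l c y" unfolding descends_def
          using False cy d c by force
        moreover have "nat (y - c) < nat (y - x)" using c cy by simp
        ultimately have "w c < w y" by (intro less.hyps)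
        then show ?thesis by simp
      qed simp
      show ?thesis using 1 2 pw(1)[of x] by simp
    qed
  qed
qed

section \<open>Uniqueness of noncrossing matchings\<close>

text \<open>Compare \<open>c\<close> with the \<open>m\<close>-partner \<open>d\<close> of
  \<open>l c\<close>. If \<open>d < c\<close>, the \<open>l\<close>-arc of \<open>d\<close> is
  nested in that of \<open>c\<close> and shorter; if \<open>d > c\<close>, the \<open>m\<close>-arc
  of \<open>c\<close> is nested in that of \<open>d\<close> and shorter than the
  \<open>l\<close>-arc of \<open>c\<close>. Either way the matchings agree on a shorter arc, a
  contradiction.\<close>

lemma noncrossing_matching_unique_step:
  fixes l m :: "int \<Rightarrow> int"
  assumes l: "\<And>a b. l b \<le> a \<Longrightarrow> a < b \<Longrightarrow> l b \<le> l a"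
    and m: "\<And>a b. m b \<le> a \<Longrightarrow> a < b \<Longrightarrow> m b \<le> m a"
    and lt: "\<And>c. c \<in> D \<Longrightarrow> l c < c \<and> l c \<in> U" "\<And>c. c \<in> D \<Longrightarrow> m c < c \<and> m c \<in> U"
    and inj: "inj_on l D" and surj: "\<And>u. u \<in> U \<Longrightarrow> \<exists>c\<in>D. m c = u"
    and IH: "\<And>d. d \<in> D \<Longrightarrow> d - l d < c - l c \<or> d - m d < c - l c \<Longrightarrow> l d = m d"
    and c: "c \<in> D"
  shows "l c = m c"
proof (rule ccontr)
  assume ne: "l c \<noteq> m c"
  obtain d where d: "d \<in> D" "m d = l c" using surj lt(1)[OF c] by blast
  have "d \<noteq> c" using d ne by auto
  then consider "d < c" | "c < d" by linarith
  then show False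
  proof cases
    case 1
    moreover have "l c < d" using lt(2)[OF d(1)] d(2) by simp
    ultimately have "l c \<le> l d" by (intro l) auto
    then have "l d = l c" using IH[OF d(1)] d(2) 1 by simp
    then show False using inj \<open>d \<noteq> c\<close> c d(1) by (auto simp: inj_on_def)
  next
    case 2
    then have "m d \<le> m c" using lt(1)[OF c] d(2) by (intro m) auto
    then show False using IH[OF c] d(2) ne by force
  qed
qed

lemma noncrossing_matching_unique:
  fixes l m :: "int \<Rightarrow> int"
  assumes l: "\<And>a b. l b \<le> a \<Longrightarrow> a < b \<Longrightarrow> l b \<le> l a"
    and m: "\<And>a b. m b \<le> a \<Longrightarrow> a < b \<Longrightarrow> m b \<le> m a"
    and lt: "\<And>c. c \<in> D \<Longrightarrow> l c < c \<and> l c \<in> U" "\<And>c. c \<in> D \<Longrightarrow> m c < c \<and> m c \<in> U"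
    and off: "\<And>c. c \<notin> D \<Longrightarrow> l c = c" "\<And>c. c \<notin> D \<Longrightarrow> m c = c"
    and inj: "inj_on l D" "inj_on m D"
    and surj: "\<And>u. u \<in> U \<Longrightarrow> \<exists>c\<in>D. l c = u" "\<And>u. u \<in> U \<Longrightarrow> \<exists>c\<in>D. m c = u"
  shows "l = m"
proof
  have "\<forall>c\<in>D. (nat (c - l c) = k \<or> nat (c - m c) = k) \<longrightarrow> l c = m c" for k
  proof (induction k rule: less_induct)
    case (less k)
    have IH: "l d = m d" if "d \<in> D" "nat (d - l d) < k \<or> nat (d - m d) < k" for d
      using less that by blast
    show ?case
    proof (intro ballI impI)
      fix c assume c: "c \<in> D" and "nat (c - l c) = k \<or> nat (c - m c) = k"
      then consider "nat (c - l c) = k" | "nat (c - m c) = k" by blast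
      then show "l c = m c"
      proof cases
        case 1
        show ?thesis
        proof (rule noncrossing_matching_unique_step[OF l m lt inj(1) surj(2) _ c])
          fix d assume "d \<in> D" "d - l d < c - l c \<or> d - m d < c - l c"
          then show "l d = m d" using 1 lt(1)[OF c] by (intro IH) auto
        qed
      next
        case 2
        have "m c = l c"
        proof (rule noncrossing_matching_unique_step[OF m l lt(2,1) inj(2) surj(1) _ c])
          fix d assume "d \<in> D" "d - m d < c - m c \<or> d - l d < c - m c"
          then have "l d = m d" using 2 lt(2)[OF c] by (intro IH) auto
          then show "m d = l d" by simp
        qed
        then show ?thesis by simp
      qed
    qed
  qed
  then have "l c = m c" if "c \<in> D" for c using that by blast
  then show "l c = m c" for c using off by metis
qed

text \<open>The competitor \<open>m\<close> is not assumed to be a matching. Modulo the period,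
  \<open>l\<close> injects \<open>D\<close> into \<open>U\<close>, descents of \<open>w\<close> give
  each element of \<open>U\<close> a preimage under \<open>m\<close> in \<open>I\<close>, and
  \<open>I\<close> is contained in \<open>D\<close>. The inequalities of cardinalities close up, so
  \<open>m\<close> matches \<open>D\<close> with \<open>U\<close> as well.\<close>

lemma dyck_matching_unique:
  assumes n: "n \<ge> 1" and w: "inj w" "equivariant n w" and l: "dyck_matching n (next_greater w) l"
    and m: "postorder_bracketing n m" "compatible w m"
  shows "m = l"
proof -
  define p where "p = next_greater w"
  have pb: "postorder_bracketing n l" using l by (simp add: dyck_matching_def)
  note L = postorder_bracketingD[OF pb] and M = postorder_bracketingD[OF m(1)]
  have ep: "equivariant n p"
    using bracketing_next_greater[OF n w] by (simp add: p_def bracketing_def)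
  have down: "l c < c \<and> p (l c - 1) \<noteq> l c" if "p (c - 1) = c" for c
    using l that unfolding dyck_matching_def p_def[symmetric] by blast
  have up: "l c = c" "\<exists>d>c. l d = c" if "p (c - 1) \<noteq> c" for c
    using l that unfolding dyck_matching_def p_def[symmetric] by blast+
  have inj: "c = d" if "l c < c" "l d < d" "l c = l d" for c d
    using l that unfolding dyck_matching_def by blast
  have upm: "m c = c" "\<exists>d>c. m d = c" if "p (c - 1) \<noteq> c" for c
  proof -
    have "\<not> w (c - 1) < w c"
      using that next_greater_eq_Suc_iff[OF n w, of "c - 1"] by (simp add: p_def)
    moreover have "w (c - 1) \<noteq> w c" using w(1) by (simp add: inj_eq)
    ultimately have "w (c - 1 + 1) < w (c - 1)" by simp
    from compatible_descent[OF m this] show "m c = c" "\<exists>d>c. m d = c" by simp_all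
  qed
  \<comment> \<open>\<open>D\<close> and \<open>U\<close> are the ends of down and up steps;
    \<open>I\<close> is the set of labels with a nonempty right subtree in the code
    \<open>m\<close>.\<close>
  define D where "D = {c. p (c - 1) = c}"
  define U where "U = {c. p (c - 1) \<noteq> c}"
  define I where "I = {c. m c < c}"
  have D_shift: "c + k * int n \<in> D \<longleftrightarrow> c \<in> D" for c k
    using equivariantD[OF ep, of "c - 1" k] by (simp add: D_def algebra_simps)
  have U_shift: "c + k * int n \<in> U \<longleftrightarrow> c \<in> U" for c k
    using D_shift[of c k] by (simp add: D_def U_def)
  have I_shift: "c + k * int n \<in> I \<longleftrightarrow> c \<in> I" for c k
    using equivariantD[OF M(1), of c k] by (simp add: I_def)
  have "I \<subseteq> D" using upm(1) by (force simp: I_def D_def)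
  define r where "r = (\<lambda>x. x - (x - 1) div int n * int n)"
  have r: "r x \<in> {1..int n}" for x unfolding r_def by (rule residue_window[OF n])
  have r_rep: "\<exists>y k. r x = y \<and> x = y + k * int n" for x by (auto simp: r_def)
  have r_eq: "\<exists>k. x = y + k * int n" if "r x = r y" for x y
    using that
      by (intro exI[of _ "(x - 1) div int n - (y - 1) div int n"]) (simp add: r_def algebra_simps)
  let ?W = "{1..int n}"
  have rU: "r u \<in> U \<longleftrightarrow> u \<in> U" for u
  proof -
    obtain d k where d: "r u = d" and k: "u = d + k * int n" using r_rep by blast
    show ?thesis unfolding d by (simp only: k U_shift)
  qed
  have same: "c = d" if "c \<in> ?W" "d \<in> ?W" "c = d + k * int n" for c d k
  proof -
    have "k = 0"
      using that by (intro residue_window_unique[of d n k]) (simp_all del: atLeastAtMost_iff)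
    then show ?thesis using that by simp
  qed
  have "card (D \<inter> ?W) \<le> card (U \<inter> ?W)"
  proof (rule card_inj_on_le)
    show "inj_on (\<lambda>c. r (l c)) (D \<inter> ?W)"
    proof (rule inj_onI)
      fix c d assume c: "c \<in> D \<inter> ?W" and d: "d \<in> D \<inter> ?W" and "r (l c) = r (l d)"
      then obtain k where "l c = l d + k * int n" using r_eq by blast
      then have "l c = l (d + k * int n)" using equivariantD[OF L(1)] by simp
      moreover have "d + k * int n \<in> D" using d by (simp add: D_shift)
      then have "l (d + k * int n) < d + k * int n" using down unfolding D_def by blast
      moreover have "l c < c" using c down unfolding D_def by blast
      ultimately have "c = d + k * int n" using inj[of c "d + k * int n"] by blast
      then show "c = d" using same c d by blast
    qed
    show "(\<lambda>c. r (l c)) ` (D \<inter> ?W) \<subseteq> U \<inter> ?W"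
    proof (rule image_subsetI)
      fix c assume "c \<in> D \<inter> ?W"
      then have "l c \<in> U" using down by (simp add: D_def U_def)
      then show "r (l c) \<in> U \<inter> ?W" using r rU by blast
    qed
  qed simp
  moreover have UI: "U \<inter> ?W \<subseteq> (\<lambda>c. r (m c)) ` (I \<inter> ?W)"
  proof
    fix u assume u: "u \<in> U \<inter> ?W"
    then obtain c where c: "c > u" "m c = u" using upm(2) by (auto simp: U_def)
    obtain d k where d: "r c = d" and k: "c = d + k * int n" using r_rep by blast
    have mc: "m c = m d + k * int n" unfolding k by (rule equivariantD[OF M(1)])
    have "d \<in> I" using c mc k by (simp add: I_def)
    moreover have "r (m d) = u"
    proof -
      obtain e k' where e: "r (m d) = e" and k': "m d = e + k' * int n" using r_rep by blast
      have "u = e + (k' + k) * int n" using c mc k' by (simp add: algebra_simps)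
      moreover have "e \<in> ?W" using r[of "m d"] unfolding e .
      ultimately have "u = e" using u same[of u e] by blast
      then show ?thesis using e by simp
    qed
    moreover have "d \<in> ?W" using r[of c] unfolding d .
    ultimately show "u \<in> (\<lambda>c. r (m c)) ` (I \<inter> ?W)" by (intro image_eqI[of _ _ d]) auto
  qed
  moreover have "card (U \<inter> ?W) \<le> card ((\<lambda>c. r (m c)) ` (I \<inter> ?W))" by (rule card_mono[OF _ UI]) simp
  moreover have "card ((\<lambda>c. r (m c)) ` (I \<inter> ?W)) \<le> card (I \<inter> ?W)" by (rule card_image_le) simp
  moreover have "card (I \<inter> ?W) \<le> card (D \<inter> ?W)" using \<open>I \<subseteq> D\<close> by (intro card_mono) auto
  ultimately have cards: "card (I \<inter> ?W) = card (D \<inter> ?W)"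
    "card ((\<lambda>c. r (m c)) ` (I \<inter> ?W)) = card (I \<inter> ?W)" "card (U \<inter> ?W) = card ((\<lambda>c. r (m c)) ` (I \<inter> ?W))"
    by linarith+
  have "I \<inter> ?W = D \<inter> ?W" using \<open>I \<subseteq> D\<close> cards(1) by (intro card_subset_eq) auto
  have ID: "I = D"
  proof (intro equalityI subsetI)
    fix c assume "c \<in> D"
    moreover obtain d k where d: "r c = d" and k: "c = d + k * int n" using r_rep by blast
    moreover have "d \<in> ?W" using r[of c] unfolding d .
    ultimately have "d \<in> D \<inter> ?W" using D_shift[of d k] by simp
    then have "d \<in> I" using \<open>I \<inter> ?W = D \<inter> ?W\<close> by blast
    then show "c \<in> I" unfolding k I_shift .
  qed (use \<open>I \<subseteq> D\<close> in blast)
  have inj_r: "inj_on (\<lambda>c. r (m c)) (I \<inter> ?W)" using cards(2) by (intro eq_card_imp_inj_on) auto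
  have img: "(\<lambda>c. r (m c)) ` (I \<inter> ?W) = U \<inter> ?W"
    using UI cards(3) by (intro card_subset_eq[symmetric]) auto
  have inj_m: "inj_on m D"
  proof (rule inj_onI)
    fix c d assume c: "c \<in> D" and d: "d \<in> D" and eq: "m c = m d"
    obtain c' k where c': "r c = c'" and k: "c = c' + k * int n" using r_rep by blast
    obtain d' k' where d': "r d = d'" and k': "d = d' + k' * int n" using r_rep by blast
    have mm: "m c' + k * int n = m d' + k' * int n"
      using eq equivariantD[OF M(1)] unfolding k k' by simp
    have "c' \<in> ?W" "d' \<in> ?W" using r[of c] r[of d] unfolding c' d' .
    moreover have "c' \<in> I" "d' \<in> I" using c d unfolding k k' D_shift ID .
    ultimately have "c' \<in> I \<inter> ?W" "d' \<in> I \<inter> ?W" by blast+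
    moreover have "r (m c') = r (m d')"
    proof -
      obtain a i where a: "r (m c') = a" and i: "m c' = a + i * int n" using r_rep by blast
      obtain b j where b: "r (m d') = b" and j: "m d' = b + j * int n" using r_rep by blast
      have "a + i * int n + k * int n = b + j * int n + k' * int n" using mm unfolding i j .
      then have "a = b + (j + k' - i - k) * int n" by (simp add: left_diff_distrib distrib_right)
      moreover have "a \<in> ?W" "b \<in> ?W" using r[of "m c'"] r[of "m d'"] unfolding a b .
      ultimately have "a = b" using same[of a b] by blast
      then show ?thesis using a b by simp
    qed
    ultimately have "c' = d'" using inj_r by (simp add: inj_on_def)
    then show "c = d" using mm k k' by simp
  qed
  have mU: "m c \<in> U" if c: "c \<in> D" for c
  proof -
    obtain d k where d: "r c = d" and k: "c = d + k * int n" using r_rep by blast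
    have "d \<in> ?W" using r[of c] unfolding d .
    moreover have "d \<in> I" using c unfolding k D_shift ID .
    ultimately have "d \<in> I \<inter> ?W" by blast
    then have "r (m d) \<in> U" using img by blast
    then show ?thesis unfolding k equivariantD[OF M(1)] by (simp add: rU U_shift)
  qed
  show "m = l"
  proof (rule noncrossing_matching_unique[where D = D and U = U])
    show "m b \<le> m a" if "m b \<le> a" "a < b" for a b using M(3) that by blast
    show "l b \<le> l a" if "l b \<le> a" "a < b" for a b using L(3) that by blast
    show "m c < c \<and> m c \<in> U" if "c \<in> D" for c using that ID mU by (auto simp: I_def)
    show "l c < c \<and> l c \<in> U" if "c \<in> D" for c using that down by (auto simp: D_def U_def)
    show "m c = c" "l c = c" if "c \<notin> D" for c using that up upm by (auto simp: D_def)
    show "inj_on m D" by (rule inj_m)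
    show "inj_on l D"
    proof (rule inj_onI)
      fix c d assume "c \<in> D" "d \<in> D" "l c = l d"
      then show "c = d" using inj[of c d] down unfolding D_def by blast
    qed
    show "\<exists>c\<in>D. m c = u" if u: "u \<in> U" for u
    proof -
      obtain c where "c > u" "m c = u" using upm(2)[of u] u by (auto simp: U_def)
      then have "c \<in> D" unfolding ID[symmetric] by (simp add: I_def)
      then show ?thesis using \<open>m c = u\<close> by blast
    qed
    show "\<exists>c\<in>D. l c = u" if u: "u \<in> U" for u
    proof -
      obtain c where c: "c > u" "l c = u" using up(2)[of u] u by (auto simp: U_def)
      then have "c \<in> D" using up(1)[of c] by (force simp: D_def)
      then show ?thesis using c by blast
    qed
  qed
qed

section \<open>Matchings and Dyck windows\<close>

lemma dyck_matchingD:
  assumes "dyck_matching n p l"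
  shows "postorder_bracketing n l"
    "p (c - 1) = c \<Longrightarrow> l c < c" "p (c - 1) = c \<Longrightarrow> p (l c - 1) \<le> c"
    "p (c - 1) \<noteq> c \<Longrightarrow> l c = c" "p (c - 1) \<noteq> c \<Longrightarrow> \<exists>d>c. l d = c"
    "l c < c \<Longrightarrow> l d < d \<Longrightarrow> l c = l d \<Longrightarrow> c = d"
  using assms unfolding dyck_matching_def by blast+

text \<open>The last two hypotheses say that the matching pairs the labels in
  \<open>{x + 1..y}\<close> among themselves. The partner \<open>z\<close> of the first up step cuts
  this stretch into the inside of an arch and a remainder, both closed in the same sense.\<close>

lemma dyck_window_of_closed:
  assumes p: "bracketing n p" and l: "dyck_matching n p l"
    and "x \<le> y"
    and "\<And>c. x < c \<Longrightarrow> c \<le> y \<Longrightarrow> x < l c" "\<And>c. x < l c \<Longrightarrow> l c \<le> y \<Longrightarrow> c \<le> y"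
  shows "\<exists>k. y = x + 2 * int k \<and> dyck_window p x k"
  using assms(3-)
proof (induction "nat (y - x)" arbitrary: x y rule: less_induct)
  case less
  note L = postorder_bracketingD(2,3)[OF dyck_matchingD(1)[OF l]]
  note down = dyck_matchingD(2,3)[OF l] and up = dyck_matchingD(4,5)[OF l] and inj = dyck_matchingD(6)[OF l]
  have P: "i < p i" "i < j \<Longrightarrow> j < p i \<Longrightarrow> p j \<le> p i" for i j
    using p by (auto simp: bracketing_def)
  show ?case
  proof (cases "x = y")
    case True
    then show ?thesis by (intro exI[of _ 0]) (simp add: dyck_window_0)
  next
    case False
    then have xy: "x < y" using less.prems by simp
    have "p x \<noteq> x + 1"
      using down(1)[of "x + 1"] less.prems(2)[of "x + 1"] xy by force
    then obtain z where z: "z > x + 1" "l z = x + 1" using up(2)[of "x + 1"] by auto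
    have zy: "z \<le> y" using less.prems(3)[of z] z xy by simp
    have pz: "p (z - 1) = z" using up(1)[of z] z by auto
    have "\<exists>j. z - 1 = x + 1 + 2 * int j \<and> dyck_window p (x + 1) j"
    proof (rule less.hyps)
      show "nat (z - 1 - (x + 1)) < nat (y - x)" using zy xy by simp
      show "x + 1 \<le> z - 1" using z by simp
      fix c assume c: "x + 1 < c" "c \<le> z - 1"
      then have "l c \<ge> x + 1" using L(2)[of z c] z by simp
      moreover have "l c \<noteq> x + 1" using inj[of c z] c z by force
      ultimately show "x + 1 < l c" by simp
    next
      fix c assume c: "x + 1 < l c" "l c \<le> z - 1"
      show "c \<le> z - 1"
      proof (rule ccontr)
        assume "\<not> c \<le> z - 1"
        moreover have "c \<noteq> z" using c z by auto
        ultimately have "l c \<le> l z" using c by (intro L(2)) auto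
        then show False using c z by simp
      qed
    qed
    then obtain j where j: "z - 1 = x + 1 + 2 * int j" "dyck_window p (x + 1) j" by blast
    have "\<exists>k. y = z + 2 * int k \<and> dyck_window p z k"
    proof (rule less.hyps)
      show "nat (y - z) < nat (y - x)" using z zy by simp
      show "z \<le> y" by (rule zy)
      fix c assume c: "z < c" "c \<le> y"
      show "z < l c"
      proof (rule ccontr)
        assume "\<not> z < l c"
        then have "l c \<le> l z" using c by (intro L(2)) auto
        moreover have "x < l c" using less.prems(2)[of c] c z by simp
        ultimately have "c = z" using inj[of c z] c z by simp
        then show False using c by simp
      qed
    next
      fix c assume "z < l c" "l c \<le> y"
      then show "c \<le> y" using less.prems(3)[of c] z by simp
    qed
    then obtain m where m: "y = z + 2 * int m" "dyck_window p z m" by blast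
    have zj: "z = x + 2 * int j + 2" "z - 1 = x + 2 * int j + 1" using j by simp_all
    have px: "x + 1 < p x" "p x \<le> z" using P(1)[of x] \<open>p x \<noteq> x + 1\<close> down(2)[OF pz] z by simp_all
    have "dyck_window p x (j + m + 1)"
    proof (rule dyck_window_step)
      show "dyck_window p (x + 1) j" by fact
      show "p (x + 2 * int j + 1) = x + 2 * int j + 2"
        unfolding zj(1)[symmetric] zj(2)[symmetric] by (rule pz)
      show "p x \<in> landings p (x + 1) (x + 2 * int j + 2)"
        unfolding landings_def zj(1)[symmetric]
      proof (intro CollectI conjI allI impI px)
        fix i assume "x + 1 \<le> i \<and> i < p x"
        then show "p i \<le> p x" using P(2)[of x i] by simp
      qed
      show "dyck_window p (x + 2 * int j + 2) m" using m zj by simp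
    qed
    then show ?thesis using m zj by (intro exI[of _ "j + m + 1"]) simp
  qed
qed

text \<open>Matched arcs are shorter than a period, so there is a cut that none of them crosses: 0
  itself, or else the last label whose arc passes over 0, since any arc across that label would pass
  over 0 too.\<close>

lemma dyck_window_exists:
  assumes k: "k \<ge> 1" and p: "bracketing (2 * k) p" and l: "dyck_matching (2 * k) p l"
  shows "\<exists>x. dyck_window p x k"
proof -
  define n where "n = 2 * k"
  have n: "n \<ge> 1" using k by (simp add: n_def)
  have "postorder_bracketing n l" using l by (simp add: dyck_matching_def n_def)
  note L = postorder_bracketingD[OF this]
  have bound: "c < l c + int n" for c
  proof (rule ccontr)
    assume *: "\<not> ?thesis"
    have "l (c + (- 1) * int n) = l c + (- 1) * int n" by (rule equivariantD[OF L(1)])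
    moreover have "l c \<le> l (c - int n)" using * n by (intro L(3)) auto
    ultimately show False using n by simp
  qed
  have "\<exists>x. \<forall>c>x. l c > x"
  proof -
    define S where "S = {c. c > 0 \<and> l c \<le> 0}"
    have S: "S \<subseteq> {0..int n}"
    proof
      fix c assume "c \<in> S" then show "c \<in> {0..int n}" using bound[of c] by (simp add: S_def)
    qed
    then have fin: "finite S" by (rule finite_subset) simp
    show ?thesis
    proof (cases "S = {}")
      case True
      then show ?thesis by (intro exI[of _ 0]) (force simp: S_def)
    next
      case False
      define b where "b = Max S"
      have "b \<in> S" unfolding b_def using fin False by (rule Max_in)
      then have b: "b > 0" "l b \<le> 0" by (auto simp: S_def)
      have "l c > b" if "c > b" for c
      proof (rule ccontr)
        assume "\<not> l c > b"
        then have "l c \<le> l b" using that by (intro L(3)) auto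
        then have "c \<in> S" using that b by (simp add: S_def)
        then have "c \<le> b" unfolding b_def using fin by simp
        then show False using that by simp
      qed
      then show ?thesis by blast
    qed
  qed
  then obtain x where x: "\<And>c. c > x \<Longrightarrow> l c > x" by blast
  have x': "l c > x + int n" if "c > x + int n" for c
  proof -
    have "l (c + (- 1) * int n) = l c + (- 1) * int n" by (rule equivariantD[OF L(1)])
    then show ?thesis using x[of "c - int n"] that by simp
  qed
  have "\<exists>j. x + int n = x + 2 * int j \<and> dyck_window p x j"
  proof (rule dyck_window_of_closed[OF p l])
    show "c \<le> x + int n" if "x < l c" "l c \<le> x + int n" for c using x'[of c] that by linarith
  qed (use x in auto)
  then show ?thesis by (auto simp: n_def)
qed

text \<open>The conditions of \<open>dyck_matching\<close> confined to one stretch and freed from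
  periodicity, so that matchings can be glued.\<close>

definition window_matching :: "(int \<Rightarrow> int) \<Rightarrow> int \<Rightarrow> int \<Rightarrow> (int \<Rightarrow> int) \<Rightarrow> bool" where
  "window_matching p x y l \<longleftrightarrow>
     (\<forall>c. x < c \<longrightarrow> c \<le> y \<longrightarrow> x < l c \<and> l c \<le> c) \<and>
     (\<forall>c. x < c \<longrightarrow> c \<le> y \<longrightarrow> p (c - 1) = c \<longrightarrow> l c < c \<and> p (l c - 1) \<noteq> l c \<and> p (l c - 1) \<le> c) \<and>
     (\<forall>c. x < c \<longrightarrow> c \<le> y \<longrightarrow> p (c - 1) \<noteq> c \<longrightarrow> l c = c \<and> (\<exists>d. c < d \<and> d \<le> y \<and> l d = c)) \<and>
     (\<forall>a b. x < a \<longrightarrow> a < b \<longrightarrow> b \<le> y \<longrightarrow> l b \<le> a \<longrightarrow> l b \<le> l a) \<and>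
     (\<forall>c d. x < c \<longrightarrow> c \<le> y \<longrightarrow> x < d \<longrightarrow> d \<le> y \<longrightarrow> l c < c \<longrightarrow> l d < d \<longrightarrow> l c = l d \<longrightarrow> c = d)"

lemma window_matchingD:
  assumes "window_matching p x y l"
  shows "x < c \<Longrightarrow> c \<le> y \<Longrightarrow> x < l c" "x < c \<Longrightarrow> c \<le> y \<Longrightarrow> l c \<le> c"
    "x < c \<Longrightarrow> c \<le> y \<Longrightarrow> p (c - 1) = c \<Longrightarrow> l c < c \<and> p (l c - 1) \<noteq> l c \<and> p (l c - 1) \<le> c"
    "x < c \<Longrightarrow> c \<le> y \<Longrightarrow> p (c - 1) \<noteq> c \<Longrightarrow> l c = c"
    "x < c \<Longrightarrow> c \<le> y \<Longrightarrow> p (c - 1) \<noteq> c \<Longrightarrow> \<exists>d. c < d \<and> d \<le> y \<and> l d = c"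
    "x < a \<Longrightarrow> a < b \<Longrightarrow> b \<le> y \<Longrightarrow> l b \<le> a \<Longrightarrow> l b \<le> l a"
    "x < c \<Longrightarrow> c \<le> y \<Longrightarrow> x < d \<Longrightarrow> d \<le> y \<Longrightarrow> l c < c \<Longrightarrow> l d < d \<Longrightarrow> l c = l d \<Longrightarrow> c = d"
  using assms unfolding window_matching_def by blast+

lemma window_matching_step:
  assumes l1: "window_matching p (x + 1) (z - 1) l1" and l2: "window_matching p z y l2"
    and xz: "x + 1 < z" "z \<le> y" and px: "p x \<noteq> x + 1" "p x \<le> z" and pz: "p (z - 1) = z"
  shows "\<exists>l. window_matching p x y l"
proof -
  \<comment> \<open>The new arc joins \<open>z\<close> to \<open>x + 1\<close>; as the end of an up
    step, \<open>x + 1\<close> is itself a leaf.\<close>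
  define l where "l = (\<lambda>c. if c = x + 1 \<or> c = z then x + 1 else if c < z then l1 c else l2 c)"
  have lx: "l (x + 1) = x + 1" and lz: "l z = x + 1" by (simp_all add: l_def)
  have li: "l c = l1 c" if "x + 1 < c" "c \<le> z - 1" for c using that by (simp add: l_def)
  have lo: "l c = l2 c" if "z < c" for c using that xz by (simp add: l_def)
  note A = window_matchingD[OF l1] and B = window_matchingD[OF l2]
  have split: "c = x + 1 \<or> (x + 1 < c \<and> c \<le> z - 1) \<or> c = z \<or> (z < c \<and> c \<le> y)"
    if "x < c" "c \<le> y" for c using that by linarith
  have "window_matching p x y l" unfolding window_matching_def
  proof (intro conjI allI impI)
    fix c assume c: "x < c" "c \<le> y"
    show "x < l c" "l c \<le> c"
      using split[OF c] A(1,2)[of c] B(1,2)[of c] xz li[of c] lo[of c] by (auto simp: lx lz)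
  next
    fix c assume c: "x < c" "c \<le> y" and pc: "p (c - 1) = c"
    have "c \<noteq> x + 1" using pc px(1) by auto
    then consider "x + 1 < c" "c \<le> z - 1" | "c = z" | "z < c" "c \<le> y" using split[OF c] by blast
    then have "l c < c \<and> p (l c - 1) \<noteq> l c \<and> p (l c - 1) \<le> c"
    proof cases
      case 1 then show ?thesis using A(3)[OF 1 pc] li[OF 1] by simp
    next
      case 2 then show ?thesis using px xz by (simp add: lz)
    next
      case 3 then show ?thesis using B(3)[OF 3 pc] lo[OF 3(1)] by simp
    qed
    then show "l c < c" "p (l c - 1) \<noteq> l c" "p (l c - 1) \<le> c" by blast+
  next
    fix c assume c: "x < c" "c \<le> y" and pc: "p (c - 1) \<noteq> c"
    have "c \<noteq> z" using pc pz by auto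
    then consider "c = x + 1" | "x + 1 < c" "c \<le> z - 1" | "z < c" "c \<le> y" using split[OF c] by blast
    then have "l c = c \<and> (\<exists>d. c < d \<and> d \<le> y \<and> l d = c)"
    proof cases
      case 1 then show ?thesis using xz lx lz by blast
    next
      case 2
      obtain d where d: "c < d" "d \<le> z - 1" "l1 d = c" using A(5)[OF 2 pc] by blast
      then have "l d = c" using li[of d] 2 by simp
      then show ?thesis using A(4)[OF 2 pc] li[OF 2] d xz by (intro conjI exI[of _ d]) auto
    next
      case 3
      obtain d where d: "c < d" "d \<le> y" "l2 d = c" using B(5)[OF 3 pc] by blast
      then have "l d = c" using lo[of d] 3 by simp
      then show ?thesis using B(4)[OF 3 pc] lo[OF 3(1)] d by (intro conjI exI[of _ d]) auto
    qed
    then show "l c = c" "\<exists>d. c < d \<and> d \<le> y \<and> l d = c" by blast+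
  next
    fix a b assume ab: "x < a" "a < b" "b \<le> y" "l b \<le> a"
    have "x < b" using ab by simp
    from split[OF this ab(3)] consider "b = x + 1" | "x + 1 < b" "b \<le> z - 1" | "b = z" | "z < b"
      by blast
    then show "l b \<le> l a"
    proof cases
      case 1 then show ?thesis using ab by simp
    next
      case 2
      then have "x + 1 < a" using A(1)[OF 2] li[OF 2] ab by simp
      then show ?thesis using A(6)[of a b] li[OF 2] li[of a] 2 ab by simp
    next
      case 3
      have "a = x + 1 \<or> (x + 1 < a \<and> a \<le> z - 1)" using ab 3 by linarith
      then show ?thesis using A(1)[of a] li[of a] 3 by (auto simp: lx lz)
    next
      case 4
      then have "z < a" using B(1)[OF 4 ab(3)] lo[OF 4] ab by simp
      then show ?thesis using B(6)[of a b] lo[of a] lo[OF 4] ab by simp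
    qed
  next
    fix c d assume c: "x < c" "c \<le> y" and d: "x < d" "d \<le> y" and lc: "l c < c" "l d < d" "l c = l d"
    have "c \<noteq> x + 1" "d \<noteq> x + 1" using lc lx by auto
    then have cc: "(x + 1 < c \<and> c \<le> z - 1) \<or> c = z \<or> (z < c \<and> c \<le> y)"
      and dd: "(x + 1 < d \<and> d \<le> z - 1) \<or> d = z \<or> (z < d \<and> d \<le> y)"
        using split[OF c] split[OF d] by blast+
    have val: "x + 1 < e \<and> e \<le> z - 1 \<Longrightarrow> x + 1 < l e \<and> l e \<le> z - 1"
      "z < e \<and> e \<le> y \<Longrightarrow> z < l e" for e
      using A(1,2)[of e] li[of e] B(1)[of e] lo[of e] by auto
    from cc show "c = d"
    proof (elim disjE)
      assume 1: "x + 1 < c \<and> c \<le> z - 1"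
      then have "x + 1 < d \<and> d \<le> z - 1" using val[of c] val[of d] dd lc(3) lz by auto
      then show ?thesis using A(7)[of c d] 1 lc li by simp
    next
      assume 1: "c = z"
      then show ?thesis using val[of d] dd lc(3) lz xz by auto
    next
      assume 1: "z < c \<and> c \<le> y"
      then have "z < d \<and> d \<le> y" using val[of c] val[of d] dd lc(3) lz xz by auto
      then show ?thesis using B(7)[of c d] 1 lc lo by simp
    qed
  qed
  then show ?thesis by blast
qed

lemma dyck_window_imp_window_matching:
  "dyck_window p x k \<Longrightarrow> \<exists>l. window_matching p x (x + 2 * int k) l"
proof (induction rule: dyck_window.induct)
  case (dyck_window_0 x)
  then show ?case by (intro exI[of _ id]) (simp add: window_matching_def)
next
  case (dyck_window_step x j m)
  define z where "z = x + 2 * int j + 2"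
  have e: "x + 1 + 2 * int j = z - 1" "x + 2 * int j + 1 = z - 1" "x + 2 * int j + 2 = z"
    "x + 2 * int (j + m + 1) = z + 2 * int m" by (simp_all add: z_def)
  obtain l1 l2 where "window_matching p (x + 1) (z - 1) l1" "window_matching p z (z + 2 * int m) l2"
    using dyck_window_step.IH unfolding e by blast
  then show ?case unfolding e
  proof (rule window_matching_step)
    show "p x \<noteq> x + 1" "p x \<le> z" "p (z - 1) = z"
      using dyck_window_step.hyps unfolding e by (auto simp: landings_def)
  qed (simp_all add: z_def)
qed

text \<open>The matching of one window is repeated periodically. An arc stays in its copy of the
  window, so nesting and injectivity reduce to a single copy.\<close>

lemma dyck_window_imp_matching:
  assumes n: "n = 2 * k" "k \<ge> 1" and p: "equivariant n p" and g: "dyck_window p x k"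
  shows "\<exists>l. dyck_matching n p l"
proof -
  have n1: "n \<ge> 1" and n0: "int n > 0" using n by simp_all
  obtain f where f: "window_matching p x (x + int n) f"
    using dyck_window_imp_window_matching[OF g] n by auto
  note F = window_matchingD[OF f]
  \<comment> \<open>\<open>q c\<close> is the index of the copy containing \<open>c\<close>; the
    \<open>- 1\<close> is there because the labels of the window are \<open>x + 1\<close> to
    \<open>x + n\<close>.\<close>
  define q where "q = (\<lambda>c. (c - x - 1) div int n)"
  define l where "l = (\<lambda>c. f (c - q c * int n) + q c * int n)"
  have q_shift: "q (c + m * int n) = q c + m" for c m
  proof -
    have eq: "(c + m * int n - x - 1) = (c - x - 1) + m * int n" by simp
    have "((c - x - 1) + m * int n) div int n = m + (c - x - 1) div int n"
      using n0 by (intro div_mult_self1) simp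
    then show ?thesis unfolding q_def eq by simp
  qed
  have q0: "q c = 0" if "x < c" "c \<le> x + int n" for c
    unfolding q_def using that by (intro div_pos_pos_trivial) auto
  have l_shift: "l (c + m * int n) = l c + m * int n" for c m
    by (simp add: l_def q_shift algebra_simps)
  have lf: "l c = f c" if "x < c" "c \<le> x + int n" for c by (simp add: l_def q0[OF that])
  have rep: "\<exists>d m. c = d + m * int n \<and> x < d \<and> d \<le> x + int n" for c
  proof -
    have "c - x - (c - x - 1) div int n * int n \<in> {1..int n}" by (rule residue_window[OF n1])
    then show ?thesis by (intro exI[of _ "c - q c * int n"] exI[of _ "q c"]) (auto simp: q_def)
  qed
  have p_shift: "p (c + m * int n - 1) = p (c - 1) + m * int n" for c m
    using equivariantD[OF p, of "c - 1" m] by (simp add: algebra_simps)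
  have win: "c + m * int n > x + m' * int n \<and> c + m * int n \<le> x + int n + m' * int n \<Longrightarrow> m = m'"
    if "x < c" "c \<le> x + int n" for c m m'
  proof -
    assume *: "c + m * int n > x + m' * int n \<and> c + m * int n \<le> x + int n + m' * int n"
    have "q (c + m * int n) = m" using q_shift q0[OF that] by simp
    moreover have "q (c + m * int n) = m'"
      using q_shift[of "c + m * int n - m' * int n" m'] q0[of "c + m * int n - m' * int n"] *
        by simp
    ultimately show "m = m'" by simp
  qed
  have pb: "postorder_bracketing n l" unfolding postorder_bracketing_def
  proof (intro conjI allI impI)
    show "equivariant n l" using l_shift[of _ 1] by (simp add: equivariant_def)
    show "l b \<le> b" for b
    proof -
      obtain c m where c: "b = c + m * int n" "x < c" "c \<le> x + int n" using rep by blast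
      then show ?thesis using F(2)[OF c(2,3)] by (simp add: l_shift lf)
    qed
    fix a b assume ab: "l b \<le> a" "a < b"
    obtain d m where d: "b = d + m * int n" "x < d" "d \<le> x + int n" using rep by blast
    obtain c m' where c: "a = c + m' * int n" "x < c" "c \<le> x + int n" using rep by blast
    have "f d + m * int n \<le> a" using ab d by (simp add: l_shift lf)
    then have "c + m' * int n > x + m * int n \<and> c + m' * int n \<le> x + int n + m * int n"
      using F(1)[OF d(2,3)] ab d c(1) by simp
    then have m: "m' = m" using win[OF c(2,3)] by blast
    have "f d \<le> f c" using ab d c F(6)[of c d] unfolding m by (simp add: l_shift lf)
    then show "l b \<le> l a" using d c m by (simp add: l_shift lf)
  qed
  have dn: "l c < c \<and> p (l c - 1) \<noteq> l c \<and> p (l c - 1) \<le> c" if pc: "p (c - 1) = c" for c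
  proof -
    obtain d m where d: "c = d + m * int n" "x < d" "d \<le> x + int n" using rep by blast
    have "p (d - 1) = d" using pc d(1) p_shift[of d m] by simp
    from F(3)[OF d(2,3) this] show ?thesis unfolding d(1) l_shift p_shift lf[OF d(2,3)] by simp
  qed
  have up: "l c = c \<and> (\<exists>d>c. l d = c)" if pc: "p (c - 1) \<noteq> c" for c
  proof -
    obtain d m where d: "c = d + m * int n" "x < d" "d \<le> x + int n" using rep by blast
    have pd: "p (d - 1) \<noteq> d" using pc d(1) p_shift[of d m] by simp
    obtain e where e: "d < e" "e \<le> x + int n" "f e = d" using F(5)[OF d(2,3) pd] by blast
    have "l (e + m * int n) = c" using e d by (simp add: l_shift lf)
    then show ?thesis using F(4)[OF d(2,3) pd] e d(1) lf[OF d(2,3)]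
      by (intro conjI exI[of _ "e + m * int n"]) (simp_all add: l_shift)
  qed
  have inj: "c = d" if lt: "l c < c" "l d < d" "l c = l d" for c d
  proof -
    obtain a m where a: "c = a + m * int n" "x < a" "a \<le> x + int n" using rep by blast
    obtain b m' where b: "d = b + m' * int n" "x < b" "b \<le> x + int n" using rep by blast
    have eq: "f a + m * int n = f b + m' * int n" using lt(3) a b by (simp add: l_shift lf)
    have fa: "x < f a" "f a \<le> x + int n" "x < f b" "f b \<le> x + int n"
      using F(1,2)[OF a(2,3)] F(1,2)[OF b(2,3)] a b by simp_all
    have "f a + m * int n > x + m' * int n \<and> f a + m * int n \<le> x + int n + m' * int n"
      unfolding eq using fa by simp
    then have m: "m = m'" using win[OF fa(1,2)] by blast
    have "f a < a" "f b < b" "f a = f b" using lt a b m by (simp_all add: l_shift lf)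
    then show ?thesis using F(7)[OF a(2,3) b(2,3)] a(1) b(1) m by simp
  qed
  have "dyck_matching n p l" unfolding dyck_matching_def
  proof (intro conjI allI impI)
    show "postorder_bracketing n l" by (rule pb)
    show "l c < c" "p (l c - 1) \<noteq> l c" "p (l c - 1) \<le> c" if "p (c - 1) = c" for c
      using dn[OF that] by blast+
    show "l c = c" "\<exists>d>c. l d = c" if "p (c - 1) \<noteq> c" for c
      using up[OF that] by blast+
    show "c = d" if "l c < c" "l d < d" "l c = l d" for c d by (rule inj[OF that])
  qed
  then show ?thesis by blast
qed

lemma uniquely_sorted_iff_dyck_window:
  assumes k: "k \<ge> 1" and w: "w \<in> affine_perms (2 * k)"
  shows "uniquely_sorted (2 * k) w \<longleftrightarrow> (\<exists>x. dyck_window (next_greater w) x k)"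
proof -
  define n where "n = 2 * k"
  have n: "n \<ge> 2" "n \<ge> 1" using k by (auto simp: n_def)
  have W: "inj w" "equivariant n w" using w by (auto simp: affine_perms_iff bij_is_inj n_def)
  have wn: "w \<in> affine_perms n" using w by (simp add: n_def)
  have p: "bracketing n (next_greater w)" by (rule bracketing_next_greater[OF n(2) W])
  have "(\<exists>!l. postorder_bracketing n l \<and> compatible w l) \<longleftrightarrow> (\<exists>x. dyck_window (next_greater w) x k)"
  proof
    assume "\<exists>!l. postorder_bracketing n l \<and> compatible w l"
    then obtain l where "postorder_bracketing n l" "compatible w l"
      "\<And>m. postorder_bracketing n m \<Longrightarrow> compatible w m \<Longrightarrow> m = l" by blast
    then have "dyck_matching n (next_greater w) l" by (rule unique_imp_dyck_matching[OF n(1) W])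
    then show "\<exists>x. dyck_window (next_greater w) x k"
      using dyck_window_exists[OF k] p unfolding n_def by blast
  next
    assume "\<exists>x. dyck_window (next_greater w) x k"
    then obtain x where "dyck_window (next_greater w) x k" ..
    moreover have "equivariant n (next_greater w)" using p by (simp add: bracketing_def)
    ultimately obtain l where l: "dyck_matching n (next_greater w) l"
      using dyck_window_imp_matching[OF n_def k] by blast
    show "\<exists>!l. postorder_bracketing n l \<and> compatible w l"
    proof (rule ex1I)
      show "postorder_bracketing n l \<and> compatible w l"
        using dyck_matching_imp_compatible[OF n(2) W l] dyck_matchingD(1)[OF l] by blast
      fix m assume "postorder_bracketing n m \<and> compatible w m"
      then show "m = l" using dyck_matching_unique[OF n(2) W l] by blast
    qed
  qed
  then show ?thesis using uniquely_sorted_iff_unique_compatible[OF n(1) wn] by (simp add: n_def)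
qed

section \<open>Counting finite patterns\<close>

text \<open>The first-return arch of a Dyck path, of length \<open>2 j + 2\<close>.\<close>

definition dyck_prime :: "(int \<Rightarrow> int) \<Rightarrow> int \<Rightarrow> nat \<Rightarrow> bool" where
  "dyck_prime p x j \<longleftrightarrow> dyck_window p (x + 1) j \<and> p (x + 2 * int j + 1) = x + 2 * int j + 2 \<and>
     p x \<in> landings p (x + 1) (x + 2 * int j + 2)"

lemma dyck_window_Suc_iff:
  "dyck_window p x (Suc k) \<longleftrightarrow>
     (\<exists>j\<le>k. dyck_prime p x j \<and> dyck_window p (x + 2 * int j + 2) (k - j))"
proof
  assume "dyck_window p x (Suc k)"
  then show "\<exists>j\<le>k. dyck_prime p x j \<and> dyck_window p (x + 2 * int j + 2) (k - j)"
  proof cases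
    case (dyck_window_step j m)
    then show ?thesis by (intro exI[of _ j]) (simp add: dyck_prime_def)
  qed
next
  assume "\<exists>j\<le>k. dyck_prime p x j \<and> dyck_window p (x + 2 * int j + 2) (k - j)"
  then obtain j where j: "j \<le> k" "dyck_prime p x j" "dyck_window p (x + 2 * int j + 2) (k - j)"
    by blast
  then have "dyck_window p x (j + (k - j) + 1)"
    unfolding dyck_prime_def by (intro dyck_window_step) auto
  then show "dyck_window p x (Suc k)" using j(1) by simp
qed

lemma dyck_window_prime_induct [consumes 1, case_names empty step]:
  assumes "dyck_window p x k"
    and "\<And>x. P x 0"
    and "\<And>x j m. dyck_prime p x j \<Longrightarrow> P (x + 1) j \<Longrightarrow> dyck_window p (x + 2 * int j + 2) m \<Longrightarrow>
      P (x + 2 * int j + 2) m \<Longrightarrow> P x (j + m + 1)"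
  shows "P x k"
  using assms(1)
proof induction
  case (dyck_window_step x j m)
  then show ?case by (intro assms(3)) (simp_all add: dyck_prime_def)
qed (rule assms(2))

lemma dyck_prime_first:
  assumes "dyck_prime p x j"
  shows "x + 1 < p x" "p x \<le> x + 2 * int j + 2" "x + 1 \<le> i \<Longrightarrow> i < p x \<Longrightarrow> p i \<le> p x"
  using assms by (auto simp: dyck_prime_def landings_def)

lemma dyck_window_range:
  assumes "dyck_window p x k" "x \<le> i" "i < x + 2 * int k"
  shows "i < p i \<and> p i \<le> x + 2 * int k"
  using assms
proof (induction arbitrary: i rule: dyck_window_prime_induct)
  case (step x j m)
  have last: "p (x + 2 * int j + 1) = x + 2 * int j + 2"
    using step.hyps(1) by (simp add: dyck_prime_def)
  consider "i = x" | "x + 1 \<le> i" "i < x + 1 + 2 * int j" | "i = x + 2 * int j + 1" | "x + 2 * int j + 2 \<le> i"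
    using step.prems(1) by linarith
  then show ?case
  proof cases
    case 1
    then show ?thesis using dyck_prime_first[OF step.hyps(1)] by simp
  next
    case 2
    then show ?thesis using step.IH(1)[of i] by simp
  next
    case 3
    then show ?thesis using last by simp
  next
    case 4
    then show ?thesis using step.IH(2)[of i] step.prems by simp
  qed
qed simp

lemma dyck_window_noncrossing:
  assumes "dyck_window p x k" "x \<le> i" "i < j" "j < p i" "j < x + 2 * int k"
  shows "p j \<le> p i"
  using assms
proof (induction arbitrary: i j rule: dyck_window_prime_induct)
  case (step x l m)
  have last: "p (x + 2 * int l + 1) = x + 2 * int l + 2"
    using step.hyps(1) by (simp add: dyck_prime_def)
  consider "i = x" | "x + 1 \<le> i" "i < x + 1 + 2 * int l" | "i = x + 2 * int l + 1" | "x + 2 * int l + 2 \<le> i"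
    using step.prems(1) by linarith
  then show ?case
  proof cases
    case 1
    then show ?thesis using dyck_prime_first(3)[OF step.hyps(1), of j] step.prems by simp
  next
    case 2
    have "dyck_window p (x + 1) l" using step.hyps(1) by (simp add: dyck_prime_def)
    then have "p i \<le> x + 1 + 2 * int l" using dyck_window_range 2 by blast
    then show ?thesis using step.IH(1)[of i j] 2 step.prems by simp
  next
    case 3
    then show ?thesis using last step.prems by simp
  next
    case 4
    then show ?thesis using step.IH(2)[of i j] step.prems by simp
  qed
qed simp

lemma landings_cong:
  assumes "\<And>i. x \<le> i \<Longrightarrow> i < y \<Longrightarrow> p i = q i"
  shows "landings p x y = landings q x y"
  using assms unfolding landings_def by (intro Collect_cong) auto

lemma dyck_window_cong:
  assumes "dyck_window p x k" "\<And>i. x \<le> i \<Longrightarrow> i < x + 2 * int k \<Longrightarrow> q i = p i"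
  shows "dyck_window q x k"
  using assms
proof (induction)
  case (dyck_window_step x j m)
  have "landings q (x + 1) (x + 2 * int j + 2) = landings p (x + 1) (x + 2 * int j + 2)"
    by (rule landings_cong) (use dyck_window_step.prems in auto)
  then show ?case
    using dyck_window_step by (intro dyck_window.dyck_window_step) auto
qed (rule dyck_window.dyck_window_0)

lemma dyck_prime_cong:
  assumes "dyck_prime p x j" "\<And>i. x \<le> i \<Longrightarrow> i < x + 2 * int j + 2 \<Longrightarrow> q i = p i"
  shows "dyck_prime q x j"
proof -
  have "landings q (x + 1) (x + 2 * int j + 2) = landings p (x + 1) (x + 2 * int j + 2)"
    by (rule landings_cong) (use assms in auto)
  moreover have "dyck_window q (x + 1) j"
    by (rule dyck_window_cong[of p]) (use assms in \<open>auto simp: dyck_prime_def\<close>)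
  ultimately show ?thesis using assms by (simp add: dyck_prime_def)
qed

lemma landings_translate:
  "landings (\<lambda>i. p (i - c) + c) (x + c) (y + c) = (\<lambda>j. j + c) ` landings p x y"
proof (intro equalityI subsetI)
  fix j assume j: "j \<in> landings (\<lambda>i. p (i - c) + c) (x + c) (y + c)"
  have "j - c \<in> landings p x y" unfolding landings_def
  proof (intro CollectI conjI allI impI)
    show "x < j - c" "j - c \<le> y" using j by (auto simp: landings_def)
    fix i assume "x \<le> i \<and> i < j - c"
    moreover have "x + c \<le> i + c \<and> i + c < j \<longrightarrow> p (i + c - c) + c \<le> j"
      using j unfolding landings_def by blast
    ultimately show "p i \<le> j - c" by simp
  qed
  then show "j \<in> (\<lambda>j. j + c) ` landings p x y" by (intro image_eqI[of _ _ "j - c"]) auto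
next
  fix j assume "j \<in> (\<lambda>j. j + c) ` landings p x y"
  then show "j \<in> landings (\<lambda>i. p (i - c) + c) (x + c) (y + c)" by (auto simp: landings_def)
qed

lemma dyck_window_translate:
  assumes "dyck_window p x k"
  shows "dyck_window (\<lambda>i. p (i - c) + c) (x + c) k"
  using assms
proof (induction)
  case (dyck_window_step x j m)
  have e: "x + c + 1 = x + 1 + c" "x + c + 2 * int j + 2 = x + 2 * int j + 2 + c" by simp_all
  show ?case
  proof (rule dyck_window.dyck_window_step)
    show "dyck_window (\<lambda>i. p (i - c) + c) (x + c + 1) j" unfolding e by (rule dyck_window_step.IH)
    show "p (x + c + 2 * int j + 1 - c) + c = x + c + 2 * int j + 2"
      using dyck_window_step.hyps(2) by (simp add: algebra_simps)
    show "p (x + c - c) + c \<in> landings (\<lambda>i. p (i - c) + c) (x + c + 1) (x + c + 2 * int j + 2)"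
      unfolding e landings_translate using dyck_window_step.hyps(3) by simp
    show "dyck_window (\<lambda>i. p (i - c) + c) (x + c + 2 * int j + 2) m"
      unfolding e by (rule dyck_window_step.IH)
  qed
qed (rule dyck_window.dyck_window_0)

lemma dyck_window_append:
  assumes "dyck_window p x a" "dyck_window p (x + 2 * int a) b"
  shows "dyck_window p x (a + b)"
  using assms
proof (induction)
  case (dyck_window_step x j m)
  have e: "x + 2 * int (j + m + 1) = x + 2 * int j + 2 + 2 * int m" by simp
  have "dyck_window p (x + 2 * int j + 2) (m + b)"
    using dyck_window_step.IH(2) dyck_window_step.prems unfolding e .
  then have "dyck_window p x (j + (m + b) + 1)"
    using dyck_window_step.hyps by (intro dyck_window.dyck_window_step)
  then show ?case by (simp add: add_ac)
qed simp

section \<open>Heights and unique decomposition\<close>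

text \<open>The level of the up-down path relative to its start; it detects where arches end and
  where a period can be cut.\<close>

definition height :: "(int \<Rightarrow> int) \<Rightarrow> int \<Rightarrow> int \<Rightarrow> int" where
  "height p x y = (\<Sum>i=x..<y. if p i = i + 1 then - 1 else 1)"

lemma height_split:
  assumes "x \<le> y" "y \<le> z"
  shows "height p x z = height p x y + height p y z"
proof -
  have "{x..<z} = {x..<y} \<union> {y..<z}" "{x..<y} \<inter> {y..<z} = {}" using assms by auto
  then show ?thesis unfolding height_def by (simp add: sum.union_disjoint)
qed

lemma height_refl [simp]: "height p x x = 0"
  by (simp add: height_def)

lemma height_step: "height p x (x + 1) = (if p x = x + 1 then - 1 else 1)"
proof -
  have "{x..<x + 1} = {x}" by auto
  then show ?thesis by (simp add: height_def)
qed

lemma dyck_window_height: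
  assumes "dyck_window p x k"
  shows "height p x (x + 2 * int k) = 0 \<and> (\<forall>y. x \<le> y \<and> y \<le> x + 2 * int k \<longrightarrow> 0 \<le> height p x y)"
  using assms
proof (induction rule: dyck_window_prime_induct)
  case (step x j m)
  define z where "z = x + 2 * int j + 2"
  have e: "x + 1 + 2 * int j = z - 1" "x + 2 * int j + 1 = z - 1" "x + 2 * int j + 2 = z"
    "x + 2 * int (j + m + 1) = z + 2 * int m"
    by (simp_all add: z_def)
  have xz: "x + 1 \<le> z - 1" by (simp add: z_def)
  have pz: "p (z - 1) = z" using step.hyps(1) unfolding dyck_prime_def e by simp
  have up: "height p x (x + 1) = 1"
    using dyck_prime_first(1)[OF step.hyps(1)] by (simp add: height_step)
  have dn: "height p (z - 1) z = - 1" using height_step[of p "z - 1"] pz by simp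
  have inner: "height p x y = 1 + height p (x + 1) y" if "x + 1 \<le> y" for y
    using that height_split[of x "x + 1" y p] up by simp
  have hz: "height p x z = 0"
    using inner[of "z - 1"] height_split[of x "z - 1" z p] dn xz step.IH(1) unfolding e by simp
  have outer: "height p x y = height p z y" if "z \<le> y" for y
    using that height_split[of x z y p] hz xz by simp
  have "0 \<le> height p x y" if y: "x \<le> y" "y \<le> z + 2 * int m" for y
  proof -
    consider "y = x" | "x + 1 \<le> y" "y \<le> z - 1" | "z \<le> y" using y by linarith
    then show ?thesis
      using inner[of y] outer[of y] step.IH y unfolding e by cases auto
  qed
  then show ?case using outer[of "z + 2 * int m"] step.IH(2) unfolding e by simp
next
  case (empty x)
  show ?case
  proof (intro conjI allI impI)
    show "height p x (x + 2 * int 0) = 0" by simp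
    fix y assume "x \<le> y \<and> y \<le> x + 2 * int 0"
    then have "y = x" by simp
    then show "0 \<le> height p x y" by simp
  qed
qed

lemma dyck_prime_height:
  assumes "dyck_prime p x j"
  shows "height p x (x + 2 * int j + 2) = 0" "x < y \<Longrightarrow> y < x + 2 * int j + 2 \<Longrightarrow> 0 < height p x y"
proof -
  have w: "dyck_window p (x + 1) j" and l: "p (x + 2 * int j + 1) = x + 2 * int j + 2"
    using assms by (auto simp: dyck_prime_def)
  have up: "height p x (x + 1) = 1" using dyck_prime_first(1)[OF assms] by (simp add: height_step)
  { assume y: "x < y" "y < x + 2 * int j + 2"
    have "0 \<le> height p (x + 1) y" using dyck_window_height[OF w] y by simp
    then show "0 < height p x y" using height_split[of x "x + 1" y p] up y by simp }
  have "dyck_window p x (Suc j)" unfolding dyck_window_Suc_iff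
    using assms by (intro exI[of _ j]) (simp add: dyck_window_0)
  then show "height p x (x + 2 * int j + 2) = 0"
    using dyck_window_height[of p x "Suc j"] by (simp add: algebra_simps)
qed

text \<open>The end of an arch is the first return of the height to 0.\<close>

lemma dyck_prime_unique:
  assumes "dyck_prime p x i" "dyck_prime p x j"
  shows "i = j"
proof (rule ccontr)
  assume "i \<noteq> j"
  then consider "i < j" | "j < i" by linarith
  then show False
    using dyck_prime_height(1)[OF assms(1)] dyck_prime_height(2)[OF assms(2), of "x + 2 * int i + 2"]
      dyck_prime_height(1)[OF assms(2)] dyck_prime_height(2)[OF assms(1), of "x + 2 * int j + 2"]
    by cases simp_all
qed

section \<open>Finite patterns counted by landings\<close>

text \<open>The value \<open>i + 1\<close> outside the window is a default that makes equality of
  functions the same as equality of patterns.\<close>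

definition dyck_bracketings :: "int \<Rightarrow> nat \<Rightarrow> (int \<Rightarrow> int) set" where
  "dyck_bracketings x k = {p. dyck_window p x k \<and> (\<forall>i. i < x \<or> x + 2 * int k \<le> i \<longrightarrow> p i = i + 1)}"

definition prime_bracketings :: "int \<Rightarrow> nat \<Rightarrow> (int \<Rightarrow> int) set" where
  "prime_bracketings x j = {p. dyck_prime p x j \<and> (\<forall>i. i < x \<or> x + 2 * int j + 2 \<le> i \<longrightarrow> p i = i + 1)}"

definition split_bracketings :: "int \<Rightarrow> nat \<Rightarrow> nat \<Rightarrow> (int \<Rightarrow> int) set" where
  "split_bracketings x j m = {p. dyck_prime p x j \<and> dyck_window p (x + 2 * int j + 2) m \<and>
     (\<forall>i. i < x \<or> x + 2 * int j + 2 + 2 * int m \<le> i \<longrightarrow> p i = i + 1)}"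

lemma finite_dyck_bracketings: "finite (dyck_bracketings x k)"
proof -
  let ?I = "{x..<x + 2 * int k}"
  have "inj_on (\<lambda>p. restrict p ?I) (dyck_bracketings x k)"
  proof (rule inj_onI, rule ext)
    fix p q i
    assume p: "p \<in> dyck_bracketings x k" and q: "q \<in> dyck_bracketings x k" and eq: "restrict p ?I = restrict q ?I"
    show "p i = q i"
    proof (cases "i \<in> ?I")
      case True then show ?thesis using fun_cong[OF eq, of i] by simp
    next
      case False then show ?thesis using p q by (auto simp: dyck_bracketings_def)
    qed
  qed
  moreover have "(\<lambda>p. restrict p ?I) ` dyck_bracketings x k \<subseteq> PiE ?I (\<lambda>_. {x..x + 2 * int k})"
  proof (rule image_subsetI)
    fix p assume "p \<in> dyck_bracketings x k"
    then have "dyck_window p x k" by (simp add: dyck_bracketings_def)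
    then show "restrict p ?I \<in> PiE ?I (\<lambda>_. {x..x + 2 * int k})"
      using dyck_window_range by fastforce
  qed
  then have "finite ((\<lambda>p. restrict p ?I) ` dyck_bracketings x k)"
    by (rule finite_subset) (simp add: finite_PiE)
  ultimately show ?thesis by (metis finite_imageD)
qed

text \<open>\<open>u\<close> is the catalytic variable: it records how many ends are open to a new
  up step placed in front of the window.\<close>

definition landing_poly :: "int \<Rightarrow> nat \<Rightarrow> real \<Rightarrow> real" where
  "landing_poly x k u = (\<Sum>p\<in>dyck_bracketings x k. u ^ card (landings p x (x + 2 * int k)))"

definition prime_landing_poly :: "int \<Rightarrow> nat \<Rightarrow> real \<Rightarrow> real" where
  "prime_landing_poly x j u = (\<Sum>p\<in>prime_bracketings x j. u ^ card (landings p x (x + 2 * int j + 2)))"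

lemma dyck_bracketings_Suc:
  "dyck_bracketings x (Suc k) = (\<Union>j\<le>k. split_bracketings x j (k - j))"
proof -
  have e: "x + 2 * int j + 2 + 2 * int (k - j) = x + 2 * int (Suc k)" if "j \<le> k" for j
    using that by (simp add: of_nat_diff)
  show ?thesis
    unfolding dyck_bracketings_def split_bracketings_def dyck_window_Suc_iff using e by auto
qed

lemma split_bracketings_disjoint:
  "i \<noteq> j \<Longrightarrow> split_bracketings x i m \<inter> split_bracketings x j l = {}"
  using dyck_prime_unique by (auto simp: split_bracketings_def)

lemma split_bracketings_subset:
  "split_bracketings x j m \<subseteq> dyck_bracketings x (Suc (j + m))"
proof
  fix p assume "p \<in> split_bracketings x j m"
  then have "p \<in> split_bracketings x j (j + m - j)" by simp
  then show "p \<in> dyck_bracketings x (Suc (j + m))"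
    unfolding dyck_bracketings_Suc by (intro UN_I[of j]) simp_all
qed

lemma landings_finite: "finite (landings p x y)"
  by (rule finite_subset[of _ "{x..y}"]) (auto simp: landings_def)

text \<open>No arc of the first arch reaches beyond \<open>z\<close>, so it neither blocks nor
  creates landings after \<open>z\<close>.\<close>

lemma split_landings_card:
  assumes "dyck_prime p x j" and z: "z = x + 2 * int j + 2" and y: "z \<le> y"
  shows "card (landings p x y) = card (landings p x z) + card (landings p z y)"
proof -
  have "dyck_window p x (Suc j)" unfolding dyck_window_Suc_iff
    using assms(1) by (intro exI[of _ j]) (simp add: dyck_window_0)
  then have le: "p i \<le> z" if "x \<le> i" "i < z" for i
    using dyck_window_range[of p x "Suc j" i] that by (simp add: z)
  have xz: "x < z" by (simp add: z)
  have "landings p x y = landings p x z \<union> landings p z y"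
  proof (intro equalityI subsetI)
    fix t assume t: "t \<in> landings p x y"
    show "t \<in> landings p x z \<union> landings p z y"
      using t xz by (cases "t \<le> z") (auto simp: landings_def)
  next
    fix t assume "t \<in> landings p x z \<union> landings p z y"
    then show "t \<in> landings p x y"
    proof
      assume "t \<in> landings p z y"
      then show ?thesis unfolding landings_def
      proof (intro CollectI conjI allI impI)
        assume t: "t \<in> {t. z < t \<and> t \<le> y \<and> (\<forall>i. z \<le> i \<and> i < t \<longrightarrow> p i \<le> t)}"
        then show "x < t" "t \<le> y" using xz by auto
        fix i assume "x \<le> i \<and> i < t"
        then show "p i \<le> t" using t le[of i] by (cases "i < z") auto
      qed
    qed (use y in \<open>auto simp: landings_def\<close>)
  qed
  moreover have "landings p x z \<inter> landings p z y = {}" by (auto simp: landings_def)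
  ultimately show ?thesis by (simp add: card_Un_disjoint landings_finite)
qed

lemma sum_split_bracketings:
  "(\<Sum>p\<in>split_bracketings x j m. u ^ card (landings p x (x + 2 * int j + 2 + 2 * int m))) =
     prime_landing_poly x j u * landing_poly (x + 2 * int j + 2) m u"
proof -
  define z where "z = x + 2 * int j + 2"
  define y where "y = z + 2 * int m"
  have xz: "x < z" "z \<le> y" by (simp_all add: z_def y_def)
  define f where "f = (\<lambda>p :: int \<Rightarrow> int. (\<lambda>i. if i < z then p i else i + 1, \<lambda>i. if i < z then i + 1 else p i))"
  define g where "g = (\<lambda>(p :: int \<Rightarrow> int, q). \<lambda>i. if i < z then p i else q i)"
  have "(\<Sum>p\<in>split_bracketings x j m. u ^ card (landings p x y)) =
    (\<Sum>(p, q)\<in>prime_bracketings x j \<times> dyck_bracketings z m. u ^ card (landings p x z) * u ^ card (landings q z y))"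
  proof (rule sum.reindex_bij_witness[of _ g f])
    fix p assume p: "p \<in> split_bracketings x j m"
    then have p': "dyck_prime p x j" "dyck_window p z m" "\<And>i. i < x \<or> y \<le> i \<Longrightarrow> p i = i + 1"
      by (auto simp: split_bracketings_def z_def y_def)
    show "g (f p) = p" by (auto simp: f_def g_def fun_eq_iff)
    have "dyck_prime (fst (f p)) x j"
      by (rule dyck_prime_cong[OF p'(1)]) (simp add: f_def z_def)
    moreover have "dyck_window (snd (f p)) z m"
      by (rule dyck_window_cong[OF p'(2)]) (simp add: f_def)
    ultimately show "f p \<in> prime_bracketings x j \<times> dyck_bracketings z m"
      using p'(3) xz
        by (auto simp: prime_bracketings_def dyck_bracketings_def f_def z_def[symmetric] y_def[symmetric])
    have "landings (fst (f p)) x z = landings p x z" by (rule landings_cong) (simp add: f_def)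
    moreover have "landings (snd (f p)) z y = landings p z y"
      by (rule landings_cong) (simp add: f_def)
    ultimately show "(case f p of (p, q) \<Rightarrow> u ^ card (landings p x z) * u ^ card (landings q z y)) = u ^ card (landings p x y)"
      using split_landings_card[OF p'(1) z_def xz(2)] by (simp add: case_prod_beta power_add)
  next
    fix r assume "r \<in> prime_bracketings x j \<times> dyck_bracketings z m"
    then obtain p q where r: "r = (p, q)" and p: "dyck_prime p x j" "\<And>i. i < x \<or> z \<le> i \<Longrightarrow> p i = i + 1"
      and q: "dyck_window q z m" "\<And>i. i < z \<or> y \<le> i \<Longrightarrow> q i = i + 1"
      by (auto simp: prime_bracketings_def dyck_bracketings_def z_def y_def)
    show "f (g r) = r" using p(2) q(2) by (auto simp: r f_def g_def fun_eq_iff)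
    have "dyck_prime (g r) x j" by (rule dyck_prime_cong[OF p(1)]) (simp add: g_def r z_def)
    moreover have "dyck_window (g r) z m" by (rule dyck_window_cong[OF q(1)]) (simp add: g_def r)
    ultimately show "g r \<in> split_bracketings x j m"
      using p(2) q(2) xz
        by (auto simp: split_bracketings_def g_def r z_def[symmetric] y_def[symmetric])
  qed
  also have "\<dots> = prime_landing_poly x j u * landing_poly z m u"
    unfolding prime_landing_poly_def landing_poly_def sum_product sum.cartesian_product
    by (simp add: z_def y_def)
  finally show ?thesis by (simp add: z_def y_def)
qed

lemma landing_poly_0: "landing_poly x 0 u = 1"
proof -
  have "dyck_bracketings x 0 = {\<lambda>i. i + 1}"
    by (auto simp: dyck_bracketings_def dyck_window_0 fun_eq_iff linorder_not_less[symmetric])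
  moreover have "landings p x x = {}" for p by (auto simp: landings_def)
  ultimately show ?thesis by (simp add: landing_poly_def)
qed

lemma landing_poly_Suc:
  "landing_poly x (Suc k) u = (\<Sum>j\<le>k. prime_landing_poly x j u * landing_poly (x + 2 * int j + 2) (k - j) u)"
proof -
  have fin: "finite (split_bracketings x j m)" for j m
    using split_bracketings_subset finite_dyck_bracketings by (rule finite_subset)
  have "landing_poly x (Suc k) u =
    (\<Sum>j\<le>k. \<Sum>p\<in>split_bracketings x j (k - j). u ^ card (landings p x (x + 2 * int (Suc k))))"
    unfolding landing_poly_def dyck_bracketings_Suc
    by (rule sum.UNION_disjoint) (use fin split_bracketings_disjoint in auto)
  also have "\<dots> = (\<Sum>j\<le>k. prime_landing_poly x j u * landing_poly (x + 2 * int j + 2) (k - j) u)"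
  proof (intro sum.cong refl)
    fix j assume "j \<in> {..k}"
    then have e: "x + 2 * int (Suc k) = x + 2 * int j + 2 + 2 * int (k - j)"
      by (simp add: of_nat_diff)
    show "(\<Sum>p\<in>split_bracketings x j (k - j). u ^ card (landings p x (x + 2 * int (Suc k)))) =
      prime_landing_poly x j u * landing_poly (x + 2 * int j + 2) (k - j) u"
      unfolding e by (rule sum_split_bracketings)
  qed
  finally show ?thesis .
qed

text \<open>The element that is \<open>i\<close>-th from the top contributes
  \<open>u ^ i\<close>.\<close>

lemma sum_power_card_above:
  fixes K :: "'a :: linorder set"
  assumes "finite K"
  shows "(\<Sum>t\<in>K. u ^ card {s \<in> K. t \<le> s}) = (\<Sum>i=1..card K. (u :: real) ^ i)"
  using assms
proof (induction rule: finite_linorder_min_induct)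
  case (insert b A)
  have b: "b \<notin> A" using insert by auto
  have "{s \<in> insert b A. b \<le> s} = insert b A" using insert by auto
  moreover have "(\<Sum>t\<in>A. u ^ card {s \<in> insert b A. t \<le> s}) = (\<Sum>t\<in>A. u ^ card {s \<in> A. t \<le> s})"
  proof (intro sum.cong refl)
    fix t assume "t \<in> A"
    then have "{s \<in> insert b A. t \<le> s} = {s \<in> A. t \<le> s}" using insert by auto
    then show "u ^ card {s \<in> insert b A. t \<le> s} = u ^ card {s \<in> A. t \<le> s}" by simp
  qed
  ultimately show ?case using insert b by simp
qed simp

text \<open>An arch is an inner window \<open>q\<close> together with a landing \<open>t\<close>
  chosen as the end of its first arc, and exactly the landings from \<open>t\<close> on survive. The
  \<open>+ 1\<close> is the end of the closing down step, which is always a landing.\<close>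

lemma prime_landing_poly_eq:
  "prime_landing_poly x j u =
    (\<Sum>q\<in>dyck_bracketings (x + 1) j. \<Sum>i=1..card (landings q (x + 1) (x + 1 + 2 * int j)) + 1. u ^ i)"
proof -
  define z where "z = x + 2 * int j + 2"
  have xz: "x + 1 \<le> z - 1" by (simp add: z_def)
  have e: "x + 1 + 2 * int j = z - 1" "x + 2 * int j + 1 = z - 1" "x + 2 * int j + 2 = z"
    by (simp_all add: z_def)
  let ?S = "dyck_bracketings (x + 1) j"
  define f where "f = (\<lambda>p :: int \<Rightarrow> int. (p(x := x + 1), p x))"
  define g where "g = (\<lambda>(q :: int \<Rightarrow> int, t). q(x := t))"
  have S: "q \<in> ?S \<longleftrightarrow> dyck_window q (x + 1) j \<and> (\<forall>i. i < x + 1 \<or> z - 1 \<le> i \<longrightarrow> q i = i + 1)" for q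
    by (simp add: dyck_bracketings_def e)
  have R: "p \<in> prime_bracketings x j \<longleftrightarrow> dyck_window p (x + 1) j \<and> p (z - 1) = z \<and>
    p x \<in> landings p (x + 1) z \<and> (\<forall>i. i < x \<or> z \<le> i \<longrightarrow> p i = i + 1)" for p
    by (auto simp: prime_bracketings_def dyck_prime_def e)
  have upd: "landings (q(x := t)) (x + 1) y = landings q (x + 1) y" for q t y
    by (rule landings_cong) simp
  have updw: "dyck_window (q(x := t)) (x + 1) j \<longleftrightarrow> dyck_window q (x + 1) j" for q t
  proof
    show "dyck_window (q(x := t)) (x + 1) j \<Longrightarrow> dyck_window q (x + 1) j"
      by (erule dyck_window_cong) simp
    show "dyck_window q (x + 1) j \<Longrightarrow> dyck_window (q(x := t)) (x + 1) j"
      by (erule dyck_window_cong) simp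
  qed
  have "prime_landing_poly x j u = (\<Sum>p\<in>prime_bracketings x j. u ^ card (landings p x z))"
    by (simp add: prime_landing_poly_def e)
  also have "\<dots> = (\<Sum>(q, t)\<in>Sigma ?S (\<lambda>q. landings q (x + 1) z). u ^ card {s \<in> landings q (x + 1) z. t \<le> s})"
  proof (rule sum.reindex_bij_witness[of _ g f])
    fix p assume p: "p \<in> prime_bracketings x j"
    show "g (f p) = p" by (simp add: f_def g_def)
    show "f p \<in> Sigma ?S (\<lambda>q. landings q (x + 1) z)"
    proof -
      have "(p(x := x + 1)) i = i + 1" if "i < x + 1 \<or> z - 1 \<le> i" for i
        using p xz that unfolding R by (cases "i = x"; cases "i = z - 1") auto
      then show ?thesis using p unfolding f_def by (auto simp: S R upd updw)
    qed
    have px: "p x \<in> landings p (x + 1) z" using p by (simp add: R)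
    have "landings p x z = {s \<in> landings p (x + 1) z. p x \<le> s}"
    proof (intro equalityI subsetI)
      fix s assume s: "s \<in> landings p x z"
      then have "p x \<le> s" by (auto simp: landings_def)
      moreover have "x + 1 < p x" using px by (simp add: landings_def)
      ultimately show "s \<in> {s \<in> landings p (x + 1) z. p x \<le> s}" using s by (auto simp: landings_def)
    next
      fix s assume s: "s \<in> {s \<in> landings p (x + 1) z. p x \<le> s}"
      show "s \<in> landings p x z" unfolding landings_def
      proof (intro CollectI conjI allI impI)
        show "x < s" "s \<le> z" using s by (auto simp: landings_def)
        fix i assume "x \<le> i \<and> i < s"
        then show "p i \<le> s" using s by (cases "i = x") (auto simp: landings_def)
      qed
    qed
    then show "(case f p of (q, t) \<Rightarrow> u ^ card {s \<in> landings q (x + 1) z. t \<le> s}) = u ^ card (landings p x z)"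
      by (simp add: f_def upd)
  next
    fix r assume "r \<in> Sigma ?S (\<lambda>q. landings q (x + 1) z)"
    then obtain q t where r: "r = (q, t)" and q: "q \<in> ?S" and t: "t \<in> landings q (x + 1) z" by blast
    have "q x = x + 1" using q by (simp add: S)
    then show "f (g r) = r" by (simp add: r f_def g_def fun_upd_idem)
    show "g r \<in> prime_bracketings x j"
      using q t xz by (simp add: r g_def R S upd updw)
  qed
  also have "\<dots> = (\<Sum>q\<in>?S. \<Sum>t\<in>landings q (x + 1) z. u ^ card {s \<in> landings q (x + 1) z. t \<le> s})"
    by (rule sum.Sigma[symmetric]) (auto simp: finite_dyck_bracketings landings_finite)
  also have "\<dots> = (\<Sum>q\<in>?S. \<Sum>i=1..card (landings q (x + 1) z). u ^ i)"
    by (simp add: sum_power_card_above landings_finite)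
  also have "\<dots> = (\<Sum>q\<in>?S. \<Sum>i=1..card (landings q (x + 1) (z - 1)) + 1. u ^ i)"
  proof (intro sum.cong refl)
    fix q assume q: "q \<in> ?S"
    have "q i \<le> z" if "x + 1 \<le> i" "i < z" for i
    proof (cases "i = z - 1")
      case True then show ?thesis using q by (simp add: S)
    next
      case False
      then show ?thesis using dyck_window_range[of q "x + 1" j i] q that by (simp add: S e)
    qed
    then have "landings q (x + 1) z = insert z (landings q (x + 1) (z - 1))"
      using xz by (auto simp: landings_def)
    moreover have "z \<notin> landings q (x + 1) (z - 1)" by (simp add: landings_def)
    ultimately have "card (landings q (x + 1) z) = card (landings q (x + 1) (z - 1)) + 1"
      by (simp add: landings_finite)
    then show "{1..card (landings q (x + 1) z)} = {1..card (landings q (x + 1) (z - 1)) + 1}"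
      by simp
  qed
  finally show ?thesis by (simp only: e)
qed

lemma landing_poly_translate: "landing_poly (x + c) k u = landing_poly x k u"
proof -
  define T where "T = (\<lambda>c (p :: int \<Rightarrow> int) i. p (i - c) + c)"
  have T: "T c p \<in> dyck_bracketings (x + c) k" if "p \<in> dyck_bracketings x k" for c p x
    using that dyck_window_translate[of p x k c] by (auto simp: dyck_bracketings_def T_def)
  have TT: "T (- c) (T c p) = p" "T c (T (- c) p) = p" for c p by (auto simp: T_def fun_eq_iff)
  have "landing_poly x k u = (\<Sum>p\<in>dyck_bracketings (x + c) k. u ^ card (landings p (x + c) (x + c + 2 * int k)))"
    unfolding landing_poly_def
  proof (rule sum.reindex_bij_witness[of _ "T (- c)" "T c"])
    fix p assume "p \<in> dyck_bracketings x k"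
    show "T (- c) (T c p) = p" by (rule TT)
    show "T c p \<in> dyck_bracketings (x + c) k" by (rule T) fact
    have e: "x + c + 2 * int k = x + 2 * int k + c" by simp
    have "landings (T c p) (x + c) (x + c + 2 * int k) = (\<lambda>j. j + c) ` landings p x (x + 2 * int k)"
      unfolding T_def e by (rule landings_translate)
    then show "u ^ card (landings (T c p) (x + c) (x + c + 2 * int k)) = u ^ card (landings p x (x + 2 * int k))"
      by (simp add: card_image)
  next
    fix p assume "p \<in> dyck_bracketings (x + c) k"
    then show "T (- c) p \<in> dyck_bracketings x k" using T[of p "x + c" "- c"] by simp
    show "T c (T (- c) p) = p" by (rule TT)
  qed
  then show ?thesis by (simp add: landing_poly_def)
qed

lemma landing_poly_eq_0: "landing_poly x k u = landing_poly 0 k u"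
  using landing_poly_translate[of 0 x] by simp

text \<open>The geometric sum over the remaining landings becomes a divided difference in
  \<open>u\<close>; this brings the value at 1 into the equation.\<close>

lemma prime_landing_poly_geometric:
  assumes "u \<noteq> 1"
  shows "(u - 1) * prime_landing_poly x j u = u * (u * landing_poly 0 j u - landing_poly 0 j 1)"
proof -
  have geo: "(u - 1) * (\<Sum>i=1..m + 1. u ^ i) = u * (u * u ^ m - 1)" for m
    by (induction m) (simp_all add: algebra_simps)
  let ?c = "\<lambda>q. card (landings q (x + 1) (x + 1 + 2 * int j))"
  have "(u - 1) * prime_landing_poly x j u =
    (\<Sum>q\<in>dyck_bracketings (x + 1) j. (u - 1) * (\<Sum>i=1..?c q + 1. u ^ i))"
    unfolding prime_landing_poly_eq by (rule sum_distrib_left)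
  also have "\<dots> = (\<Sum>q\<in>dyck_bracketings (x + 1) j. u * (u * u ^ ?c q - 1))"
    by (simp only: geo)
  also have "\<dots> = u * (u * landing_poly (x + 1) j u - landing_poly (x + 1) j 1)"
    by (simp add: landing_poly_def sum_distrib_left sum_subtractf algebra_simps)
  finally show ?thesis by (simp only: landing_poly_eq_0[of "x + 1"])
qed

text \<open>For \<open>u \<noteq> 1\<close> the geometric formula shows that the start
  \<open>x\<close> is irrelevant; both sides are polynomials in \<open>u\<close>, so this extends to
  1.\<close>

lemma prime_landing_poly_eq_0: "prime_landing_poly x j 1 = prime_landing_poly 0 j 1"
proof -
  have c: "isCont (\<lambda>u. prime_landing_poly x j u) 1" for x
    unfolding prime_landing_poly_def by (intro continuous_intros)
  have "prime_landing_poly x j u = prime_landing_poly 0 j u" if "u \<noteq> 1" for u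
  proof -
    have "(u - 1) * prime_landing_poly x j u = (u - 1) * prime_landing_poly 0 j u"
      unfolding prime_landing_poly_geometric[OF that] ..
    then show ?thesis using that by simp
  qed
  then have ev: "eventually (\<lambda>u. prime_landing_poly x j u = prime_landing_poly 0 j u) (at 1)"
    by (auto simp: eventually_at_filter)
  have "((\<lambda>u. prime_landing_poly x j u) \<longlongrightarrow> prime_landing_poly x j 1) (at 1)"
    using c[of x] by (simp add: isCont_def)
  then have "((\<lambda>u. prime_landing_poly 0 j u) \<longlongrightarrow> prime_landing_poly x j 1) (at 1)"
    using ev by (rule Lim_transform_eventually)
  moreover have "((\<lambda>u. prime_landing_poly 0 j u) \<longlongrightarrow> prime_landing_poly 0 j 1) (at 1)"
    using c[of 0] by (simp add: isCont_def)
  ultimately show ?thesis using tendsto_unique[of "at (1::real)"] by simp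
qed

section \<open>The catalytic equation\<close>

text \<open>For \<open>U = 1 / (1 - t)\<close> the equation \<open>U = 1 + x U^4\<close> reads
  \<open>t (1 - t)^3 = x\<close>, which compositional inversion of power series solves.\<close>

lemma inverse_cubic_substitution:
  fixes t :: "'a :: comm_ring_1"
  assumes "t * (1 - t) ^ 3 = x" "i * (1 - t) = 1"
  shows "i = 1 + x * i ^ 4"
proof -
  have "x * i ^ 4 = t * i * (i * (1 - t)) ^ 3"
    unfolding assms(1)[symmetric]
      by (simp add: power_mult_distrib power_numeral_odd power_numeral_even mult_ac Let_def)
  also have "\<dots> = i * t" unfolding assms(2) by simp
  also have "\<dots> = i - i * (1 - t)" by (simp add: algebra_simps)
  also have "\<dots> = i - 1" unfolding assms(2) ..
  finally show ?thesis by simp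
qed

lemma inverse_quadratic_substitution:
  fixes t :: "'a :: comm_ring_1"
  assumes "t * (1 - t) = x" "i * (1 - t) = 1"
  shows "i = 1 + x * i ^ 2"
proof -
  have "x * i ^ 2 = t * i * (i * (1 - t))"
    unfolding assms(1)[symmetric] by (simp add: power2_eq_square mult_ac)
  also have "\<dots> = i * t" unfolding assms(2) by simp
  also have "\<dots> = i - i * (1 - t)" by (simp add: algebra_simps)
  also have "\<dots> = i - 1" unfolding assms(2) ..
  finally show ?thesis by simp
qed

lemma quaternary_series_exists:
  "\<exists>U :: real fps. U = 1 + fps_X * U ^ 4"
proof -
  define a :: "real fps" where "a = fps_X * (1 - fps_X) ^ 3"
  define t where "t = fps_inv a"
  have t0: "t $ 0 = 0" by (simp add: t_def fps_inv_def)
  have "a $ 0 = 0" "a $ 1 \<noteq> 0" by (simp_all add: a_def power3_eq_cube)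
  then have "a oo t = fps_X" unfolding t_def by (intro fps_inv_right)
  then have "t * (1 - t) ^ 3 = fps_X"
    using t0 by (simp add: a_def fps_compose_mult_distrib fps_compose_power [symmetric]
        fps_compose_sub_distrib)
  moreover have "inverse (1 - t) * (1 - t) = 1"
    using t0 by (intro inverse_mult_eq_1) simp
  ultimately show ?thesis by (blast intro: inverse_cubic_substitution)
qed

lemma catalan_series_exists:
  "\<exists>C :: real fps. C = 1 + fps_X * C ^ 2"
proof -
  define a :: "real fps" where "a = fps_X * (1 - fps_X)"
  define t where "t = fps_inv a"
  have t0: "t $ 0 = 0" by (simp add: t_def fps_inv_def)
  have "a $ 0 = 0" "a $ 1 \<noteq> 0" by (simp_all add: a_def)
  then have "a oo t = fps_X" unfolding t_def by (intro fps_inv_right)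
  then have "t * (1 - t) = fps_X"
    using t0 by (simp add: a_def fps_compose_mult_distrib fps_compose_sub_distrib)
  moreover have "inverse (1 - t) * (1 - t) = 1"
    using t0 by (intro inverse_mult_eq_1) simp
  ultimately show ?thesis by (blast intro: inverse_quadratic_substitution)
qed

lemma quadratic_fixpoint_unique:
  fixes C D z :: "'a :: idom fps"
  assumes "C = 1 + z * C ^ 2" "D = 1 + z * D ^ 2" "z $ 0 = 0"
  shows "C = D"
proof -
  have "(C - D) * (1 - z * (C + D)) = 0" using assms(1,2) by algebra
  moreover have "(1 - z * (C + D)) $ 0 \<noteq> 0" using assms(3) by simp
  then have "1 - z * (C + D) \<noteq> 0" by (metis fps_zero_nth)
  ultimately show ?thesis by simp
qed

text \<open>After multiplication by \<open>(U - 1) C^2\<close> both sides become the product of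
  \<open>C - 1\<close>, \<open>C - U\<close>, \<open>(U - 1) C - 1\<close> and
  \<open>(U - 1) C - U\<close>.\<close>

lemma catalytic_identity:
  fixes U C x u :: "'a :: idom"
  assumes U: "U = 1 + x * U ^ 4" and C: "C = 1 + x * u * U ^ 2 * C ^ 2"
    and ne: "x \<noteq> 0" "U \<noteq> 0" "C \<noteq> 0"
    and A: "A = U * C - (U - 1) * C ^ 2"
  shows "(u - 1) * (A - 1) = x * u * (u * A - U ^ 2 * (2 - U)) * A"
proof -
  \<comment> \<open>Multiplying the equation of \<open>C\<close> by \<open>U^2\<close> and replacing
    \<open>x U^4\<close> by \<open>U - 1\<close> eliminates \<open>x\<close>; this expresses
    \<open>u\<close> through \<open>U\<close> and \<open>C\<close>.\<close>
  have K: "(U - 1) * C ^ 2 * u = U ^ 2 * (C - 1)" using U C by algebra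
  have xu: "x * u * (U ^ 2 * C ^ 2) = C - 1" using C by algebra
  have 1: "(U - 1) * C ^ 2 * (u - 1) = - (((U - 1) * C - U) * (C - U))" using K by algebra
  have 2: "A - 1 = - (((U - 1) * C - 1) * (C - 1))" using A by algebra
  have "(U - 1) * C ^ 2 * (u * A - U ^ 2 * (2 - U)) = U ^ 2 * (C - 1) * A - U ^ 2 * (2 - U) * (U - 1) * C ^ 2"
    using K by algebra
  also have "\<dots> = - (U ^ 2 * C * (((U - 1) * C - 1) * (C - U)))" using A by algebra
  finally have 3: "(U - 1) * C ^ 2 * (u * A - U ^ 2 * (2 - U)) = - (U ^ 2 * C * (((U - 1) * C - 1) * (C - U)))" .
  have 4: "A = - (C * ((U - 1) * C - U))" using A by algebra
  have "((U - 1) * C ^ 2 * (u * A - U ^ 2 * (2 - U))) * (x * u * A) =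
     - (x * u * (U ^ 2 * C ^ 2)) * (((U - 1) * C - 1) * (C - U)) * (- ((U - 1) * C - U))"
    unfolding 3 using 4 by algebra
  also have "\<dots> = ((U - 1) * C ^ 2 * (u - 1)) * (A - 1)" unfolding xu 1 2 by algebra
  finally have "((U - 1) * C ^ 2) * ((u - 1) * (A - 1)) = ((U - 1) * C ^ 2) * (x * u * (u * A - U ^ 2 * (2 - U)) * A)"
    by algebra
  moreover have "(U - 1) * C ^ 2 \<noteq> 0" using U ne by auto
  ultimately show ?thesis by (simp only: mult_cancel_left) simp
qed


text \<open>The unique solution \<open>A = U C - (U - 1) C\<^sup>2\<close> of the catalytic equation, with \<open>C\<close> the
  Catalan series at \<open>u x U\<^sup>2\<close>; at \<open>u = 1\<close> it collapses since then \<open>C = U\<close>.\<close>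

lemma catalytic_solution_at_1:
  fixes \<alpha> :: "nat \<Rightarrow> real \<Rightarrow> real"
  assumes a0: "\<And>u. \<alpha> 0 u = 1"
    and cont: "\<And>k. isCont (\<alpha> k) 1"
    and rec: "\<And>k u. u \<noteq> 1 \<Longrightarrow>
      (u - 1) * \<alpha> (Suc k) u = (\<Sum>j\<le>k. u * (u * \<alpha> j u - \<alpha> j 1) * \<alpha> (k - j) u)"
    and U: "U = 1 + fps_X * U ^ 4"
  shows "Abs_fps (\<lambda>k. \<alpha> k 1) = U ^ 2 * (2 - U)"
proof -
  obtain c :: "real fps" where c: "c = 1 + fps_X * c ^ 2" using catalan_series_exists by blast
  define z where "z = (\<lambda>u. fps_const u * (fps_X * U ^ 2))"
  define C where "C = (\<lambda>u. c oo z u)"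
  define A where "A = (\<lambda>u. U * C u - (U - 1) * C u ^ 2)"
  define A1 where "A1 = U ^ 2 * (2 - U)"
  have z0: "z u $ 0 = 0" for u by (simp add: z_def)
  have Ceq: "C u = 1 + z u * C u ^ 2" for u
  proof -
    have "c oo z u = (1 + fps_X * c ^ 2) oo z u" using c by simp
    also have "\<dots> = 1 + z u * (c oo z u) ^ 2" using z0[of u]
      by (simp add: fps_compose_add_distrib fps_compose_mult_distrib fps_compose_power)
    finally show ?thesis by (simp add: C_def)
  qed
  have C1: "C 1 = U"
  proof (rule quadratic_fixpoint_unique[OF Ceq _ z0])
    show "U = 1 + z 1 * U ^ 2" using U by (simp add: z_def power_numeral_even algebra_simps)
  qed
  have A_1: "A 1 = A1" unfolding A_def A1_def C1 by algebra
  have U0: "U $ 0 = 1" by (subst U) simp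
  have C0: "C u $ 0 = 1" for u by (subst Ceq) (simp add: z0)
  have A0: "A u $ 0 = 1" for u
    by (simp add: A_def C0 U0 power2_eq_square)
  have eq: "(fps_const u - 1) * (A u - 1) = fps_X * fps_const u * (fps_const u * A u - A1) * A u" for u
    unfolding A1_def
  proof (rule catalytic_identity[OF U _ _ _ _ A_def[THEN fun_cong]])
    show "C u = 1 + fps_X * fps_const u * U\<^sup>2 * (C u)\<^sup>2"
      using Ceq[of u] by (simp add: z_def mult_ac)
    show "(fps_X :: real fps) \<noteq> 0" by simp
    show "U \<noteq> 0" using U0 by auto
    show "C u \<noteq> 0" using C0[of u] by auto
  qed
  have Arec: "(u - 1) * A u $ Suc k = (\<Sum>j\<le>k. u * (u * A u $ j - A1 $ j) * A u $ (k - j))" for u k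
  proof -
    have "((fps_const u - 1) * (A u - 1)) $ Suc k = (u - 1) * A u $ Suc k"
      by (simp add: algebra_simps)
    moreover have "(fps_X * fps_const u * (fps_const u * A u - A1) * A u) $ Suc k
       = (fps_X * ((fps_const u * (fps_const u * A u - A1)) * A u)) $ Suc k"
      by (simp add: mult_ac)
    moreover have "\<dots> = (\<Sum>j\<le>k. u * (u * A u $ j - A1 $ j) * A u $ (k - j))"
      by (simp add: fps_mult_nth[of "fps_const u * (fps_const u * A u - A1)" "A u"] atLeast0AtMost
          del: mult.assoc)
    ultimately show ?thesis using eq[of u] by simp
  qed
  have contA: "isCont (\<lambda>u. A u $ k) 1" for k
  proof -
    \<comment> \<open>With \<open>u ^ i\<close> pulled out, each coefficient of \<open>C u\<close>
      is a finite sum of constants times powers of \<open>u\<close>.\<close>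
    have Z: "z u ^ i = fps_const (u ^ i) * (fps_X * U ^ 2) ^ i" for u i
      by (simp add: z_def power_mult_distrib)
    have "isCont (\<lambda>u. C u $ m) 1" for m
      unfolding C_def fps_compose_nth Z fps_mult_left_const_nth by (intro continuous_intros)
    then show ?thesis
      unfolding A_def power2_eq_square fps_sub_nth fps_mult_nth by (intro continuous_intros) auto
  qed
  have main: "\<forall>u. \<alpha> k u = A u $ k" for k
  proof (induction k rule: less_induct)
    case (less k)
    show ?case
    proof (cases k)
      case 0
      then show ?thesis by (simp add: a0 A0)
    next
      case (Suc m)
      \<comment> \<open>Away from 1 the recursion can be divided by \<open>u - 1\<close>. The value
        at 1, which enters all later coefficients, is then obtained as a limit.\<close>
      have ne: "\<alpha> k u = A u $ k" if "u \<noteq> 1" for u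
      proof -
        have "(u - 1) * \<alpha> (Suc m) u = (\<Sum>j\<le>m. u * (u * \<alpha> j u - \<alpha> j 1) * \<alpha> (m - j) u)"
          by (rule rec[OF that])
        also have "\<dots> = (\<Sum>j\<le>m. u * (u * A u $ j - A1 $ j) * A u $ (m - j))"
          using less Suc by (intro sum.cong) (auto simp: A_1)
        also have "\<dots> = (u - 1) * A u $ Suc m" by (rule Arec[symmetric])
        finally show ?thesis using that Suc by simp
      qed
      have 1: "(\<alpha> k \<longlongrightarrow> \<alpha> k 1) (at 1)" using cont[of k] by (simp add: isCont_def)
      have 2: "((\<lambda>u. A u $ k) \<longlongrightarrow> A 1 $ k) (at 1)" using contA[of k] by (simp add: isCont_def)
      have "(\<alpha> k \<longlongrightarrow> A 1 $ k) (at 1)"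
        using 2 by (rule Lim_transform_eventually) (auto simp: eventually_at_filter ne)
      then have "\<alpha> k 1 = A 1 $ k" using tendsto_unique[OF _ 1] by simp
      then show ?thesis using ne by metis
    qed
  qed
  show ?thesis by (rule fps_ext) (simp add: main A_1 A1_def)
qed

section \<open>Coefficient extraction\<close>

text \<open>Extending the lower index by 0 to negative integers lets Pascal's rule hold without side
  conditions.\<close>

definition chooseZ :: "nat \<Rightarrow> int \<Rightarrow> int" where
  "chooseZ m i = (if i < 0 then 0 else int (m choose nat i))"

lemma chooseZ_Suc: "chooseZ (Suc m) i = chooseZ m i + chooseZ m (i - 1)"
proof (cases "i \<le> 0")
  case False
  then obtain j where "i = int (Suc j)"
    by (metis int_nat_eq not_le not0_implies_Suc nat_0_iff of_nat_0 order_less_imp_le)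
  then show ?thesis by (simp add: chooseZ_def nat_add_distrib)
qed (auto simp: chooseZ_def)

text \<open>This is the case \<open>j = 0\<close> of the coefficient formula below, where the power
  is 1 and the difference has to vanish.\<close>

lemma choose_threefold: "(4 * k + 3) choose Suc k = 3 * ((4 * k + 3) choose k)"
proof -
  have "Suc k * ((4 * k + 3) choose Suc k) = Suc k * (3 * ((4 * k + 3) choose k))"
    using binomial_absorption[of k "4 * k + 3"] binomial_absorb_comp[of "4 * k + 3" k]
    by (simp add: algebra_simps)
  then show ?thesis by (simp only: mult_cancel1) simp
qed

lemma sum_choose_Suc:
  "(\<Sum>i\<le>Suc m. Suc n choose i) = (n choose Suc m) + 2 * (\<Sum>i\<le>m. n choose i)"
proof -
  have "(\<Sum>i\<le>Suc m. Suc n choose i) = 1 + (\<Sum>i\<le>m. n choose i) + (\<Sum>i\<le>m. n choose Suc i)"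
    unfolding sum.atMost_Suc_shift by (simp add: sum.distrib)
  moreover have "1 + (\<Sum>i\<le>m. n choose Suc i) = (\<Sum>i\<le>Suc m. n choose i)"
    unfolding sum.atMost_Suc_shift by simp
  ultimately show ?thesis by simp
qed

text \<open>The coefficient is \<open>j / (k + 1)\<close> times \<open>4 k + 4\<close> choose \<open>k + 1 - j\<close>; written as a difference, it
  satisfies the recursion from \<open>U - 1 = x U\<^sup>4\<close> by Pascal's rule.\<close>

lemma quaternary_power_coeff:
  fixes U :: "real fps"
  assumes U: "U = 1 + fps_X * U ^ 4"
  shows "((U - 1) ^ j) $ Suc k = of_int (chooseZ (4 * k + 3) (int k + 1 - int j) - 3 * chooseZ (4 * k + 3) (int k - int j))"
proof -
  define Y where "Y = U - 1"
  have Y: "Y = fps_X * (1 + Y) ^ 4"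
    using U by (metis Y_def add_diff_cancel_left' add.commute diff_add_cancel)
  have Y0: "Y $ 0 = 0" by (subst Y) simp
  have rec: "(Y ^ Suc j) $ Suc k = (Y ^ j) $ k + 4 * (Y ^ (j+1)) $ k + 6 * (Y ^ (j+2)) $ k
      + 4 * (Y ^ (j+3)) $ k + (Y ^ (j+4)) $ k" for j k
  proof -
    have "Y ^ Suc j = fps_X * (Y ^ j * (1 + Y) ^ 4)" 
      using Y by (metis power_Suc mult.left_commute mult.commute)
    also have "Y ^ j * (1 + Y) ^ 4 = Y ^ j + fps_const 4 * Y ^ (j+1) + fps_const 6 * Y ^ (j+2) + fps_const 4 * Y ^ (j+3) + Y ^ (j+4)"
      unfolding numeral_fps_const [symmetric] power_add by algebra
    finally show ?thesis
      by (simp only: fps_X_mult_nth fps_add_nth fps_mult_left_const_nth) simp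
  qed
  have "(Y ^ j) $ Suc k = of_int (chooseZ (4 * k + 3) (int k + 1 - int j) - 3 * chooseZ (4 * k + 3) (int k - int j))" for j
  proof (induction k arbitrary: j)
    case 0
    show ?case
    proof (cases j)
      case (Suc i)
      show ?thesis unfolding Suc rec
        by (cases i) (simp_all add: Y0 chooseZ_def fps_power_zeroth numeral_3_eq_3)
    qed (simp add: chooseZ_def numeral_eq_Suc)
  next
    case (Suc k)
    show ?case
    proof (cases j)
      case 0
      show ?thesis using 0 choose_threefold[of "Suc k"] by (simp add: chooseZ_def nat_add_distrib)
    next
      case (Suc i)
      \<comment> \<open>Pascal's rule applied four times produces the coefficients 1, 4, 6, 4, 1 of
        the recursion.\<close>
      have s: "4 * Suc k + 3 = Suc (Suc (Suc (Suc (4 * k + 3))))" by simp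
      show ?thesis unfolding Suc rec Suc.IH unfolding s chooseZ_Suc
        by (simp add: algebra_simps)
    qed
  qed
  then show ?thesis by (simp add: Y_def)
qed


text \<open>With \<open>A = U\<^sup>2 (2 - U)\<close> and \<open>B = 1 - 1/A\<close>, the series \<open>2 x B' A = 2 x A'/A\<close> equals
  \<open>2 (U - 1)/(2 - U)\<close>, the sum of \<open>2 (U - 1)\<^sup>j\<close> over \<open>j \<ge> 1\<close>.\<close>

lemma cyclic_count_formula:
  fixes a b :: "nat \<Rightarrow> real"
  assumes U: "U = 1 + fps_X * U ^ 4"
    and A: "Abs_fps a = U ^ 2 * (2 - U)"
    and ab: "\<And>k. a (Suc k) = (\<Sum>j\<le>k. b (Suc j) * a (k - j))"
    and k: "k \<ge> 1"
  shows "(\<Sum>j=1..k. 2 * real j * b j * a (k - j)) =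
     3 * real ((4 * k) choose k) - 2 * (\<Sum>i=0..k. real ((4 * k) choose i))"
proof -
  define B where "B = Abs_fps (\<lambda>j. if j = 0 then 0 else b j)"
  define A' where "A' = Abs_fps a"
  define N where "N = 2 * fps_X * fps_deriv B * A'"
  define Y where "Y = U - 1"
  have U0: "U $ 0 = 1" by (subst U) simp
  have a0: "a 0 = 1" using arg_cong[OF A, of "\<lambda>f. f $ 0"] U0 by (simp add: power2_eq_square)
  have AB: "A' = 1 + B * A'"
  proof (rule fps_ext)
    fix m show "A' $ m = (1 + B * A') $ m"
    proof (cases m)
      case 0
      then show ?thesis by (simp add: A'_def B_def a0)
    next
      case (Suc l)
      have "(B * A') $ m = (\<Sum>j=0..Suc l. B $ j * A' $ (Suc l - j))"
        by (simp add: fps_mult_nth Suc)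
      also have "\<dots> = (\<Sum>j\<le>l. b (Suc j) * a (l - j))"
        unfolding atLeast0AtMost sum.atMost_Suc_shift by (simp add: B_def A'_def)
      finally show ?thesis using ab[of l] by (simp add: A'_def Suc)
    qed
  qed
  \<comment> \<open>Since \<open>A' = 1 / (1 - B)\<close>, its derivative is that of
    \<open>B\<close> times \<open>A'\<close> squared; here \<open>A'\<close> names the series of
    \<open>a\<close>, not a derivative.\<close>
  have dA: "fps_deriv A' = fps_deriv B * A' ^ 2"
  proof -
    have "fps_deriv A' = fps_deriv B * A' + B * fps_deriv A'"
      by (subst AB) (simp add: add.commute)
    then show ?thesis using AB by algebra
  qed
  have A'U: "A' = 2 * U ^ 2 - U ^ 3" unfolding A'_def A by algebra
  have dA': "fps_deriv A' = (4 * U - 3 * U ^ 2) * fps_deriv U"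
    unfolding A'U by (simp add: fps_deriv_power' algebra_simps power2_eq_square power3_eq_cube)
  have dU: "fps_deriv U = U ^ 4 + 4 * fps_X * U ^ 3 * fps_deriv U"
    by (subst U) (simp add: fps_deriv_power' algebra_simps)
  have dU': "fps_deriv U * (4 - 3 * U) = U ^ 5" using dU U by algebra
  have Unz: "U \<noteq> 0" using U0 by auto
  have "N * A' = 2 * fps_X * fps_deriv A'"
    unfolding N_def dA by (simp add: power2_eq_square mult_ac)
  also have "\<dots> = 2 * fps_X * U * (fps_deriv U * (4 - 3 * U))" unfolding dA' by algebra
  also have "\<dots> = 2 * (fps_X * U ^ 4) * U ^ 2" unfolding dU' by algebra
  also have "fps_X * U ^ 4 = Y" using U by (metis Y_def add_diff_cancel_left')
  finally have "N * (2 - U) * U ^ 2 = 2 * Y * U ^ 2" unfolding A'U by algebra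
  then have "N * (2 - U) = 2 * Y" using Unz by simp
  then have NY: "N = 2 * Y + N * Y" unfolding Y_def by algebra
  \<comment> \<open>Iterating \<open>NY\<close> expands \<open>2 Y / (1 - Y)\<close> into finitely
    many powers plus a remainder.\<close>
  have Nsum: "N = 2 * (\<Sum>j=1..m. Y ^ j) + N * Y ^ m" for m
  proof (induction m)
    case (Suc m)
    have "N * Y ^ m = 2 * Y ^ Suc m + N * Y ^ Suc m" 
      using arg_cong[OF NY, of "\<lambda>f. f * Y ^ m"] by (simp add: algebra_simps)
    then show ?case using Suc by (simp add: algebra_simps)
  qed simp
  obtain m where m: "k = Suc m" using k by (cases k) auto
  define n where "n = 4 * m + 3"
  have Y0: "Y $ 0 = 0" by (simp add: Y_def U0)
  \<comment> \<open>\<open>N\<close> starts in degree 1 and \<open>Y ^ k\<close> in degree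
    \<open>k\<close>, so the remainder does not reach the coefficient sought.\<close>
  have "(N * Y ^ k) $ k = 0"
  proof -
    have "(N * Y ^ k) $ k = (\<Sum>i=0..k. N $ i * (Y ^ k) $ (k - i))" by (rule fps_mult_nth)
    also have "\<dots> = (\<Sum>i=0..k. 0)"
    proof (intro sum.cong refl)
      fix i assume "i \<in> {0..k}"
      show "N $ i * (Y ^ k) $ (k - i) = 0"
      proof (cases "i = 0")
        case True then show ?thesis by (simp add: N_def mult.assoc)
      next
        case False
        then show ?thesis using startsby_zero_power_prefix[OF Y0, of k] \<open>k \<ge> 1\<close> by auto
      qed
    qed
    finally show ?thesis by simp
  qed
  then have "N $ k = 2 * (\<Sum>j=1..k. (Y ^ j) $ k)"
    by (subst Nsum[of k]) (simp add: fps_sum_nth numeral_fps_const)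
  also have "(\<Sum>j=1..k. (Y ^ j) $ k) =
      (\<Sum>j=1..k. of_int (chooseZ n (int m + 1 - int j) - 3 * chooseZ n (int m - int j)))"
    unfolding m Y_def quaternary_power_coeff[OF U] n_def by simp
  also have "\<dots> = (\<Sum>i\<le>m. of_int (chooseZ n (int i) - 3 * chooseZ n (int i - 1)))"
    by (rule sum.reindex_bij_witness[of _ "\<lambda>i. k - i" "\<lambda>j. k - j"]) (auto simp: m of_nat_diff algebra_simps)
  also have "\<dots> = (\<Sum>i\<le>m. real (n choose i)) - 3 * (\<Sum>i\<le>m. of_int (chooseZ n (int i - 1)))"
    by (simp add: sum_subtractf sum_distrib_left chooseZ_def)
  also have "(\<Sum>i\<le>m. of_int (chooseZ n (int i - 1))) = (\<Sum>i\<le>m. real (n choose i)) - real (n choose m)"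
    by (induction m) (simp_all add: chooseZ_def)
  finally have Nk: "N $ k = 6 * real (n choose m) - 4 * (\<Sum>i\<le>m. real (n choose i))" by simp
  have "N $ k = (\<Sum>j=1..k. 2 * real j * b j * a (k - j))"
  proof -
    have "N = fps_X * (2 * fps_deriv B * A')" by (simp add: N_def mult_ac)
    then have "N $ k = (2 * fps_deriv B * A') $ m" by (simp add: m)
    also have "\<dots> = (\<Sum>j=0..m. 2 * real (Suc j) * b (Suc j) * a (m - j))"
      unfolding fps_mult_nth[of _ A'] by (simp add: B_def A'_def numeral_fps_const algebra_simps)
    also have "\<dots> = (\<Sum>j=1..k. 2 * real j * b j * a (k - j))"
      by (rule sum.reindex_bij_witness[of _ "\<lambda>i. i - 1" Suc]) (auto simp: m)
    finally show ?thesis .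
  qed
  moreover have "real ((4 * k) choose k) = 4 * real (n choose m)"
  proof -
    have e: "4 * k = Suc n" "Suc n = Suc m * 4" by (simp_all add: m n_def)
    have "Suc m * ((4 * k) choose k) = Suc n * (n choose m)"
      using binomial_absorption[of m "Suc n"]
        unfolding e(1) unfolding m by (simp del: binomial_Suc_Suc)
    also have "\<dots> = Suc m * (4 * (n choose m))" unfolding e(2) by (simp add: algebra_simps)
    finally have "Suc m * ((4 * k) choose k) = Suc m * (4 * (n choose m))" .
    then have "(4 * k) choose k = 4 * (n choose m)" by (simp only: mult_cancel1) simp
    then show ?thesis by simp
  qed
  \<comment> \<open>With \<open>c = n choose m\<close> and \<open>s\<close> the sum of
    \<open>n choose i\<close> up to \<open>m\<close>, the claim becomes
    \<open>3 * 4 c - 2 (3 c + 2 s) = 6 c - 4 s\<close>.\<close>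
  moreover have "(\<Sum>i=0..k. real ((4 * k) choose i)) = 3 * real (n choose m) + 2 * (\<Sum>i\<le>m. real (n choose i))"
  proof -
    have "4 * k = Suc n" by (simp add: m n_def)
    then show ?thesis
      using arg_cong[OF sum_choose_Suc[of n m], of real] choose_threefold[of m]
      by (simp add: m n_def atLeast0AtMost del: binomial_Suc_Suc)
  qed
  ultimately show ?thesis using Nk by simp
qed

section \<open>Counting periodic patterns\<close>

definition periodic_dyck_bracketings :: "nat \<Rightarrow> (int \<Rightarrow> int) set" where
  "periodic_dyck_bracketings k = {p. equivariant (2 * k) p \<and> (\<exists>x. dyck_window p x k)}"

definition periodic_split_bracketings :: "nat \<Rightarrow> nat \<Rightarrow> int \<Rightarrow> (int \<Rightarrow> int) set" where
  "periodic_split_bracketings k j x = {p. equivariant (2 * k) p \<and> dyck_prime p x j \<and>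
     dyck_window p (x + 2 * int j + 2) (k - 1 - j)}"

lemma dyck_window_shift:
  assumes "equivariant n p" "dyck_window p x k"
  shows "dyck_window p (x + m * int n) k"
proof -
  have "p (i - m * int n) + m * int n = p i" for i
    using equivariantD[OF assms(1), of "i - m * int n" m] by simp
  then show ?thesis using dyck_window_translate[OF assms(2), of "m * int n"] by simp
qed

text \<open>The translates of the window tile the line and arcs stay inside their tile, so the
  conditions can be checked in one tile.\<close>

lemma bracketing_if_dyck_window:
  assumes k: "k \<ge> 1" and p: "equivariant (2 * k) p" and w: "dyck_window p x k"
  shows "bracketing (2 * k) p"
proof -
  define n where "n = 2 * k"
  have n0: "int n > 0" and w': "dyck_window p (x + m * int n) k" for m
    using k dyck_window_shift[OF p w] by (auto simp: n_def)
  have range: "i < p i \<and> (\<forall>j. i < j \<longrightarrow> j < p i \<longrightarrow> p j \<le> p i)" for i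
  proof -
    define m where "m = (i - x) div int n"
    have e: "i - x = m * int n + (i - x) mod int n" by (simp add: m_def)
    have "0 \<le> (i - x) mod int n" "(i - x) mod int n < int n" using n0 by simp_all
    then have i: "x + m * int n \<le> i" "i < x + m * int n + 2 * int k"
      using e by (simp_all add: n_def)
    then have "i < p i" "p i \<le> x + m * int n + 2 * int k" using dyck_window_range[OF w'] by blast+
    then show ?thesis using dyck_window_noncrossing[OF w' i(1)] by auto
  qed
  then show ?thesis using p unfolding bracketing_def by blast
qed

lemma periodic_split_window:
  assumes "p \<in> periodic_split_bracketings k j x" "j < k"
  shows "dyck_window p x k"
proof -
  have "dyck_window p x (Suc (k - 1))"
    unfolding dyck_window_Suc_iff
      using assms by (intro exI[of _ j]) (auto simp: periodic_split_bracketings_def)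
  then show ?thesis using assms(2) by simp
qed

text \<open>One period determines the pattern: \<open>cut\<close> puts the default value outside the
  window, and \<open>ext\<close> repeats the window.\<close>

lemma periodic_split_bracketings_bij:
  assumes j: "j < k"
  shows "\<exists>f. bij_betw f (periodic_split_bracketings k j x) (split_bracketings x j (k - 1 - j))"
proof -
  define n where "n = 2 * k"
  define m where "m = k - 1 - j"
  have n0: "int n > 0" using j by (simp add: n_def)
  have len: "x + 2 * int j + 2 + 2 * int m = x + int n"
    using j by (simp add: n_def m_def of_nat_diff)
  define q where "q = (\<lambda>i. (i - x) div int n)"
  define cut where "cut = (\<lambda>(p :: int \<Rightarrow> int) i. if x \<le> i \<and> i < x + int n then p i else i + 1)"
  define ext where "ext = (\<lambda>(p :: int \<Rightarrow> int) i. p (i - q i * int n) + q i * int n)"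
  have q0: "q i = 0" if "x \<le> i" "i < x + int n" for i
    unfolding q_def using that by (intro div_pos_pos_trivial) auto
  have qs: "q (i + int n) = q i + 1" for i
  proof -
    have e: "i + int n - x = (i - x) + 1 * int n" by simp
    have "((i - x) + 1 * int n) div int n = 1 + (i - x) div int n"
      using n0 by (intro div_mult_self1) simp
    then show ?thesis unfolding q_def e by simp
  qed
  have qw: "x \<le> i - q i * int n \<and> i - q i * int n < x + int n" for i
  proof -
    have e: "i - x = q i * int n + (i - x) mod int n" by (simp add: q_def)
    have "0 \<le> (i - x) mod int n" "(i - x) mod int n < int n" using n0 by simp_all
    then show ?thesis using e by linarith
  qed
  have win: "x \<le> i \<Longrightarrow> i < x + 2 * int j + 2 \<Longrightarrow> i < x + int n"
    "x + 2 * int j + 2 \<le> i \<Longrightarrow> i < x + 2 * int j + 2 + 2 * int m \<Longrightarrow> x \<le> i \<and> i < x + int n" for i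
    using len by simp_all
  have P: "p \<in> periodic_split_bracketings k j x \<longleftrightarrow>
    equivariant n p \<and> dyck_prime p x j \<and> dyck_window p (x + 2 * int j + 2) m" for p
    by (simp add: periodic_split_bracketings_def n_def m_def)
  have S: "p \<in> split_bracketings x j m \<longleftrightarrow> dyck_prime p x j \<and> dyck_window p (x + 2 * int j + 2) m \<and>
    (\<forall>i. i < x \<or> x + int n \<le> i \<longrightarrow> p i = i + 1)" for p
    unfolding split_bracketings_def len by simp
  have "bij_betw cut (periodic_split_bracketings k j x) (split_bracketings x j m)"
  proof (rule bij_betw_byWitness[where f' = ext])
    show "\<forall>p\<in>periodic_split_bracketings k j x. ext (cut p) = p"
    proof (intro ballI ext)
      fix p i assume "p \<in> periodic_split_bracketings k j x"
      then have e: "equivariant n p" by (simp add: P)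
      have "p (i - q i * int n) + q i * int n = p i"
        using equivariantD[OF e, of "i - q i * int n" "q i"] by simp
      then show "ext (cut p) i = p i" using qw[of i] by (simp add: ext_def cut_def)
    qed
    show "\<forall>p\<in>split_bracketings x j m. cut (ext p) = p"
    proof (intro ballI, rule HOL.ext)
      fix p i assume "p \<in> split_bracketings x j m"
      then show "cut (ext p) i = p i" using q0[of i] by (auto simp: S cut_def ext_def)
    qed
    show "cut ` periodic_split_bracketings k j x \<subseteq> split_bracketings x j m"
    proof (rule image_subsetI)
      fix p assume "p \<in> periodic_split_bracketings k j x"
      then have p: "dyck_prime p x j" "dyck_window p (x + 2 * int j + 2) m" by (auto simp: P)
      have "dyck_prime (cut p) x j"
        by (rule dyck_prime_cong[OF p(1)]) (use win in \<open>simp add: cut_def\<close>)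
      moreover have "dyck_window (cut p) (x + 2 * int j + 2) m"
        by (rule dyck_window_cong[OF p(2)]) (use win in \<open>simp add: cut_def\<close>)
      ultimately show "cut p \<in> split_bracketings x j m" by (simp add: S cut_def)
    qed
    show "ext ` split_bracketings x j m \<subseteq> periodic_split_bracketings k j x"
    proof (rule image_subsetI)
      fix p assume "p \<in> split_bracketings x j m"
      then have p: "dyck_prime p x j" "dyck_window p (x + 2 * int j + 2) m" by (auto simp: S)
      have eq: "ext p i = p i" if "x \<le> i" "i < x + int n" for i
        using q0[OF that] by (simp add: ext_def)
      have "dyck_prime (ext p) x j" by (rule dyck_prime_cong[OF p(1)]) (use win eq in simp)
      moreover have "dyck_window (ext p) (x + 2 * int j + 2) m"
        by (rule dyck_window_cong[OF p(2)]) (use win eq in simp)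
      moreover have "equivariant n (ext p)"
        by (simp add: equivariant_def ext_def qs algebra_simps)
      ultimately show "ext p \<in> periodic_split_bracketings k j x" by (simp add: P)
    qed
  qed
  then show ?thesis unfolding m_def by blast
qed

lemma real_card_split_bracketings:
  "real (card (split_bracketings x j m)) = prime_landing_poly 0 j 1 * landing_poly 0 m 1"
  using sum_split_bracketings[where u = 1 and x = x and j = j and m = m]
  by (simp add: prime_landing_poly_eq_0[of x] landing_poly_eq_0[of "x + 2 * int j + 2"])

text \<open>Passing over the arches that end at or before 0 leads to the arch covering 0;
  \<open>i\<close> and \<open>r\<close> are the half-lengths of the parts before and after
  it.\<close>

lemma dyck_window_locate:
  assumes "dyck_window p x m" "x \<le> 0" "0 < x + 2 * int m"
  shows "\<exists>i j r. dyck_window p x i \<and> dyck_prime p (x + 2 * int i) j \<and>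
    dyck_window p (x + 2 * int i + 2 * int j + 2) r \<and> i + j + r + 1 = m \<and>
    x + 2 * int i \<le> 0 \<and> 0 < x + 2 * int i + 2 * int j + 2"
  using assms
proof (induction rule: dyck_window_prime_induct)
  case (step x j m)
  show ?case
  proof (cases "0 < x + 2 * int j + 2")
    case True
    then show ?thesis using step dyck_window_0[of p x]
      by (intro exI[of _ 0] exI[of _ j] exI[of _ m]) simp
  next
    case False
    have "0 < x + 2 * int j + 2 + 2 * int m" using step.prems by simp
    then obtain i l r where *: "dyck_window p (x + 2 * int j + 2) i" "dyck_prime p (x + 2 * int j + 2 + 2 * int i) l"
      "dyck_window p (x + 2 * int j + 2 + 2 * int i + 2 * int l + 2) r" "i + l + r + 1 = m"
      "x + 2 * int j + 2 + 2 * int i \<le> 0" "0 < x + 2 * int j + 2 + 2 * int i + 2 * int l + 2"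
      using step.IH(2) False by auto
    have e: "x + 2 * int (j + i + 1) = x + 2 * int j + 2 + 2 * int i" by simp
    have "dyck_window p x (j + i + 1)"
      using step.hyps(1) *(1) unfolding dyck_prime_def by (intro dyck_window_step) auto
    then show ?thesis using * unfolding e[symmetric]
      by (intro exI[of _ "j + i + 1"] exI[of _ l] exI[of _ r]) (simp del: of_nat_add)
  qed
qed simp

text \<open>A period can be rotated to begin with the arch covering position 0. An arch of length
  \<open>2 j + 2\<close> covers 0 from \<open>2 j + 2\<close> starting points, the interval in the
  index set.\<close>

lemma periodic_dyck_bracketings_decomp:
  assumes k: "k \<ge> 1"
  shows "periodic_dyck_bracketings k =
    (\<Union>(j, x)\<in>Sigma {..<k} (\<lambda>j. {- (2 * int j + 1)..0}). periodic_split_bracketings k j x)"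
proof (intro equalityI subsetI)
  fix p assume "p \<in> periodic_dyck_bracketings k"
  then obtain y where p: "equivariant (2 * k) p" and y: "dyck_window p y k"
    by (auto simp: periodic_dyck_bracketings_def)
  define m where "m = (- y) div int (2 * k)"
  define x where "x = y + m * int (2 * k)"
  have e: "- y = m * int (2 * k) + (- y) mod int (2 * k)"
    unfolding m_def by (rule div_mult_mod_eq[symmetric])
  have "0 \<le> (- y) mod int (2 * k)" "(- y) mod int (2 * k) < int (2 * k)" using k by simp_all
  then have x: "x \<le> 0" "0 < x + 2 * int k" using e by (simp_all add: x_def)
  have "dyck_window p x k" unfolding x_def by (rule dyck_window_shift[OF p y])
  from dyck_window_locate[OF this x] obtain i j r where *: "dyck_window p x i" "dyck_prime p (x + 2 * int i) j"
    "dyck_window p (x + 2 * int i + 2 * int j + 2) r" "i + j + r + 1 = k"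
    "x + 2 * int i \<le> 0" "0 < x + 2 * int i + 2 * int j + 2" by blast
  \<comment> \<open>Translated by a period, the part before the arch continues the part after
    it.\<close>
  have e: "x + 1 * int (2 * k) = x + 2 * int i + 2 * int j + 2 + 2 * int r" using *(4) by auto
  have "dyck_window p (x + 2 * int i + 2 * int j + 2 + 2 * int r) i"
    unfolding e[symmetric] by (rule dyck_window_shift[OF p *(1)])
  with *(3) have "dyck_window p (x + 2 * int i + 2 * int j + 2) (r + i)"
    by (rule dyck_window_append)
  moreover have "r + i = k - 1 - j" using *(4) by simp
  ultimately have "p \<in> periodic_split_bracketings k j (x + 2 * int i)"
    using p *(2) by (simp add: periodic_split_bracketings_def)
  moreover have "(j, x + 2 * int i) \<in> Sigma {..<k} (\<lambda>j. {- (2 * int j + 1)..0})"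
    using *(4-6) by auto
  ultimately show "p \<in> (\<Union>(j, x)\<in>Sigma {..<k} (\<lambda>j. {- (2 * int j + 1)..0}). periodic_split_bracketings k j x)"
    by blast
next
  fix p assume "p \<in> (\<Union>(j, x)\<in>Sigma {..<k} (\<lambda>j. {- (2 * int j + 1)..0}). periodic_split_bracketings k j x)"
  then obtain j x where jx: "j < k" "p \<in> periodic_split_bracketings k j x" by auto
  have "equivariant (2 * k) p" using jx(2) by (simp add: periodic_split_bracketings_def)
  then show "p \<in> periodic_dyck_bracketings k"
    using periodic_split_window[OF jx(2,1)] unfolding periodic_dyck_bracketings_def by blast
qed

text \<open>Strictly inside the arch from \<open>x\<close> the height is positive. A window starting
  at such a \<open>y\<close> never falls below that level, yet the height returns to 0 at
  \<open>x + 2 k\<close>.\<close>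

lemma periodic_split_start_unique:
  assumes p: "p \<in> periodic_split_bracketings k j x" "p \<in> periodic_split_bracketings k l y"
    and "j < k" "l < k" and x: "x < y" "y < x + 2 * int j + 2"
  shows False
proof -
  have "0 < height p x y"
    using p(1) x dyck_prime_height(2)[of p x j y] by (simp add: periodic_split_bracketings_def)
  moreover have "height p x (x + 2 * int k) = 0"
    using dyck_window_height[OF periodic_split_window[OF p(1) assms(3)]] by simp
  moreover have "0 \<le> height p y (x + 2 * int k)"
    using dyck_window_height[OF periodic_split_window[OF p(2) assms(4)]] x \<open>j < k\<close> by simp
  moreover have "height p x (x + 2 * int k) = height p x y + height p y (x + 2 * int k)"
    using x \<open>j < k\<close> by (intro height_split) auto
  ultimately show False by simp
qed

lemma real_card_periodic_dyck_bracketings: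
  assumes k: "k \<ge> 1"
  shows "finite (periodic_dyck_bracketings k)"
    and "real (card (periodic_dyck_bracketings k)) =
      (\<Sum>j<k. 2 * real (Suc j) * prime_landing_poly 0 j 1 * landing_poly 0 (k - 1 - j) 1)"
proof -
  let ?I = "Sigma {..<k} (\<lambda>j. {- (2 * int j + 1)..0})"
  let ?F = "\<lambda>(j, x). periodic_split_bracketings k j x"
  have card: "card (periodic_split_bracketings k j x) = card (split_bracketings x j (k - 1 - j))" if "j < k" for j x
    using periodic_split_bracketings_bij[OF that] by (metis bij_betw_same_card)
  have fin: "finite (periodic_split_bracketings k j x)" if "j < k" for j x
    using periodic_split_bracketings_bij[OF that, of x]
      finite_subset[OF split_bracketings_subset finite_dyck_bracketings] by (metis bij_betw_finite)
  have disj: "?F a \<inter> ?F b = {}" if ab: "a \<in> ?I" "b \<in> ?I" "a \<noteq> b" for a b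
  proof (rule ccontr)
    assume "?F a \<inter> ?F b \<noteq> {}"
    then obtain p where p: "p \<in> ?F a" "p \<in> ?F b" by blast
    obtain j x where a: "a = (j, x)" by fastforce
    obtain l y where b: "b = (l, y)" by fastforce
    have jl: "j < k" "l < k" and xy: "x \<le> 0" "0 < x + 2 * int j + 2" "y \<le> 0" "0 < y + 2 * int l + 2"
      using ab(1,2) by (auto simp: a b)
    have pp: "p \<in> periodic_split_bracketings k j x" "p \<in> periodic_split_bracketings k l y"
      using p by (auto simp: a b)
    have "\<not> x < y" using periodic_split_start_unique[OF pp jl] xy by auto
    moreover have "\<not> y < x" using periodic_split_start_unique[OF pp(2,1) jl(2,1)] xy by auto
    ultimately have "x = y" by simp
    then have "j = l"
      using pp dyck_prime_unique[of p x j l] by (simp add: periodic_split_bracketings_def)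
    then show False using \<open>x = y\<close> ab(3) by (simp add: a b)
  qed
  show "finite (periodic_dyck_bracketings k)"
    unfolding periodic_dyck_bracketings_decomp[OF k] using fin by auto
  have "card (periodic_dyck_bracketings k) = (\<Sum>a\<in>?I. card (?F a))"
    unfolding periodic_dyck_bracketings_decomp[OF k] using fin disj by (intro card_UN_disjoint) auto
  also have "\<dots> = (\<Sum>j<k. \<Sum>x\<in>{- (2 * int j + 1)..0}. card (split_bracketings x j (k - 1 - j)))"
    by (subst sum.Sigma) (auto intro!: sum.cong simp: card)
  finally have "real (card (periodic_dyck_bracketings k)) =
    (\<Sum>j<k. \<Sum>x\<in>{- (2 * int j + 1)..0}. prime_landing_poly 0 j 1 * landing_poly 0 (k - 1 - j) 1)"
    by (simp add: real_card_split_bracketings del: sum_constant)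
  also have "\<dots> = (\<Sum>j<k. 2 * real (Suc j) * prime_landing_poly 0 j 1 * landing_poly 0 (k - 1 - j) 1)"
    by (intro sum.cong refl) (simp add: algebra_simps)
  finally show "real (card (periodic_dyck_bracketings k)) =
      (\<Sum>j<k. 2 * real (Suc j) * prime_landing_poly 0 j 1 * landing_poly 0 (k - 1 - j) 1)" .
qed

lemma card_periodic_dyck_bracketings:
  assumes k: "k \<ge> 1"
  shows "int (card (periodic_dyck_bracketings k)) =
    3 * int ((4 * k) choose k) - 2 * (\<Sum>i=0..k. int ((4 * k) choose i))"
proof -
  obtain U :: "real fps" where U: "U = 1 + fps_X * U ^ 4" using quaternary_series_exists by blast
  define a where "a = (\<lambda>k. landing_poly 0 k 1)"
  \<comment> \<open>The shift converts the inner half-length of an arch into its full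
    half-length.\<close>
  define b where "b = (\<lambda>j. prime_landing_poly 0 (j - 1) 1)"
  have Suc: "landing_poly 0 (Suc k) u = (\<Sum>j\<le>k. prime_landing_poly 0 j u * landing_poly 0 (k - j) u)" for k u
    unfolding landing_poly_Suc
      by (intro sum.cong refl arg_cong2[of _ _ _ _ "(*)"] landing_poly_eq_0)
  have "Abs_fps (\<lambda>k. landing_poly 0 k 1) = U ^ 2 * (2 - U)"
  proof (rule catalytic_solution_at_1[OF _ _ _ U])
    show "landing_poly 0 0 u = 1" for u by (rule landing_poly_0)
    show "isCont (landing_poly 0 k) 1" for k unfolding landing_poly_def by (intro continuous_intros)
    fix k and u :: real assume u: "u \<noteq> 1"
    show "(u - 1) * landing_poly 0 (Suc k) u =
      (\<Sum>j\<le>k. u * (u * landing_poly 0 j u - landing_poly 0 j 1) * landing_poly 0 (k - j) u)"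
      unfolding Suc sum_distrib_left mult.assoc[symmetric] prime_landing_poly_geometric[OF u] ..
  qed
  then have A: "Abs_fps a = U ^ 2 * (2 - U)" by (simp add: a_def)
  have "a (Suc k) = (\<Sum>j\<le>k. b (Suc j) * a (k - j))" for k by (simp add: a_def b_def Suc)
  from cyclic_count_formula[OF U A this k]
  have "(\<Sum>j=1..k. 2 * real j * b j * a (k - j)) =
    3 * real ((4 * k) choose k) - 2 * (\<Sum>i=0..k. real ((4 * k) choose i))" .
  moreover have "(\<Sum>j<k. 2 * real (Suc j) * prime_landing_poly 0 j 1 * landing_poly 0 (k - 1 - j) 1) =
    (\<Sum>j=1..k. 2 * real j * b j * a (k - j))"
    by (rule sum.reindex_bij_witness[of _ "\<lambda>j. j - 1" Suc]) (auto simp: a_def b_def)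
  ultimately have "real (card (periodic_dyck_bracketings k)) =
    3 * real ((4 * k) choose k) - 2 * (\<Sum>i=0..k. real ((4 * k) choose i))"
    using real_card_periodic_dyck_bracketings(2)[OF k] by simp
  then have "real_of_int (int (card (periodic_dyck_bracketings k))) =
    real_of_int (3 * int ((4 * k) choose k) - 2 * (\<Sum>i=0..k. int ((4 * k) choose i)))"
    by simp
  then show ?thesis by (simp only: of_int_eq_iff)
qed

theorem theorem8p19:
  fixes k :: nat
  assumes "k \<ge> 1"
  shows "finite (uniquely_sorted_classes (2 * k)) \<and>
    finite {w \<in> affine_perms (2 * k). avoids_231 w \<and> uniquely_sorted (2 * k) w} \<and>
    card (uniquely_sorted_classes (2 * k)) =
      card {w \<in> affine_perms (2 * k). avoids_231 w \<and> uniquely_sorted (2 * k) w} \<and>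
    int (card (uniquely_sorted_classes (2 * k))) =
      3 * int ((4 * k) choose k) - 2 * (\<Sum>i=0..k. int ((4 * k) choose i))"
proof -
  define n where "n = 2 * k"
  have n1: "n \<ge> 1" using assms by (simp add: n_def)
  define W where "W = periodic_dyck_bracketings k"
  define A where "A = {w \<in> affine_perms n. avoids_231 w \<and> uniquely_sorted n w}"
  have us: "uniquely_sorted n w \<longleftrightarrow> next_greater w \<in> W" if "w \<in> affine_perms n" for w
  proof -
    have "equivariant n (next_greater w)"
      using bracketing_next_greater[OF n1, of w] that
        by (auto simp: affine_perms_iff bij_is_inj bracketing_def)
    then show ?thesis
      using uniquely_sorted_iff_dyck_window[OF assms] that
        by (simp add: W_def periodic_dyck_bracketings_def n_def)
  qed
  have ex: "\<exists>w\<in>affine_perms n. avoids_231 w \<and> next_greater w = p" if "p \<in> W" for p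
    using that bracketing_if_dyck_window[OF assms]
    by (intro exists_231_avoiding_of_bracketing[OF n1]) (auto simp: W_def periodic_dyck_bracketings_def n_def)
  have "bij_betw next_greater A W" unfolding bij_betw_def
  proof
    show "inj_on next_greater A"
      using avoids_231_unique[OF n1] by (auto simp: inj_on_def A_def)
    show "next_greater ` A = W"
    proof (intro equalityI subsetI)
      fix p assume "p \<in> next_greater ` A"
      then show "p \<in> W" using us by (auto simp: A_def)
    next
      fix p assume "p \<in> W"
      then obtain w where "w \<in> affine_perms n" "avoids_231 w" "next_greater w = p" using ex by blast
      then show "p \<in> next_greater ` A" using us \<open>p \<in> W\<close> by (auto simp: A_def)
    qed
  qed
  then have A: "card A = card W" "finite A \<longleftrightarrow> finite W"
    by (auto dest: bij_betw_same_card bij_betw_finite)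
  \<comment> \<open>\<open>C p\<close> is the sylvester class with bracketing \<open>p\<close>; it
    is nonempty for \<open>p\<close> in \<open>W\<close>, which makes \<open>C\<close> injective
    there.\<close>
  define C where "C = (\<lambda>p. {w \<in> affine_perms n. next_greater w = p})"
  have cls: "syl_cong n `` {w} = C (next_greater w)" if "w \<in> affine_perms n" for w
    using that by (auto simp: C_def syl_cong_iff[OF n1])
  have "bij_betw C W (uniquely_sorted_classes n)" unfolding bij_betw_def
  proof
    show "inj_on C W"
    proof (rule inj_onI)
      fix p q assume p: "p \<in> W" and eq: "C p = C q"
      obtain w where "w \<in> affine_perms n" "next_greater w = p" using ex[OF p] by blast
      then have "w \<in> C q" unfolding eq[symmetric] by (simp add: C_def)
      then show "p = q" using \<open>next_greater w = p\<close> by (simp add: C_def)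
    qed
    show "C ` W = uniquely_sorted_classes n"
    proof (intro equalityI subsetI)
      fix X assume "X \<in> C ` W"
      then obtain p where p: "p \<in> W" "X = C p" by blast
      obtain w where w: "w \<in> affine_perms n" "next_greater w = p" using ex[OF p(1)] by blast
      have "X \<in> syl_classes n"
        using quotientI[OF w(1), of "syl_cong n"] unfolding syl_classes_def p(2) cls[OF w(1)] w(2) .
      moreover have "uniquely_sorted n v" if "v \<in> X" for v using that us p by (auto simp: C_def)
      ultimately show "X \<in> uniquely_sorted_classes n" by (simp add: uniquely_sorted_classes_def)
    next
      fix X assume "X \<in> uniquely_sorted_classes n"
      then have X: "X \<in> affine_perms n // syl_cong n" "\<And>w. w \<in> X \<Longrightarrow> uniquely_sorted n w"
        by (auto simp: uniquely_sorted_classes_def syl_classes_def)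
      from X(1) obtain w where w: "w \<in> affine_perms n" "X = syl_cong n `` {w}" by (rule quotientE)
      then have Xw: "X = C (next_greater w)" using cls by simp
      moreover have "w \<in> X" unfolding Xw using w by (simp add: C_def)
      ultimately show "X \<in> C ` W" using us[OF w(1)] X(2) by blast
    qed
  qed
  then have C: "card W = card (uniquely_sorted_classes n)" "finite W \<longleftrightarrow> finite (uniquely_sorted_classes n)"
    by (auto dest: bij_betw_same_card bij_betw_finite)
  have "finite W" unfolding W_def by (rule real_card_periodic_dyck_bracketings(1)[OF assms])
  then show ?thesis
    using A C card_periodic_dyck_bracketings[OF assms]
      unfolding n_def[symmetric] A_def[symmetric] W_def[symmetric]
    by simp
qed

end
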